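(* Let $R$ be a number ring, and let $\tilde R$ denote its normalization (integral closure in its field of fractions). The following statements are equivalent: (i) every ideal of $R$ can be generated by $3$ elements; (ii) every ring $R'$ with $R\subseteq R'\subseteq \tilde R$ is super-multiplicative.
   Context: A number ring is a subring of a number field (a finite extension of $\mathbb{Q}$). For a commutative ring $A$ and an ideal $I$ of $A$ with $[A:I]$ finite, the norm is $N(I)=[A:I]$ (index as additive groups). A commutative ring $A$ is called super-multiplicative if for every pair of $A$-ideals $I,J$ such that $[A:IJ]$ is finite one has $N(IJ)\geq N(I)N(J)$. *)

theory Defs
  imports "HOL-Computational_Algebra.Polynomial"
begin

definition subring_of :: "'a::field_char_0 set \<Rightarrow> bool" where
  "subring_of R \<longleftrightarrow> 0 \<in> R \<and> 1 \<in> R \<and>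
     (\<forall>x\<in>R. \<forall>y\<in>R. x + y \<in> R \<and> x - y \<in> R \<and> x * y \<in> R)"

definition frac_field :: "'a::field_char_0 set \<Rightarrow> 'a set" where
  "frac_field R = {a / b | a b. a \<in> R \<and> b \<in> R \<and> b \<noteq> 0}"

text \<open>A number ring: a subring whose fraction field is a finite extension of Q,
  i.e. lies in a finite-dimensional Q-subspace of the ambient field.\<close>
definition number_ring :: "'a::field_char_0 set \<Rightarrow> bool" where
  "number_ring R \<longleftrightarrow> subring_of R \<and>
     (\<exists>B. finite B \<and> frac_field R \<subseteq> {\<Sum>b\<in>B. of_rat (c b) * b | c. True})"

definition integral_over :: "'a::field_char_0 set \<Rightarrow> 'a \<Rightarrow> bool" where
  "integral_over R x \<longleftrightarrow>
     (\<exists>p. lead_coeff p = 1 \<and> (\<forall>i. coeff p i \<in> R) \<and> poly p x = 0)"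

definition normalization_of :: "'a::field_char_0 set \<Rightarrow> 'a set" where
  "normalization_of R = {x \<in> frac_field R. integral_over R x}"

definition ideal_of :: "'a::field_char_0 set \<Rightarrow> 'a set \<Rightarrow> bool" where
  "ideal_of A I \<longleftrightarrow> I \<subseteq> A \<and> 0 \<in> I \<and>
     (\<forall>x\<in>I. \<forall>y\<in>I. x + y \<in> I) \<and> (\<forall>r\<in>A. \<forall>x\<in>I. r * x \<in> I)"

definition prod_ideal_of :: "'a::field_char_0 set \<Rightarrow> 'a set \<Rightarrow> 'a set" where
  "prod_ideal_of I J = {\<Sum>k<n. a k * b k | (n::nat) a b. \<forall>k<n. a k \<in> I \<and> b k \<in> J}"

definition cosets_of :: "'a::field_char_0 set \<Rightarrow> 'a set \<Rightarrow> 'a set set" where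
  "cosets_of A I = {(\<lambda>i. x + i) ` I | x. x \<in> A}"

definition idl_norm :: "'a::field_char_0 set \<Rightarrow> 'a set \<Rightarrow> nat" where
  "idl_norm A I = card (cosets_of A I)"

definition super_multiplicative :: "'a::field_char_0 set \<Rightarrow> bool" where
  "super_multiplicative A \<longleftrightarrow>
     (\<forall>I J. ideal_of A I \<and> ideal_of A J \<and> finite (cosets_of A (prod_ideal_of I J)) \<longrightarrow>
        idl_norm A (prod_ideal_of I J) \<ge> idl_norm A I * idl_norm A J)"

definition generated_by_3 :: "'a::field_char_0 set \<Rightarrow> 'a set \<Rightarrow> bool" where
  "generated_by_3 A I \<longleftrightarrow> (\<exists>a\<in>A. \<exists>b\<in>A. \<exists>c\<in>A.
     I = {r * a + s * b + t * c | r s t. r \<in> A \<and> s \<in> A \<and> t \<in> A})"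

end

theory Submission
  imports Defs "HOL-Library.Set_Algebras" "HOL-Library.FuncSet"
begin

text \<open>
  If \<open>IJ = aJ + cI\<close> for some \<open>a \<in> I\<close> and \<open>c \<in> J\<close>, then multiplication by \<open>c\<close> maps \<open>I/aR\<close> onto \<open>IJ/aJ\<close>,
  whence \<open>N(I) N(J) \<le> N(IJ)\<close>. Such \<open>a\<close> and \<open>c\<close> exist when \<open>IJ\<close> is generated by 3 elements: modulo
  each maximal ideal this is a statement on bilinear maps whose values span a space of dimension at
  most 3, and the local solutions are glued by the Chinese remainder theorem.

  Conversely let \<open>S\<close> be the normalization of \<open>R\<close>, a Pruefer domain with \<open>D S \<subseteq> R\<close> for some \<open>D > 0\<close>. For a
  maximal ideal \<open>m\<close> of \<open>R\<close>, the index \<open>[I : mI]\<close> never exceeds \<open>[S : mS]\<close>; this is seen by counting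
  polynomials and using Gauss' lemma. If \<open>S/mS\<close> has dimension at least 4 over \<open>R/m\<close>, there are \<open>a, b \<in> S\<close>
  such that \<open>1, a, b, ab\<close> are independent modulo \<open>mS\<close>, and then the ideals of \<open>R' = R + mS\<close> proportional to
  \<open>R' + aR\<close> and \<open>R' + bR\<close> violate super-multiplicativity. So \<open>[I : mI] \<le> [R : m]\<^sup>3\<close> for all \<open>m\<close>, and
  the local generators are glued to three global ones.
\<close>

section \<open>Index of additive subgroups\<close>

text \<open>A number ring need not be a lattice (localizations, and even \<open>K\<close> itself,
  are allowed), so finiteness comes from two other facts: an additive group \<open>G\<close> inside
  a finite-dimensional rational space has finite \<open>G/nG\<close>, and every nonzero ideal
  contains a positive integer. Dimensions over \<open>k = A/m\<close> are then read off from
  indices: with \<open>q = [A:m]\<close>, dimension at most 3 means index below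
  \<open>q ^ 4\<close>, and independence means a strict chain of submodules. No localization is
  formed. A local statement at \<open>m\<close> about \<open>X\<close> is one modulo
  \<open>mX\<close>, and \<open>ex_separating_maxid\<close> turns equality modulo every
  \<open>mX\<close> into equality. The violation of super-multiplicativity arises as follows. For
  fractional ideals \<open>X\<close>, \<open>Y\<close> of \<open>R'\<close> that contain
  \<open>R'\<close> and lie in \<open>S\<close>, the condition yields
  \<open>[XY:R'] \<le> [X:R'] [Y:R']\<close>. Both \<open>R' + aR\<close> and \<open>R' + bR\<close>
  have index \<open>q\<close> over \<open>R'\<close>, but their product contains
  \<open>1, a, b, ab\<close> and has index at least \<open>q ^ 3\<close>. The constant
  \<open>D\<close> scales such fractional ideals into \<open>R'\<close>; its existence is the
  arithmetic input and rests on the trace form.\<close>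

definition add_subgroup :: "'a::field_char_0 set \<Rightarrow> bool" where
  "add_subgroup X \<longleftrightarrow> 0 \<in> X \<and> (\<forall>x\<in>X. \<forall>y\<in>X. x - y \<in> X)"

lemma add_subgroupD:
  assumes "add_subgroup X"
  shows "0 \<in> X" "x \<in> X \<Longrightarrow> y \<in> X \<Longrightarrow> x - y \<in> X" "x \<in> X \<Longrightarrow> - x \<in> X"
    "x \<in> X \<Longrightarrow> y \<in> X \<Longrightarrow> x + y \<in> X"
proof -
  show *: "0 \<in> X" and **: "x \<in> X \<Longrightarrow> y \<in> X \<Longrightarrow> x - y \<in> X" for x y
    using assms by (auto simp: add_subgroup_def)
  show ***: "x \<in> X \<Longrightarrow> - x \<in> X" for x
    using **[OF *, of x] by simp
  show "x \<in> X \<Longrightarrow> y \<in> X \<Longrightarrow> x + y \<in> X"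
    using **[of x "- y"] ***[of y] by simp
qed

lemma add_subgroup_sum: "add_subgroup X \<Longrightarrow> (\<And>i. i \<in> S \<Longrightarrow> f i \<in> X) \<Longrightarrow> sum f S \<in> X"
  by (induction S rule: infinite_finite_induct) (auto intro: add_subgroupD)

lemma add_subgroup_of_nat: "add_subgroup X \<Longrightarrow> x \<in> X \<Longrightarrow> of_nat n * x \<in> X"
  by (induction n) (auto simp: algebra_simps intro: add_subgroupD)

lemma add_subgroup_of_int: "add_subgroup X \<Longrightarrow> x \<in> X \<Longrightarrow> of_int n * x \<in> X"
  using add_subgroup_of_nat[of X x] add_subgroupD(3)[of X]
  by (cases n rule: int_cases2) auto

lemma add_subgroup_scale: "add_subgroup X \<Longrightarrow> add_subgroup (a *o X)"
  by (auto simp: add_subgroup_def elt_set_times_def) (metis right_diff_distrib)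

lemma elt_set_timesI: "x \<in> X \<Longrightarrow> y = a * x \<Longrightarrow> y \<in> a *o X"
  by (auto simp: elt_set_times_def)

lemma elt_set_timesE: "y \<in> a *o X \<Longrightarrow> (\<And>x. x \<in> X \<Longrightarrow> y = a * x \<Longrightarrow> P) \<Longrightarrow> P"
  by (auto simp: elt_set_times_def)

lemma set_plusI: "x \<in> X \<Longrightarrow> y \<in> Y \<Longrightarrow> z = x + y \<Longrightarrow> z \<in> X + Y"
  by (auto simp: set_plus_def)

lemma set_plusE: "z \<in> X + Y \<Longrightarrow> (\<And>x y. x \<in> X \<Longrightarrow> y \<in> Y \<Longrightarrow> z = x + y \<Longrightarrow> P) \<Longrightarrow> P"
  by (auto simp: set_plus_def)

lemma set_plus_subset:
  "add_subgroup Z \<Longrightarrow> X \<subseteq> Z \<Longrightarrow> Y \<subseteq> Z \<Longrightarrow> X + Y \<subseteq> Z"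
  by (auto simp: set_plus_def intro: add_subgroupD)

lemma subset_set_plus:
  assumes "add_subgroup X" "add_subgroup Y"
  shows "X \<subseteq> X + Y" "Y \<subseteq> X + Y"
  using add_subgroupD(1)[OF assms(1)] add_subgroupD(1)[OF assms(2)]
  by (auto simp: set_plus_def) (metis add.right_neutral, metis add.left_neutral)

lemma cosets_of_image: "cosets_of X Y = (\<lambda>x. (+) x ` Y) ` X"
  by (auto simp: cosets_of_def)

lemma coset_eq_iff:
  assumes "add_subgroup Y"
  shows "(+) x ` Y = (+) y ` Y \<longleftrightarrow> x - y \<in> Y"
proof
  assume "(+) x ` Y = (+) y ` Y"
  then have "x + 0 \<in> (+) y ` Y"
    using add_subgroupD(1)[OF assms] by (metis imageI)
  then show "x - y \<in> Y" by auto
next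
  assume xy: "x - y \<in> Y"
  have "(+) a ` Y \<subseteq> (+) b ` Y" if "a - b \<in> Y" for a b
  proof
    fix z assume "z \<in> (+) a ` Y"
    then obtain u where u: "u \<in> Y" "z = a + u" by auto
    then have "(a - b) + u \<in> Y" using that assms by (intro add_subgroupD(4))
    then show "z \<in> (+) b ` Y" using u by (intro image_eqI[of _ _ "(a - b) + u"]) auto
  qed
  from this[of x y] this[of y x] xy add_subgroupD(3)[OF assms xy]
  show "(+) x ` Y = (+) y ` Y" by simp
qed

text \<open>Indices are counted through representatives, so that the tower law becomes a bijection
  from \<open>T \<times> T'\<close> to \<open>T + T'\<close>, and infinite index is treated together
  with finite index.\<close>

definition transversal :: "'a::field_char_0 set \<Rightarrow> 'a set \<Rightarrow> 'a set \<Rightarrow> bool" where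
  "transversal T X Y \<longleftrightarrow> T \<subseteq> X \<and> (\<forall>x\<in>X. \<exists>!t. t \<in> T \<and> x - t \<in> Y)"

lemma ex_transversal:
  assumes "add_subgroup Y"
  obtains T where "transversal T X Y"
proof -
  obtain T where T: "T \<subseteq> X" "inj_on (\<lambda>x. (+) x ` Y) T" "cosets_of X Y = (\<lambda>x. (+) x ` Y) ` T"
    using subset_image_inj[of "cosets_of X Y" "\<lambda>x. (+) x ` Y" X] by (auto simp: cosets_of_image)
  have "\<exists>!t. t \<in> T \<and> x - t \<in> Y" if "x \<in> X" for x
  proof -
    have "(+) x ` Y \<in> (\<lambda>x. (+) x ` Y) ` T" using T(3) that by (auto simp: cosets_of_image)
    then obtain t where "t \<in> T" "(+) x ` Y = (+) t ` Y" by blast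
    moreover have "s = t" if "s \<in> T" "x - s \<in> Y" for s
      using T(2) coset_eq_iff[OF assms, of x] calculation that by (metis inj_onD)
    ultimately show ?thesis using coset_eq_iff[OF assms, of x] by blast
  qed
  with T show ?thesis by (intro that[of T]) (auto simp: transversal_def)
qed

lemma transversal_bij:
  assumes "add_subgroup Y" "transversal T X Y"
  shows "bij_betw (\<lambda>x. (+) x ` Y) T (cosets_of X Y)"
  unfolding bij_betw_def
proof
  show "inj_on (\<lambda>x. (+) x ` Y) T"
  proof (rule inj_onI)
    fix s t assume st: "s \<in> T" "t \<in> T" "(+) s ` Y = (+) t ` Y"
    then have "s - t \<in> Y" "s - s \<in> Y" using coset_eq_iff[OF assms(1)] add_subgroupD(1)[OF assms(1)] by auto
    then show "s = t" using st assms(2) unfolding transversal_def by blast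
  qed
  show "(\<lambda>x. (+) x ` Y) ` T = cosets_of X Y"
    unfolding cosets_of_image using assms(2) coset_eq_iff[OF assms(1)]
    by (auto simp: transversal_def image_iff) blast
qed

lemma transversal_card:
  assumes "add_subgroup Y" "transversal T X Y"
  shows "card T = idl_norm X Y" "finite T \<longleftrightarrow> finite (cosets_of X Y)"
  using transversal_bij[OF assms] by (auto simp: idl_norm_def bij_betw_same_card bij_betw_finite)

lemma transversal_unique:
  "transversal T X Y \<Longrightarrow> x \<in> X \<Longrightarrow> s \<in> T \<Longrightarrow> t \<in> T \<Longrightarrow> x - s \<in> Y \<Longrightarrow> x - t \<in> Y \<Longrightarrow> s = t"
  by (auto simp: transversal_def)

lemma transversal_tower:
  assumes "add_subgroup Z" "add_subgroup Y" "add_subgroup X" "Z \<subseteq> Y" "Y \<subseteq> X"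
    and T: "transversal T X Y" and T': "transversal T' Y Z"
  shows "transversal (T + T') X Z" "bij_betw (\<lambda>(t, t'). t + t') (T \<times> T') (T + T')"
proof -
  have TX: "T \<subseteq> X" "T' \<subseteq> Y" using T T' by (auto simp: transversal_def)
  have uniq: "s = t \<and> s' = t'"
    if "s \<in> T" "t \<in> T" "s' \<in> T'" "t' \<in> T'" "x \<in> X" "x - (s + s') \<in> Z" "x - (t + t') \<in> Z" for s t s' t' x
  proof -
    have *: "x - r \<in> Y" if "x - (r + r') \<in> Z" "r' \<in> T'" for r r'
    proof -
      have "x - (r + r') + r' \<in> Y" using that assms(4) TX by (intro add_subgroupD(4)[OF assms(2)]) auto
      then show ?thesis by simp
    qed
    then have st: "s = t" using transversal_unique[OF T] that by blast
    have "x - s \<in> Y" using * that by blast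
    moreover have "x - s - s' \<in> Z" "x - s - t' \<in> Z" using that st by (auto simp: algebra_simps)
    ultimately show ?thesis using st transversal_unique[OF T'] that by blast
  qed
  show "transversal (T + T') X Z"
    unfolding transversal_def
  proof (intro conjI ballI)
    show "T + T' \<subseteq> X" using TX assms by (intro set_plus_subset) auto
    fix x assume x: "x \<in> X"
    obtain t where t: "t \<in> T" "x - t \<in> Y" using T x unfolding transversal_def by blast
    obtain t' where t': "t' \<in> T'" "x - t - t' \<in> Z" using T' t unfolding transversal_def by blast
    show "\<exists>!t. t \<in> T + T' \<and> x - t \<in> Z"
    proof (rule ex1I[of _ "t + t'"])
      show "t + t' \<in> T + T' \<and> x - (t + t') \<in> Z" using t t' by (auto simp: diff_diff_eq)
      fix u assume "u \<in> T + T' \<and> x - u \<in> Z"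
      then obtain s s' where "s \<in> T" "s' \<in> T'" "u = s + s'" "x - (s + s') \<in> Z" by (auto elim!: set_plusE)
      then show "u = t + t'" using uniq[of s t s' t' x] t t' x by (auto simp: algebra_simps)
    qed
  qed
  show "bij_betw (\<lambda>(t, t'). t + t') (T \<times> T') (T + T')"
    unfolding bij_betw_def
  proof
    show "inj_on (\<lambda>(t, t'). t + t') (T \<times> T')"
    proof (rule inj_onI, clarify)
      fix s s' t t' assume "s \<in> T" "s' \<in> T'" "t \<in> T" "t' \<in> T'" "s + s' = t + t'"
      then show "s = t \<and> s' = t'"
        using uniq[of s t s' t' "s + s'"] add_subgroupD(1)[OF assms(1)] add_subgroupD(4)[OF assms(3), of s s'] TX assms(5)
        by auto
    qed
    show "(\<lambda>(t, t'). t + t') ` (T \<times> T') = T + T'" by (rule set_plus_image[symmetric])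
  qed
qed

text \<open>If an index is infinite, both sides of the formula are 0 by the convention of
  \<open>card\<close>; the second claim keeps track of finiteness.\<close>

lemma index_tower:
  assumes "add_subgroup Z" "add_subgroup Y" "add_subgroup X" "Z \<subseteq> Y" "Y \<subseteq> X"
  shows "idl_norm X Z = idl_norm X Y * idl_norm Y Z"
    and "finite (cosets_of X Z) \<longleftrightarrow> finite (cosets_of X Y) \<and> finite (cosets_of Y Z)"
proof -
  obtain T T' where T: "transversal T X Y" "transversal T' Y Z"
    using ex_transversal assms(1,2) by meson
  note tow = transversal_tower[OF assms T]
  note c = transversal_card[OF assms(2) T(1)] transversal_card[OF assms(1) T(2)]
    transversal_card[OF assms(1) tow(1)]
  show "idl_norm X Z = idl_norm X Y * idl_norm Y Z"
    using bij_betw_same_card[OF tow(2)] c by (simp add: card_cartesian_product)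
  have "T \<noteq> {}" "T' \<noteq> {}" using T add_subgroupD(1)[OF assms(3)] add_subgroupD(1)[OF assms(2)]
    by (auto simp: transversal_def)
  then show "finite (cosets_of X Z) \<longleftrightarrow> finite (cosets_of X Y) \<and> finite (cosets_of Y Z)"
    using bij_betw_finite[OF tow(2)] c by (auto simp: finite_cartesian_product_iff)
qed

lemma idl_norm_pos:
  assumes "finite (cosets_of X Y)" "X \<noteq> {}"
  shows "idl_norm X Y > 0"
  using assms by (auto simp: idl_norm_def cosets_of_image card_gt_0_iff)

lemma idl_norm_eq_1_iff:
  assumes "add_subgroup Y" "add_subgroup X" "Y \<subseteq> X"
  shows "idl_norm X Y = 1 \<longleftrightarrow> X = Y"
proof
  assume "idl_norm X Y = 1"
  then obtain c where c: "cosets_of X Y = {c}" by (auto simp: idl_norm_def card_1_singleton_iff)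
  have "x \<in> Y" if "x \<in> X" for x
  proof -
    have "(+) x ` Y = (+) 0 ` Y" using c that add_subgroupD(1)[OF assms(2)]
      unfolding cosets_of_image by (metis (mono_tags, lifting) imageI singletonD)
    then show ?thesis using coset_eq_iff[OF assms(1), of x 0] by simp
  qed
  with assms(3) show "X = Y" by auto
next
  assume "X = Y"
  then have "cosets_of X Y = {Y}" using coset_eq_iff[OF assms(1), of _ 0] add_subgroupD(1)[OF assms(2)]
    by (auto simp: cosets_of_image image_iff intro!: bexI[of _ 0])
  then show "idl_norm X Y = 1" by (simp add: idl_norm_def)
qed

text \<open>\<open>f\<close> induces a surjection from \<open>X/Y\<close> onto \<open>X'/Y'\<close>.
  Since it only has to respect cosets, it may be a choice function, as in
  \<open>index_adjoin\<close>.\<close>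

lemma index_image_le:
  assumes "add_subgroup Y" "add_subgroup Y'" "finite (cosets_of X Y)"
    and add: "\<And>x y. x \<in> X \<Longrightarrow> y \<in> X \<Longrightarrow> x - y \<in> Y \<Longrightarrow> f x - f y \<in> Y'"
    and surj: "\<And>x'. x' \<in> X' \<Longrightarrow> \<exists>x\<in>X. x' - f x \<in> Y'"
  shows "idl_norm X' Y' \<le> idl_norm X Y" "finite (cosets_of X' Y')"
proof -
  obtain T where T: "transversal T X Y" using ex_transversal assms(1) by meson
  have fin: "finite T" "card T = idl_norm X Y" using transversal_card[OF assms(1) T] assms(3) by auto
  have "cosets_of X' Y' \<subseteq> (\<lambda>t. (+) (f t) ` Y') ` T"
  proof
    fix c assume "c \<in> cosets_of X' Y'"
    then obtain x' where x': "x' \<in> X'" "c = (+) x' ` Y'" by (auto simp: cosets_of_image)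
    obtain x where x: "x \<in> X" "x' - f x \<in> Y'" using surj x' by blast
    obtain t where t: "t \<in> T" "x - t \<in> Y" using T x unfolding transversal_def by blast
    have tX: "t \<in> X" using t T by (auto simp: transversal_def)
    have "(x' - f x) + (f x - f t) \<in> Y'" using x t add tX assms(2) by (intro add_subgroupD(4)) auto
    then have "c = (+) (f t) ` Y'" using x' coset_eq_iff[OF assms(2)] by auto
    then show "c \<in> (\<lambda>t. (+) (f t) ` Y') ` T" using t by blast
  qed
  with fin show "finite (cosets_of X' Y')" "idl_norm X' Y' \<le> idl_norm X Y"
    by (auto simp: idl_norm_def intro: finite_subset)
       (metis card_image_le card_mono finite_imageI le_trans)
qed

lemma index_scale:
  assumes "add_subgroup Y" "a \<noteq> 0"
  shows "idl_norm (a *o X) (a *o Y) = idl_norm X Y"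
    "finite (cosets_of (a *o X) (a *o Y)) \<longleftrightarrow> finite (cosets_of X Y)"
proof -
  have eq: "cosets_of (a *o X) (a *o Y) = (`) ((*) a) ` cosets_of X Y"
    by (force simp: cosets_of_image elt_set_times_def image_image image_iff distrib_left)
  have inj: "inj_on ((`) ((*) a)) (cosets_of X Y)"
    using assms(2) by (auto intro!: inj_onI simp: inj_image_eq_iff inj_on_def)
  show "idl_norm (a *o X) (a *o Y) = idl_norm X Y"
    "finite (cosets_of (a *o X) (a *o Y)) \<longleftrightarrow> finite (cosets_of X Y)"
    unfolding idl_norm_def eq using inj by (auto simp: card_image finite_image_iff)
qed

section \<open>Rational subspaces and lattices\<close>

interpretation rat: vector_space "\<lambda>q (x::'a::field_char_0). of_rat q * x"
  by unfold_locales (auto simp: algebra_simps of_rat_add of_rat_mult)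

definition zspan :: "'a::field_char_0 set \<Rightarrow> 'a set" where
  "zspan W = range (\<lambda>c::'a \<Rightarrow> int. \<Sum>w\<in>W. of_int (c w) * w)"

lemma zspanI: "x = (\<Sum>w\<in>W. of_int (c w) * w) \<Longrightarrow> x \<in> zspan W"
  by (auto simp: zspan_def)

lemma zspanE:
  assumes "x \<in> zspan W"
  obtains c :: "'a::field_char_0 \<Rightarrow> int" where "x = (\<Sum>w\<in>W. of_int (c w) * w)"
  using assms by (auto simp: zspan_def)

lemma add_subgroup_zspan: "add_subgroup (zspan W)"
  unfolding add_subgroup_def
proof (intro conjI ballI)
  show "0 \<in> zspan W" by (rule zspanI[of _ "\<lambda>_. 0"]) simp
  fix x y assume "x \<in> zspan W" "y \<in> zspan W"
  then obtain c d :: "'a \<Rightarrow> int"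
    where "x = (\<Sum>w\<in>W. of_int (c w) * w)" "y = (\<Sum>w\<in>W. of_int (d w) * w)"
    by (auto elim!: zspanE)
  then show "x - y \<in> zspan W"
    by (intro zspanI[of _ "\<lambda>w. c w - d w"]) (simp add: sum_subtractf algebra_simps)
qed

lemma zspan_minimal: "add_subgroup X \<Longrightarrow> W \<subseteq> X \<Longrightarrow> zspan W \<subseteq> X"
  by (auto elim!: zspanE intro!: add_subgroup_sum add_subgroup_of_int)

lemma zspan_base:
  assumes "finite W" "w \<in> W"
  shows "w \<in> zspan W"
proof (rule zspanI[of _ "\<lambda>v. if v = w then 1 else 0"])
  have "(\<Sum>v\<in>W. of_int (if v = w then 1 else 0) * v) = (\<Sum>v\<in>W. if v = w then v else 0)"
    by (intro sum.cong) auto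
  then show "w = (\<Sum>v\<in>W. of_int (if v = w then 1 else 0) * v)"
    using assms by simp
qed

lemma zspan_mono: "finite W \<Longrightarrow> V \<subseteq> W \<Longrightarrow> zspan V \<subseteq> zspan W"
  by (intro zspan_minimal add_subgroup_zspan) (auto intro: zspan_base)

lemma zspan_subset_span: "zspan W \<subseteq> rat.span W"
proof
  fix x assume "x \<in> zspan W"
  then obtain c :: "'a \<Rightarrow> int" where c: "x = (\<Sum>w\<in>W. of_int (c w) * w)" by (rule zspanE)
  have "of_int (c w) * w \<in> rat.span W" if "w \<in> W" for w
    using rat.span_scale[OF rat.span_base[OF that], of "of_int (c w)"] by simp
  then show "x \<in> rat.span W" unfolding c by (rule rat.span_sum)
qed

lemma zspan_insert:
  assumes "finite W"
  shows "x \<in> zspan (insert w W) \<longleftrightarrow> (\<exists>c. x - of_int c * w \<in> zspan W)"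
proof
  assume "x \<in> zspan (insert w W)"
  then obtain c :: "'a \<Rightarrow> int" where c: "x = (\<Sum>v\<in>insert w W. of_int (c v) * v)" by (rule zspanE)
  show "\<exists>c. x - of_int c * w \<in> zspan W"
  proof (cases "w \<in> W")
    case True
    then show ?thesis using c by (intro exI[of _ 0] zspanI[of _ c]) (simp add: insert_absorb)
  next
    case False
    then show ?thesis using c assms by (intro exI[of _ "c w"] zspanI[of _ c]) simp
  qed
next
  assume "\<exists>c. x - of_int c * w \<in> zspan W"
  then obtain c where c: "x - of_int c * w \<in> zspan (insert w W)"
    using zspan_mono[of "insert w W" W] assms by blast
  have "of_int c * w \<in> zspan (insert w W)"
    using assms by (intro add_subgroup_of_int add_subgroup_zspan zspan_base) auto
  from add_subgroupD(4)[OF add_subgroup_zspan c this] show "x \<in> zspan (insert w W)" by simp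
qed

text \<open>The \<open>w\<close>-coordinates occurring in \<open>H\<close> form a subgroup of the
  integers. An element \<open>h0\<close> realizing its positive generator, added to a basis of the
  part of \<open>H\<close> without \<open>w\<close>-component, gives a basis of
  \<open>H\<close>.\<close>

lemma sublattice_basis:
  assumes "finite W" "rat.independent W" "add_subgroup H" "H \<subseteq> zspan W"
  shows "\<exists>V. finite V \<and> rat.independent V \<and> card V \<le> card W \<and> H = zspan V"
  using assms
proof (induction W arbitrary: H rule: finite_induct)
  case empty
  then have "H = zspan {}" using add_subgroupD(1)[OF empty(2)] by (auto simp: zspan_def)
  then show ?case using rat.independent_empty by (intro exI[of _ "{}"]) auto
next
  case (insert w W)
  have indW: "rat.independent W" and w: "w \<notin> rat.span W"
    using insert.prems(1) insert.hyps by (auto simp: rat.independent_insert)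
  define H0 where "H0 = H \<inter> zspan W"
  have "add_subgroup H0" using insert.prems(2) add_subgroup_zspan[of W]
    by (auto simp: H0_def add_subgroup_def)
  then obtain V where V: "finite V" "rat.independent V" "card V \<le> card W" "H0 = zspan V"
    using insert.IH[OF indW, of H0] by (auto simp: H0_def)
  have dec: "\<exists>c. h - of_int c * w \<in> zspan W" if "h \<in> H" for h
    using insert.prems(3) that zspan_insert[OF insert.hyps(1)] by blast
  define C where "C = {c::int. \<exists>h\<in>H. h - of_int c * w \<in> zspan W}"
  have Cdiff: "a - k * b \<in> C" if ab: "a \<in> C" "b \<in> C" for a b k
  proof -
    obtain g h where gh: "g \<in> H" "g - of_int a * w \<in> zspan W" "h \<in> H" "h - of_int b * w \<in> zspan W"
      using ab by (auto simp: C_def)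
    have "(g - of_int a * w) - of_int k * (h - of_int b * w) \<in> zspan W"
      using add_subgroupD(2)[OF add_subgroup_zspan gh(2) add_subgroup_of_int[OF add_subgroup_zspan gh(4)]] .
    moreover have "g - of_int k * h \<in> H"
      using gh insert.prems(2) by (intro add_subgroupD(2) add_subgroup_of_int)
    ultimately show ?thesis by (auto simp: C_def algebra_simps intro!: bexI[of _ "g - of_int k * h"])
  qed
  show ?case
  proof (cases "C \<subseteq> {0}")
    case True
    then have "H \<subseteq> zspan W" using dec by (force simp: C_def)
    then have "H = H0" by (auto simp: H0_def)
    then show ?thesis using V insert.hyps by (intro exI[of _ V]) auto
  next
    case False
    then obtain c where c: "c \<in> C" "c \<noteq> 0" by auto
    have "- c \<in> C" using Cdiff[of c c 2] c by simp
    with c have "\<exists>n. n > 0 \<and> int n \<in> C"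
      by (cases "c > 0") (force intro: exI[of _ "nat \<bar>c\<bar>"])+
    then obtain d where d: "d > 0" "int d \<in> C" "\<And>n. n < d \<Longrightarrow> n > 0 \<Longrightarrow> int n \<notin> C"
      using exists_least_iff[of "\<lambda>n. n > 0 \<and> int n \<in> C"] by blast
    have dvd: "int d dvd c" if "c \<in> C" for c
    proof -
      have "c mod int d \<in> C" using Cdiff[OF that d(2), of "c div int d"]
        by (simp add: minus_div_mult_eq_mod)
      moreover have "c mod int d \<ge> 0" "c mod int d < int d" using d by auto
      ultimately have "c mod int d = 0" using d(3)[of "nat (c mod int d)"] by force
      then show ?thesis by auto
    qed
    obtain h0 where h0: "h0 \<in> H" "h0 - of_int (int d) * w \<in> zspan W"
      using d(2) by (auto simp: C_def)
    have h0span: "h0 \<notin> rat.span W"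
    proof
      assume "h0 \<in> rat.span W"
      moreover have "h0 - of_nat d * w \<in> rat.span W" using h0 zspan_subset_span by auto
      ultimately have "h0 - (h0 - of_nat d * w) \<in> rat.span W" by (rule rat.span_diff)
      then have "of_rat (1 / of_nat d) * (of_nat d * w) \<in> rat.span W"
        by (intro rat.span_scale) simp
      then have "w \<in> rat.span W" using d(1) by (simp add: of_rat_divide)
      then show False using w by simp
    qed
    have Vspan: "rat.span V \<subseteq> rat.span W"
    proof (rule rat.span_minimal)
      show "V \<subseteq> rat.span W" using V(1,4) zspan_base[of V] zspan_subset_span[of W]
        by (auto simp: H0_def)
    qed auto
    have "rat.independent (insert h0 V)"
      using V(2) h0span Vspan by (intro rat.independent_insertI) auto
    moreover have "H = zspan (insert h0 V)"
    proof (intro equalityI subsetI)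
      fix h assume h: "h \<in> H"
      obtain c where c: "h - of_int c * w \<in> zspan W" using dec[OF h] by blast
      then obtain k where k: "c = int d * k" using dvd[of c] h by (auto simp: C_def)
      have "(h - of_int c * w) - of_int k * (h0 - of_int (int d) * w) \<in> zspan W"
        using add_subgroupD(2)[OF add_subgroup_zspan c add_subgroup_of_int[OF add_subgroup_zspan h0(2)]] .
      then have "h - of_int k * h0 \<in> zspan W" by (simp add: k algebra_simps)
      moreover have "h - of_int k * h0 \<in> H"
        using h h0 insert.prems(2) by (intro add_subgroupD(2) add_subgroup_of_int)
      ultimately show "h \<in> zspan (insert h0 V)"
        using V zspan_insert[of V h h0] by (auto simp: H0_def)
    next
      have "insert h0 V \<subseteq> H" using h0 V(1,4) zspan_base[of V] by (auto simp: H0_def)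
      then show "h \<in> H" if "h \<in> zspan (insert h0 V)" for h
        using that zspan_minimal[OF insert.prems(2)] by blast
    qed
    moreover have "card (insert h0 V) \<le> card (insert w W)"
      using V insert.hyps by (simp add: card_insert_if)
    ultimately show ?thesis using V(1) by blast
  qed
qed

lemma common_denominator:
  assumes "finite W" "finite F" "F \<subseteq> rat.span W"
  shows "\<exists>d>0. \<forall>x\<in>F. of_nat d * x \<in> zspan W"
  using assms(2,3)
proof (induction F rule: finite_induct)
  case empty
  show ?case by (intro exI[of _ 1]) auto
next
  case (insert x F)
  then obtain d where d: "d > 0" "\<And>y. y \<in> F \<Longrightarrow> of_nat d * y \<in> zspan W" by auto
  obtain u :: "_ \<Rightarrow> rat" where u: "x = (\<Sum>w\<in>W. of_rat (u w) * w)"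
    using insert.prems rat.span_finite[OF assms(1)] by auto
  define e where "e = (\<Prod>w\<in>W. nat (snd (quotient_of (u w))))"
  have e: "e > 0" using assms(1) quotient_of_denom_pos' by (auto simp: e_def intro!: prod_pos)
  have "\<exists>c::int. of_nat e * u w = of_int c" if "w \<in> W" for w
  proof -
    have "nat (snd (quotient_of (u w))) dvd e"
      unfolding e_def using assms(1) that by (intro dvd_prodI)
    then obtain k where k: "e = nat (snd (quotient_of (u w))) * k" by auto
    have "u w = of_int (fst (quotient_of (u w))) / of_int (snd (quotient_of (u w)))"
      by (simp add: quotient_of_div)
    then have "of_int (snd (quotient_of (u w))) * u w = of_int (fst (quotient_of (u w)))"
      using quotient_of_denom_pos'[of "u w"] by (simp add: field_simps)
    moreover have "of_nat e = (of_int (snd (quotient_of (u w))) :: rat) * of_nat k"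
      unfolding k using quotient_of_denom_pos'[of "u w"] by (simp add: of_nat_nat)
    ultimately have "of_nat e * u w = of_int (fst (quotient_of (u w)) * int k)"
      by simp
    then show ?thesis by blast
  qed
  then obtain c :: "_ \<Rightarrow> int" where c: "\<And>w. w \<in> W \<Longrightarrow> of_nat e * u w = of_int (c w)" by metis
  have ex: "of_nat e * x \<in> zspan W"
  proof (rule zspanI[of _ c])
    have "of_nat e * (of_rat (u w) * w) = of_int (c w) * w" if "w \<in> W" for w
      using arg_cong[OF c[OF that], of "of_rat :: rat \<Rightarrow> 'a"] by (simp add: of_rat_mult flip: mult.assoc)
    then show "of_nat e * x = (\<Sum>w\<in>W. of_int (c w) * w)"
      unfolding u sum_distrib_left by (intro sum.cong) auto
  qed
  show ?case
  proof (intro exI[of _ "d * e"] conjI ballI)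
    show "d * e > 0" using d e by simp
    fix y assume "y \<in> insert x F"
    then consider "y = x" | "y \<in> F" by auto
    then show "of_nat (d * e) * y \<in> zspan W"
    proof cases
      case 1
      then show ?thesis using add_subgroup_of_nat[OF add_subgroup_zspan ex, of d] by (simp add: algebra_simps)
    next
      case 2
      then show ?thesis using add_subgroup_of_nat[OF add_subgroup_zspan d(2)[OF 2], of e] by (simp add: algebra_simps)
    qed
  qed
qed

text \<open>\<open>G\<close> may be far from a lattice (it may contain all fractions whose
  denominator is a power of 2), so it need not have a basis. Instead, every finite set of pairwise
  incongruent elements spans, up to a denominator, a lattice of rank at most \<open>card W\<close>,
  which bounds its size uniformly by \<open>n ^ card W\<close>.\<close>

lemma finite_index_multiple:
  assumes "finite B" "add_subgroup G" "G \<subseteq> rat.span B" "n > 0"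
  shows "finite (cosets_of G (of_nat n *o G))"
proof -
  obtain W where W: "W \<subseteq> B" "rat.independent W" "B \<subseteq> rat.span W"
    by (rule rat.maximal_independent_subset)
  have finW: "finite W" using W assms(1) finite_subset by blast
  have GW: "G \<subseteq> rat.span W" using assms(3) W(3) rat.span_minimal[of B "rat.span W"] by auto
  have bound: "card F \<le> n ^ card W"
    if F: "finite F" "F \<subseteq> G" "\<And>x y. x \<in> F \<Longrightarrow> y \<in> F \<Longrightarrow> x - y \<in> of_nat n *o G \<Longrightarrow> x = y" for F
  proof -
    obtain d where d: "d > 0" "\<And>x. x \<in> F \<Longrightarrow> of_nat d * x \<in> zspan W"
      using common_denominator[OF finW F(1)] F(2) GW by blast
    define H where "H = zspan ((*) (of_nat d) ` F)"
    have "H \<subseteq> zspan W" unfolding H_def using d by (intro zspan_minimal add_subgroup_zspan) auto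
    then obtain V where V: "finite V" "rat.independent V" "card V \<le> card W" "H = zspan V"
      using sublattice_basis[OF finW W(2), of H] by (auto simp: H_def add_subgroup_zspan)
    have "\<exists>c::_ \<Rightarrow> int. of_nat d * x = (\<Sum>v\<in>V. of_int (c v) * v)" if "x \<in> F" for x
    proof -
      have "of_nat d * x \<in> H" using that F(1) by (auto simp: H_def intro!: zspan_base)
      then show ?thesis unfolding V by (auto simp: zspan_def)
    qed
    then obtain c :: "'a \<Rightarrow> 'a \<Rightarrow> int"
      where c: "\<And>x. x \<in> F \<Longrightarrow> of_nat d * x = (\<Sum>v\<in>V. of_int (c x v) * v)" by metis
    define \<phi> where "\<phi> = (\<lambda>x. \<lambda>v\<in>V. nat (c x v mod int n))"
    have "\<phi> ` F \<subseteq> V \<rightarrow>\<^sub>E {0..<n}"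
      using assms(4) by (auto simp: \<phi>_def PiE_def extensional_def nat_less_iff)
    moreover have "inj_on \<phi> F"
    proof (rule inj_onI)
      fix x y assume xy: "x \<in> F" "y \<in> F" "\<phi> x = \<phi> y"
      have "\<exists>k. c x v - c y v = int n * k" if "v \<in> V" for v
      proof -
        have "nat (c x v mod int n) = nat (c y v mod int n)"
          using fun_cong[OF xy(3), of v] that by (simp add: \<phi>_def)
        then have "c x v mod int n = c y v mod int n" using assms(4) by (simp add: eq_nat_nat_iff)
        then show ?thesis using mod_eq_dvd_iff[of "c x v" "int n" "c y v"] by (auto simp: dvd_def)
      qed
      then obtain k where k: "\<And>v. v \<in> V \<Longrightarrow> c x v - c y v = int n * k v" by metis
      have "of_nat d * (x - y) = (\<Sum>v\<in>V. of_int (c x v - c y v) * v)"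
        using c[OF xy(1)] c[OF xy(2)] by (simp add: right_diff_distrib left_diff_distrib sum_subtractf)
      also have "\<dots> = of_nat n * (\<Sum>v\<in>V. of_int (k v) * v)"
        unfolding sum_distrib_left by (intro sum.cong) (auto simp: k)
      finally have eq: "of_nat d * (x - y) = of_nat n * (\<Sum>v\<in>V. of_int (k v) * v)" .
      have "(\<Sum>v\<in>V. of_int (k v) * v) \<in> H" using V by (auto intro: zspanI)
      \<comment> \<open>The factor \<open>d\<close> only served to move \<open>F\<close> into a
        lattice. Since \<open>H\<close> consists of \<open>d\<close>-multiples of elements of
        \<open>G\<close>, it cancels from the congruence modulo \<open>n\<close>.\<close>
      moreover have "H \<subseteq> of_nat d *o G" unfolding H_def using F(2)
        by (intro zspan_minimal add_subgroup_scale assms) (auto simp: elt_set_times_def)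
      ultimately obtain g where g: "g \<in> G" "(\<Sum>v\<in>V. of_int (k v) * v) = of_nat d * g"
        by (auto elim: elt_set_timesE)
      have "of_nat d * (x - y) = of_nat d * (of_nat n * g)" using eq g by simp
      then have "x - y = of_nat n * g" using d(1) by simp
      then show "x = y" using F(3) xy g by (auto simp: elt_set_times_def)
    qed
    ultimately have "card F \<le> card (V \<rightarrow>\<^sub>E {0..<n})"
      using V(1) by (intro card_inj_on_le[of \<phi>]) (auto intro: finite_PiE)
    also have "\<dots> = n ^ card V" using V(1) by (simp add: card_PiE)
    also have "\<dots> \<le> n ^ card W" using V(3) assms(4) by (intro power_increasing) auto
    finally show ?thesis .
  qed
  have nG: "add_subgroup (of_nat n *o G)" using assms(2) by (rule add_subgroup_scale)
  obtain T where T: "transversal T G (of_nat n *o G)" using ex_transversal[OF nG] .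
  have "finite T"
  proof (rule ccontr)
    assume "infinite T"
    then obtain F where F: "finite F" "card F = n ^ card W + 1" "F \<subseteq> T"
      using infinite_arbitrarily_large by blast
    have "card F \<le> n ^ card W"
    proof (rule bound)
      show "F \<subseteq> G" using F T by (auto simp: transversal_def)
      fix x y assume "x \<in> F" "y \<in> F" "x - y \<in> of_nat n *o G"
      moreover have "x - x \<in> of_nat n *o G" using add_subgroupD(1)[OF nG] by simp
      ultimately show "x = y" using F T transversal_unique[OF T, of x x y] by (auto simp: transversal_def)
    qed (use F in auto)
    then show False using F by simp
  qed
  then show ?thesis using transversal_card[OF nG T] by simp
qed

section \<open>The trace form and a common denominator for integers\<close>

text \<open>The trace of multiplication by \<open>z\<close> on the span of \<open>W\<close>,
  meaningful if \<open>W\<close> is a basis and the span is stable under \<open>z\<close>.\<close>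

definition rat_trace :: "'a::field_char_0 set \<Rightarrow> 'a \<Rightarrow> rat" where
  "rat_trace W z = (\<Sum>w\<in>W. rat.representation W (z * w) w)"

lemma span_eq_representation:
  "finite W \<Longrightarrow> rat.independent W \<Longrightarrow> x \<in> rat.span W \<Longrightarrow>
    (\<Sum>w\<in>W. of_rat (rat.representation W x w) * w) = x"
  by (rule rat.sum_representation_eq) auto

lemma representation_sum_scale:
  assumes "rat.independent W" "\<And>i. i \<in> I \<Longrightarrow> f i \<in> rat.span W"
  shows "rat.representation W (\<Sum>i\<in>I. of_rat (c i) * f i) w = (\<Sum>i\<in>I. c i * rat.representation W (f i) w)"
proof -
  have "rat.representation W (\<Sum>i\<in>I. of_rat (c i) * f i) w =
      (\<Sum>i\<in>I. rat.representation W (of_rat (c i) * f i) w)"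
    by (subst rat.representation_sum) (use assms rat.span_scale in auto)
  also have "\<dots> = (\<Sum>i\<in>I. c i * rat.representation W (f i) w)"
    using assms by (intro sum.cong refl) (simp add: rat.representation_scale)
  finally show ?thesis .
qed

text \<open>This is \<open>tr (C M C') = tr (M C' C)\<close> in coordinates: after interchanging the
  sums, the two base change matrices between \<open>V\<close> and \<open>W\<close> meet and
  cancel.\<close>

lemma rat_trace_basis:
  assumes "finite W" "rat.independent W" "finite V" "rat.independent V" "rat.span V = rat.span W"
    and stable: "\<And>w. w \<in> rat.span W \<Longrightarrow> z * w \<in> rat.span W"
  shows "rat_trace W z = rat_trace V z"
proof -
  let ?R = "rat.representation"
  have base: "w \<in> rat.span W" if "w \<in> W \<or> w \<in> V" for w
    using that rat.span_base[of w W] rat.span_base[of w V] assms(5) by auto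
  have exp: "?R W (z * w) w = (\<Sum>v\<in>V. \<Sum>u\<in>V. ?R V w v * (?R V (z * v) u * ?R W u w))" if "w \<in> W" for w
  proof -
    have "z * w = z * (\<Sum>v\<in>V. of_rat (?R V w v) * v)"
      using span_eq_representation[OF assms(3,4), of w] base that assms(5) by simp
    also have "\<dots> = (\<Sum>v\<in>V. of_rat (?R V w v) * (z * v))"
      unfolding sum_distrib_left by (simp only: mult.left_commute)
    finally have "z * w = (\<Sum>v\<in>V. of_rat (?R V w v) * (z * v))" .
    then have "?R W (z * w) w = (\<Sum>v\<in>V. ?R V w v * ?R W (z * v) w)"
      using representation_sum_scale[OF assms(2), of V "\<lambda>v. z * v"] base stable by simp
    also have "\<dots> = (\<Sum>v\<in>V. ?R V w v * (\<Sum>u\<in>V. ?R V (z * v) u * ?R W u w))"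
    proof (intro sum.cong refl)
      fix v assume "v \<in> V"
      then have "z * v = (\<Sum>u\<in>V. of_rat (?R V (z * v) u) * u)"
        using span_eq_representation[OF assms(3,4), of "z * v"] base stable assms(5) by simp
      then have "?R W (z * v) w = ?R W (\<Sum>u\<in>V. of_rat (?R V (z * v) u) * u) w" by simp
      also have "\<dots> = (\<Sum>u\<in>V. ?R V (z * v) u * ?R W u w)"
        using base by (intro representation_sum_scale assms) auto
      finally show "?R V w v * ?R W (z * v) w = ?R V w v * (\<Sum>u\<in>V. ?R V (z * v) u * ?R W u w)"
        by simp
    qed
    finally show ?thesis by (simp add: sum_distrib_left)
  qed
  have "rat_trace W z = (\<Sum>w\<in>W. \<Sum>v\<in>V. \<Sum>u\<in>V. ?R V w v * (?R V (z * v) u * ?R W u w))"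
    unfolding rat_trace_def by (intro sum.cong refl exp)
  also have "\<dots> = (\<Sum>v\<in>V. \<Sum>u\<in>V. ?R V (z * v) u * (\<Sum>w\<in>W. ?R W u w * ?R V w v))"
    unfolding sum_distrib_left
    by (subst sum.swap, rule sum.cong[OF refl], subst sum.swap) (simp add: algebra_simps)
  also have "\<dots> = (\<Sum>v\<in>V. \<Sum>u\<in>V. ?R V (z * v) u * (if v = u then 1 else 0))"
  proof (intro sum.cong refl)
    fix u v assume uv: "u \<in> V" "v \<in> V"
    have "?R V u v = ?R V (\<Sum>w\<in>W. of_rat (?R W u w) * w) v"
      using span_eq_representation[OF assms(1,2), of u] base uv by simp
    also have "\<dots> = (\<Sum>w\<in>W. ?R W u w * ?R V w v)"
      using base assms(5) by (intro representation_sum_scale assms) auto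
    finally show "?R V (z * v) u * (\<Sum>w\<in>W. ?R W u w * ?R V w v) = ?R V (z * v) u * (if v = u then 1 else 0)"
      using rat.representation_basis[OF assms(4) uv(1)] by simp
  qed
  also have "\<dots> = rat_trace V z"
    unfolding rat_trace_def
  proof (intro sum.cong refl)
    fix v assume "v \<in> V"
    have "(\<Sum>u\<in>V. ?R V (z * v) u * (if v = u then 1 else 0)) = (\<Sum>u\<in>V. if v = u then ?R V (z * v) u else 0)"
      by (intro sum.cong) auto
    then show "(\<Sum>u\<in>V. ?R V (z * v) u * (if v = u then 1 else 0)) = ?R V (z * v) v"
      using \<open>v \<in> V\<close> assms(3) by simp
  qed
  finally show ?thesis .
qed

lemma representation_zspan:
  assumes "finite W" "rat.independent W" "x \<in> zspan W"
  shows "rat.representation W x w \<in> \<int>"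
proof -
  obtain c :: "'a \<Rightarrow> int" where c: "x = (\<Sum>w\<in>W. of_int (c w) * w)" using assms(3) by (rule zspanE)
  have "rat.representation W x w = rat.representation W (\<Sum>w\<in>W. of_rat (of_int (c w)) * w) w"
    by (simp add: c)
  also have "\<dots> = (\<Sum>v\<in>W. of_int (c v) * rat.representation W v w)"
    by (intro representation_sum_scale assms rat.span_base)
  also have "\<dots> \<in> \<int>"
    by (intro Ints_sum Ints_mult) (auto simp: rat.representation_basis[OF assms(2)])
  finally show ?thesis .
qed

text \<open>A basis of the stable lattice \<open>H\<close> is also a rational basis of the span,
  because \<open>E\<close> makes \<open>H\<close> of full rank; in that basis \<open>z\<close> has
  an integral matrix.\<close>

lemma rat_trace_Ints:
  assumes "finite W" "rat.independent W"
    and stable: "\<And>w. w \<in> rat.span W \<Longrightarrow> z * w \<in> rat.span W"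
    and H: "add_subgroup H" "H \<subseteq> zspan W" "\<And>x. x \<in> H \<Longrightarrow> z * x \<in> H"
    and E: "E > 0" "\<And>w. w \<in> W \<Longrightarrow> of_nat E * w \<in> H"
  shows "rat_trace W z \<in> \<int>"
proof -
  obtain V where V: "finite V" "rat.independent V" "H = zspan V"
    using sublattice_basis[OF assms(1,2) H(1,2)] by blast
  have "V \<subseteq> rat.span W" using V H zspan_base[of V] zspan_subset_span[of W] by auto
  moreover have "w \<in> rat.span V" if "w \<in> W" for w
  proof -
    have "of_nat E * w \<in> rat.span V" using E(2)[OF that] V(3) zspan_subset_span[of V] by auto
    then have "of_rat (1 / of_nat E) * (of_nat E * w) \<in> rat.span V" by (rule rat.span_scale)
    then show ?thesis using E(1) by (simp add: of_rat_divide)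
  qed
  ultimately have span: "rat.span V = rat.span W" by (intro iffD2[OF rat.span_eq]) auto
  have "rat_trace W z = rat_trace V z"
    by (rule rat_trace_basis) (use assms V span in auto)
  also have "\<dots> \<in> \<int>"
    unfolding rat_trace_def
  proof (rule Ints_sum)
    fix v assume "v \<in> V"
    then have "z * v \<in> zspan V" using V(1,3) H(3) zspan_base[of V v] by auto
    then show "rat.representation V (z * v) v \<in> \<int>" using V by (intro representation_zspan)
  qed
  finally show ?thesis .
qed

text \<open>
  Pairing with a basis under the trace form is injective since the trace of 1 is the degree, which
  is nonzero in characteristic 0; the dual basis then bounds the denominators of all elements
  that stabilise a lattice.
\<close>

lemma lattice_conductor:
  assumes fin: "finite W" and ind: "rat.independent W"
    and one: "1 \<in> rat.span W"
    and mult: "\<And>x y. x \<in> rat.span W \<Longrightarrow> y \<in> rat.span W \<Longrightarrow> x * y \<in> rat.span W"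
    and inv: "\<And>x. x \<in> rat.span W \<Longrightarrow> inverse x \<in> rat.span W"
    and WW: "\<And>v w. v \<in> W \<Longrightarrow> w \<in> W \<Longrightarrow> v * w \<in> zspan W"
  shows "\<exists>D>0. \<forall>y M. add_subgroup M \<and> 1 \<in> M \<and> (\<forall>x\<in>M. y * x \<in> M) \<and>
      (\<exists>E>0. \<forall>x\<in>M. of_nat E * x \<in> zspan W) \<longrightarrow> of_nat D * y \<in> zspan W"
proof -
  let ?K = "rat.span W" and ?R = "rat.representation W"
  have W: "w \<in> ?K" if "w \<in> W" for w using that by (rule rat.span_base)
  have tr_sum: "rat_trace W (\<Sum>i\<in>I. of_rat (c i) * f i) = (\<Sum>i\<in>I. c i * rat_trace W (f i))"
    if "\<And>i. i \<in> I \<Longrightarrow> f i \<in> ?K" for I :: "'a set" and c f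
  proof -
    have "rat_trace W (\<Sum>i\<in>I. of_rat (c i) * f i) =
        (\<Sum>w\<in>W. ?R (\<Sum>i\<in>I. of_rat (c i) * (f i * w)) w)"
      by (simp add: rat_trace_def sum_distrib_right mult.assoc)
    also have "\<dots> = (\<Sum>w\<in>W. \<Sum>i\<in>I. c i * ?R (f i * w) w)"
      using that mult W by (intro sum.cong refl representation_sum_scale ind) auto
    also have "\<dots> = (\<Sum>i\<in>I. c i * rat_trace W (f i))"
      by (subst sum.swap) (simp add: rat_trace_def sum_distrib_left)
    finally show ?thesis .
  qed
  have W_ne: "W \<noteq> {}" using one by auto
  have tr1: "rat_trace W 1 = of_nat (card W)"
    by (simp add: rat_trace_def rat.representation_basis[OF ind])
  \<comment> \<open>\<open>\<Psi> y\<close> packs the trace pairings of \<open>y\<close> with all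
    basis vectors into one vector, so that nondegeneracy of the trace form becomes injectivity of a
    linear map.\<close>
  define \<Psi> where "\<Psi> = (\<lambda>y. \<Sum>w\<in>W. of_rat (rat_trace W (y * w)) * w)"
  have \<Psi>_sum: "\<Psi> (\<Sum>i\<in>I. of_rat (c i) * f i) = (\<Sum>i\<in>I. of_rat (c i) * \<Psi> (f i))"
    if "\<And>i. i \<in> I \<Longrightarrow> f i \<in> ?K" for I :: "'a set" and c f
  proof -
    have tr: "rat_trace W ((\<Sum>i\<in>I. of_rat (c i) * f i) * w) = (\<Sum>i\<in>I. c i * rat_trace W (f i * w))"
      if w: "w \<in> W" for w
    proof -
      have "f i * w \<in> ?K" if "i \<in> I" for i
        using \<open>\<And>i. i \<in> I \<Longrightarrow> f i \<in> ?K\<close>[OF that] W[OF w] by (rule mult)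
      from tr_sum[of I "\<lambda>i. f i * w" c, OF this] show ?thesis
        by (simp only: sum_distrib_right mult.assoc)
    qed
    have "\<Psi> (\<Sum>i\<in>I. of_rat (c i) * f i) = (\<Sum>w\<in>W. \<Sum>i\<in>I. of_rat (c i) * (of_rat (rat_trace W (f i * w)) * w))"
      unfolding \<Psi>_def
    proof (intro sum.cong refl)
      fix w assume "w \<in> W"
      then show "of_rat (rat_trace W ((\<Sum>i\<in>I. of_rat (c i) * f i) * w)) * w =
          (\<Sum>i\<in>I. of_rat (c i) * (of_rat (rat_trace W (f i * w)) * w))"
        by (subst tr) (simp_all only: of_rat_sum of_rat_mult sum_distrib_right mult.assoc)
    qed
    also have "\<dots> = (\<Sum>i\<in>I. of_rat (c i) * \<Psi> (f i))"
      by (subst sum.swap) (simp add: \<Psi>_def sum_distrib_left)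
    finally show ?thesis .
  qed
  have \<Psi>_diff: "\<Psi> (x - y) = \<Psi> x - \<Psi> y" if "x \<in> ?K" "y \<in> ?K" for x y
  proof -
    have "?R ((x - y) * w * v) v = ?R (x * w * v) v - ?R (y * w * v) v" if "w \<in> W" "v \<in> W" for v w
      using rat.representation_diff[OF ind mult[OF mult[OF \<open>y \<in> ?K\<close> W] W] mult[OF mult[OF \<open>x \<in> ?K\<close> W] W], OF that that]
      by (simp only: left_diff_distrib)
    then have "rat_trace W ((x - y) * w) = rat_trace W (x * w) - rat_trace W (y * w)" if "w \<in> W" for w
      using that by (simp add: rat_trace_def sum_subtractf)
    then show ?thesis by (simp add: \<Psi>_def sum_subtractf of_rat_diff left_diff_distrib)
  qed
  have \<Psi>_0: "y = 0" if y: "y \<in> ?K" "\<Psi> y = 0" for y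
  proof (rule ccontr)
    assume y0: "y \<noteq> 0"
    have "rat_trace W (y * w) = 0" if "w \<in> W" for w
      using rat.independentD[OF ind fin order_refl, of "\<lambda>w. rat_trace W (y * w)" w] y(2) that
      by (simp add: \<Psi>_def)
    \<comment> \<open>A nonzero \<open>y\<close> with all pairings 0 would give trace 0 to
      \<open>1\<close>, by expanding \<open>inverse y\<close> in the basis; but the trace of
      \<open>1\<close> is \<open>card W\<close>.\<close>
    moreover have "1 = (\<Sum>w\<in>W. of_rat (?R (inverse y) w) * (y * w))"
    proof -
      have "1 = y * (\<Sum>w\<in>W. of_rat (?R (inverse y) w) * w)"
        using span_eq_representation[OF fin ind inv[OF y(1)]] y0 by simp
      also have "\<dots> = (\<Sum>w\<in>W. of_rat (?R (inverse y) w) * (y * w))"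
        unfolding sum_distrib_left by (simp only: mult.left_commute)
      finally show ?thesis .
    qed
    ultimately have "rat_trace W 1 = 0"
      using tr_sum[of W "\<lambda>w. y * w" "?R (inverse y)"] mult W y(1) by simp
    then show False using tr1 W_ne fin by simp
  qed
  have inj_comb: "\<And>w. w \<in> W \<Longrightarrow> c w = 0" if "(\<Sum>w\<in>W. of_rat (c w) * \<Psi> w) = 0" for c
  proof -
    have "\<Psi> (\<Sum>w\<in>W. of_rat (c w) * w) = 0" using \<Psi>_sum[of W "\<lambda>w. w" c] W that by simp
    moreover have "(\<Sum>w\<in>W. of_rat (c w) * w) \<in> ?K" by (intro rat.span_sum rat.span_scale W)
    ultimately have "(\<Sum>w\<in>W. of_rat (c w) * w) = 0" using \<Psi>_0 by blast
    then show "c w = 0" if "w \<in> W" for w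
      using rat.independentD[OF ind fin order_refl] that by blast
  qed
  have inj\<Psi>: "inj_on \<Psi> W"
  proof (rule inj_onI, rule ccontr)
    fix v w assume vw: "v \<in> W" "w \<in> W" "\<Psi> v = \<Psi> w" "v \<noteq> w"
    let ?c = "\<lambda>u. (if u = v then 1 else 0) - (if u = w then 1 else 0) :: rat"
    have "(\<Sum>u\<in>W. of_rat (?c u) * \<Psi> u) = (\<Sum>u\<in>W. (if u = v then \<Psi> u else 0) - (if u = w then \<Psi> u else 0))"
      by (intro sum.cong refl) (auto simp: of_rat_diff)
    also have "\<dots> = \<Psi> v - \<Psi> w" using vw fin by (simp add: sum_subtractf)
    finally have "?c v = 0" using inj_comb[of ?c v] vw by simp
    then show False using vw by simp
  qed
  have ind\<Psi>: "rat.independent (\<Psi> ` W)"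
  proof (rule rat.independent_if_scalars_zero)
    fix f x assume f: "(\<Sum>x\<in>\<Psi> ` W. of_rat (f x) * x) = 0" "x \<in> \<Psi> ` W"
    have "(\<Sum>w\<in>W. of_rat (f (\<Psi> w)) * \<Psi> w) = 0" using f(1) by (simp add: sum.reindex[OF inj\<Psi>])
    then show "f x = 0" using inj_comb[of "\<lambda>w. f (\<Psi> w)"] f(2) by auto
  qed (use fin in auto)
  have \<Psi>W: "\<Psi> ` W \<subseteq> ?K" unfolding \<Psi>_def by (intro image_subsetI rat.span_sum rat.span_scale W)
  have "\<exists>u\<in>?K. \<Psi> u = w" if w: "w \<in> W" for w
  proof -
    have "w \<in> rat.span (\<Psi> ` W)"
    proof (rule ccontr)
      assume nw: "w \<notin> rat.span (\<Psi> ` W)"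
      have "rat.independent (insert w (\<Psi> ` W))" using nw ind\<Psi> by (rule rat.independent_insertI)
      then have "card (insert w (\<Psi> ` W)) \<le> card W"
        using rat.independent_span_bound[OF fin, of "insert w (\<Psi> ` W)"] \<Psi>W W[OF w] by auto
      moreover have "w \<notin> \<Psi> ` W" using nw rat.span_base by blast
      ultimately show False using fin inj\<Psi> by (simp add: card_image)
    qed
    then have "w = (\<Sum>x\<in>\<Psi> ` W. of_rat (rat.representation (\<Psi> ` W) w x) * x)"
      using span_eq_representation[OF _ ind\<Psi>] fin by simp
    also have "\<dots> = \<Psi> (\<Sum>v\<in>W. of_rat (rat.representation (\<Psi> ` W) w (\<Psi> v)) * v)"
      using \<Psi>_sum[of W "\<lambda>v. v"] W by (simp add: sum.reindex[OF inj\<Psi>])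
    finally have "w = \<Psi> (\<Sum>v\<in>W. of_rat (rat.representation (\<Psi> ` W) w (\<Psi> v)) * v)" .
    moreover have "(\<Sum>v\<in>W. of_rat (rat.representation (\<Psi> ` W) w (\<Psi> v)) * v) \<in> ?K"
      by (intro rat.span_sum rat.span_scale W)
    ultimately show ?thesis by metis
  qed
  \<comment> \<open>This is the dual basis for the trace form. \<open>D\<close> clears denominators
    of the dual basis alone, so it does not depend on \<open>y\<close>, \<open>M\<close> or
    \<open>E\<close>.\<close>
  then obtain dual where dual: "\<And>w. w \<in> W \<Longrightarrow> dual w \<in> ?K" "\<And>w. w \<in> W \<Longrightarrow> \<Psi> (dual w) = w" by metis
  obtain D where D: "D > 0" "\<And>w. w \<in> W \<Longrightarrow> of_nat D * dual w \<in> zspan W"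
    using common_denominator[OF fin, of "dual ` W"] fin dual(1) by auto
  show ?thesis
  proof (intro exI[of _ D] conjI allI impI D(1), elim conjE exE)
    fix y M E assume M: "add_subgroup M" "1 \<in> M" "\<forall>x\<in>M. y * x \<in> M" "E > 0"
      "\<forall>x\<in>M. of_nat E * x \<in> zspan W"
    have E_span: "x \<in> ?K" if "x \<in> M" for x
    proof -
      have "of_nat E * x \<in> ?K" using M(5) that zspan_subset_span by blast
      then have "of_rat (1 / of_nat E) * (of_nat E * x) \<in> ?K" by (rule rat.span_scale)
      then show ?thesis using M(4) by (simp add: of_rat_divide)
    qed
    have y: "y \<in> ?K" using E_span[of "y * 1"] M by auto
    have ideal: "v * x \<in> zspan W" if "v \<in> W" "x \<in> zspan W" for v x
    proof -
      obtain c :: "'a \<Rightarrow> int" where c: "x = (\<Sum>w\<in>W. of_int (c w) * w)" using \<open>x \<in> zspan W\<close> by (rule zspanE)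
      have "v * x = (\<Sum>w\<in>W. of_int (c w) * (v * w))" by (simp add: c sum_distrib_left algebra_simps)
      also have "\<dots> \<in> zspan W"
        using WW that by (intro add_subgroup_sum add_subgroup_of_int add_subgroup_zspan)
      finally show ?thesis .
    qed
    have tr: "rat_trace W (y * w) \<in> \<int>" if w: "w \<in> W" for w
    proof -
      \<comment> \<open>\<open>G\<close> is \<open>E\<close> times the product of
        \<open>zspan W\<close> and \<open>M\<close>. It lies in \<open>zspan W\<close> by the choice
        of \<open>E\<close>, it is stable under \<open>y * w\<close> because \<open>w\<close>
        preserves \<open>zspan W\<close> and \<open>y\<close> preserves \<open>M\<close>, and it has
        full rank because \<open>1 \<in> M\<close>.\<close>
      define G where "G = {x. \<exists>b. (\<forall>v\<in>W. b v \<in> M) \<and> x = (\<Sum>v\<in>W. of_nat E * v * b v)}"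
      have G: "add_subgroup G"
        unfolding add_subgroup_def
      proof (intro conjI ballI)
        show "0 \<in> G" unfolding G_def using add_subgroupD(1)[OF M(1)] by (auto intro!: exI[of _ "\<lambda>_. 0"])
        fix x x' assume "x \<in> G" "x' \<in> G"
        then obtain b b' where "\<forall>v\<in>W. b v \<in> M" "\<forall>v\<in>W. b' v \<in> M"
          "x = (\<Sum>v\<in>W. of_nat E * v * b v)" "x' = (\<Sum>v\<in>W. of_nat E * v * b' v)"
          unfolding G_def by blast
        then show "x - x' \<in> G" unfolding G_def
          using add_subgroupD(2)[OF M(1)]
          by (auto intro!: exI[of _ "\<lambda>v. b v - b' v"] simp: sum_subtractf right_diff_distrib)
      qed
      show ?thesis
      proof (rule rat_trace_Ints[OF fin ind _ G _ _ M(4)])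
        show "y * w * x \<in> ?K" if "x \<in> ?K" for x using mult y W w that by simp
        show "G \<subseteq> zspan W"
        proof
          fix x assume "x \<in> G"
          then obtain b where b: "\<forall>v\<in>W. b v \<in> M" "x = (\<Sum>v\<in>W. v * (of_nat E * b v))"
            unfolding G_def by (auto simp: mult_ac)
          then show "x \<in> zspan W" using M(5) ideal
            by (auto intro!: add_subgroup_sum add_subgroup_zspan)
        qed
        show "of_nat E * v \<in> G" if v: "v \<in> W" for v
        proof -
          have "(\<Sum>u\<in>W. of_nat E * u * (if u = v then 1 else 0)) = (\<Sum>u\<in>W. if u = v then of_nat E * u else 0)"
            by (intro sum.cong) auto
          then have "(\<Sum>u\<in>W. of_nat E * u * (if u = v then 1 else 0)) = of_nat E * v"
            using v fin by simp
          then show ?thesis unfolding G_def using M(2) add_subgroupD(1)[OF M(1)]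
            by (auto intro!: exI[of _ "\<lambda>u. if u = v then 1 else 0"])
        qed
        fix x assume "x \<in> G"
        then obtain b where b: "\<forall>v\<in>W. b v \<in> M" "x = (\<Sum>v\<in>W. of_nat E * v * b v)"
          unfolding G_def by blast
        have "\<exists>c::'a \<Rightarrow> int. w * v = (\<Sum>u\<in>W. of_int (c u) * u)" if "v \<in> W" for v
          using WW[OF w that] by (auto elim: zspanE)
        then obtain c :: "'a \<Rightarrow> 'a \<Rightarrow> int" where c: "\<And>v. v \<in> W \<Longrightarrow> w * v = (\<Sum>u\<in>W. of_int (c v u) * u)" by metis
        have "y * w * x = (\<Sum>v\<in>W. of_nat E * (w * v) * (y * b v))"
          unfolding b sum_distrib_left by (intro sum.cong) (auto simp: algebra_simps)
        also have "\<dots> = (\<Sum>v\<in>W. \<Sum>u\<in>W. of_nat E * u * (of_int (c v u) * (y * b v)))"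
        proof (intro sum.cong refl)
          fix v assume "v \<in> W"
          show "of_nat E * (w * v) * (y * b v) = (\<Sum>u\<in>W. of_nat E * u * (of_int (c v u) * (y * b v)))"
            unfolding c[OF \<open>v \<in> W\<close>] sum_distrib_left sum_distrib_right
            by (intro sum.cong refl) (simp only: mult_ac)
        qed
        also have "\<dots> = (\<Sum>u\<in>W. of_nat E * u * (\<Sum>v\<in>W. of_int (c v u) * (y * b v)))"
          by (subst sum.swap) (simp add: sum_distrib_left)
        also have "\<dots> \<in> G" unfolding G_def using M b(1)
          by (auto intro!: exI[of _ "\<lambda>u. \<Sum>v\<in>W. of_int (c v u) * (y * b v)"] add_subgroup_sum add_subgroup_of_int)
        finally show "y * w * x \<in> G" .
      qed
    qed
    then have "\<forall>w\<in>W. \<exists>k. rat_trace W (y * w) = of_int k" by (auto elim: Ints_cases)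
    then obtain t :: "'a \<Rightarrow> int" where t: "\<And>w. w \<in> W \<Longrightarrow> rat_trace W (y * w) = of_int (t w)"
      by metis
    \<comment> \<open>The integral traces \<open>t w\<close> are the coordinates of \<open>y\<close>
      in the dual basis.\<close>
    have "\<Psi> (\<Sum>w\<in>W. of_rat (of_int (t w)) * dual w) = (\<Sum>w\<in>W. of_rat (of_int (t w)) * w)"
      using \<Psi>_sum[of W dual "\<lambda>w. of_int (t w)", OF dual(1)] dual(2) by simp
    also have "\<dots> = \<Psi> y" by (simp add: \<Psi>_def t)
    finally have eq: "\<Psi> (\<Sum>w\<in>W. of_rat (of_int (t w)) * dual w) = \<Psi> y" .
    have mem: "(\<Sum>w\<in>W. of_rat (of_int (t w)) * dual w) \<in> ?K"
      using dual(1) by (intro rat.span_sum rat.span_scale)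
    have "(\<Sum>w\<in>W. of_rat (of_int (t w)) * dual w) - y = 0"
      by (rule \<Psi>_0[OF rat.span_diff[OF mem y]]) (simp only: \<Psi>_diff[OF mem y] eq diff_self)
    then have "y = (\<Sum>w\<in>W. of_rat (of_int (t w)) * dual w)" by simp
    then have "of_nat D * y = (\<Sum>w\<in>W. of_int (t w) * (of_nat D * dual w))"
      by (simp add: sum_distrib_left algebra_simps)
    also have "\<dots> \<in> zspan W"
      using D(2) by (intro add_subgroup_sum add_subgroup_of_int add_subgroup_zspan)
    finally show "of_nat D * y \<in> zspan W" .
  qed
qed

section \<open>Modules and ideals in a number ring\<close>

text \<open>Dropping the inclusion in \<open>A\<close> from the notion of ideal covers fractional
  ideals, overrings and ideals of overrings, all viewed over \<open>A\<close>.\<close>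

definition module_over :: "'a::field_char_0 set \<Rightarrow> 'a set \<Rightarrow> bool" where
  "module_over A X \<longleftrightarrow> 0 \<in> X \<and> (\<forall>x\<in>X. \<forall>y\<in>X. x + y \<in> X) \<and> (\<forall>r\<in>A. \<forall>x\<in>X. r * x \<in> X)"

lemma ideal_of_iff: "ideal_of A I \<longleftrightarrow> I \<subseteq> A \<and> module_over A I"
  by (auto simp: ideal_of_def module_over_def)

lemma module_overD:
  assumes "module_over A X"
  shows "0 \<in> X" "x \<in> X \<Longrightarrow> y \<in> X \<Longrightarrow> x + y \<in> X" "r \<in> A \<Longrightarrow> x \<in> X \<Longrightarrow> r * x \<in> X"
  using assms by (auto simp: module_over_def)

lemma module_over_subset: "module_over A X \<Longrightarrow> B \<subseteq> A \<Longrightarrow> module_over B X"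
  by (auto simp: module_over_def)

text \<open>As \<open>X\<close> has to be closed under addition only, it may be a set such as
  \<open>{z. \<forall>y\<in>J. z * y \<in> P}\<close>; in this way properties of products extend
  from generators.\<close>

lemma prod_ideal_minimal:
  assumes "0 \<in> X" "\<And>x y. x \<in> X \<Longrightarrow> y \<in> X \<Longrightarrow> x + y \<in> X" "\<And>a b. a \<in> I \<Longrightarrow> b \<in> J \<Longrightarrow> a * b \<in> X"
  shows "prod_ideal_of I J \<subseteq> X"
proof
  fix x assume "x \<in> prod_ideal_of I J"
  then obtain n :: nat and a b where x: "x = (\<Sum>k<n. a k * b k)" "\<forall>k<n. a k \<in> I \<and> b k \<in> J"
    unfolding prod_ideal_of_def by blast
  have "(\<Sum>k<m. a k * b k) \<in> X" if "m \<le> n" for m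
    using that x(2) assms by (induction m) auto
  then show "x \<in> X" using x(1) by blast
qed

lemma prod_idealI: "a \<in> I \<Longrightarrow> b \<in> J \<Longrightarrow> a * b \<in> prod_ideal_of I J"
  unfolding prod_ideal_of_def
  by (intro CollectI exI[of _ 1] exI[of _ "\<lambda>_. a"] exI[of _ "\<lambda>_. b"]) simp

lemma prod_ideal_0: "0 \<in> prod_ideal_of I J"
  unfolding prod_ideal_of_def by (intro CollectI exI[of _ 0]) simp

lemma prod_ideal_add:
  assumes "x \<in> prod_ideal_of I J" "y \<in> prod_ideal_of I J"
  shows "x + y \<in> prod_ideal_of I J"
proof -
  obtain n m :: nat and a b c d where
    x: "x = (\<Sum>k<n. a k * b k)" "\<forall>k<n. a k \<in> I \<and> b k \<in> J" and
    y: "y = (\<Sum>k<m. c k * d k)" "\<forall>k<m. c k \<in> I \<and> d k \<in> J"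
    using assms unfolding prod_ideal_of_def by blast
  define e f where "e = (\<lambda>k. if k < n then a k else c (k - n))"
    and "f = (\<lambda>k. if k < n then b k else d (k - n))"
  have "(\<Sum>k<n + m. e k * f k) = (\<Sum>k<n. e k * f k) + (\<Sum>k<m. e (k + n) * f (k + n))"
    by (induction m) (auto simp: algebra_simps)
  also have "\<dots> = x + y" unfolding x y by (simp add: e_def f_def)
  finally have "x + y = (\<Sum>k<n + m. e k * f k)" ..
  moreover have "\<forall>k<n + m. e k \<in> I \<and> f k \<in> J" using x(2) y(2) by (auto simp: e_def f_def)
  ultimately show ?thesis unfolding prod_ideal_of_def by blast
qed

lemma module_over_prod: "module_over A I \<Longrightarrow> module_over A (prod_ideal_of I J)"
  unfolding module_over_def
proof (intro conjI ballI)
  assume I: "0 \<in> I \<and> (\<forall>x\<in>I. \<forall>y\<in>I. x + y \<in> I) \<and> (\<forall>r\<in>A. \<forall>x\<in>I. r * x \<in> I)"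
  show "0 \<in> prod_ideal_of I J" by (rule prod_ideal_0)
  show "x + y \<in> prod_ideal_of I J" if "x \<in> prod_ideal_of I J" "y \<in> prod_ideal_of I J" for x y
    using that by (rule prod_ideal_add)
  fix r x assume r: "r \<in> A" and "x \<in> prod_ideal_of I J"
  moreover have "prod_ideal_of I J \<subseteq> {x. r * x \<in> prod_ideal_of I J}"
  proof (rule prod_ideal_minimal)
    show "a * b \<in> {x. r * x \<in> prod_ideal_of I J}" if "a \<in> I" "b \<in> J" for a b
      using prod_idealI[of "r * a" I b J] I r that by (simp add: mult.assoc)
  qed (auto simp: distrib_left intro: prod_ideal_0 prod_ideal_add)
  ultimately show "r * x \<in> prod_ideal_of I J" by auto
qed

lemma prod_ideal_subset:
  "module_over A X \<Longrightarrow> (\<And>a b. a \<in> I \<Longrightarrow> b \<in> J \<Longrightarrow> a * b \<in> X) \<Longrightarrow> prod_ideal_of I J \<subseteq> X"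
  by (rule prod_ideal_minimal) (auto simp: module_over_def)

lemma subring_ofD:
  assumes "subring_of A"
  shows "0 \<in> A" "1 \<in> A" "x \<in> A \<Longrightarrow> y \<in> A \<Longrightarrow> x + y \<in> A" "x \<in> A \<Longrightarrow> y \<in> A \<Longrightarrow> x - y \<in> A"
    "x \<in> A \<Longrightarrow> y \<in> A \<Longrightarrow> x * y \<in> A" "x \<in> A \<Longrightarrow> - x \<in> A"
proof -
  show *: "0 \<in> A" "1 \<in> A" "x \<in> A \<Longrightarrow> y \<in> A \<Longrightarrow> x + y \<in> A" "x \<in> A \<Longrightarrow> y \<in> A \<Longrightarrow> x - y \<in> A"
    "x \<in> A \<Longrightarrow> y \<in> A \<Longrightarrow> x * y \<in> A" for x y using assms by (auto simp: subring_of_def)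
  show "x \<in> A \<Longrightarrow> - x \<in> A" using *(4)[OF *(1), of x] by simp
qed

locale subring =
  fixes A :: "'a::field_char_0 set"
  assumes subring: "subring_of A"
begin

lemmas A0 = subring_ofD(1)[OF subring] and A1 = subring_ofD(2)[OF subring]
  and Aadd = subring_ofD(3)[OF subring] and Adiff = subring_ofD(4)[OF subring]
  and Amult = subring_ofD(5)[OF subring] and Aminus = subring_ofD(6)[OF subring]

lemma add_subgroup_A: "add_subgroup A"
  using A0 Adiff by (auto simp: add_subgroup_def)

lemma A_of_int: "of_int n \<in> A"
  using add_subgroup_of_int[OF add_subgroup_A A1] by simp

lemma A_of_nat: "of_nat n \<in> A"
  using A_of_int[of "int n"] by simp

lemma A_power: "x \<in> A \<Longrightarrow> x ^ n \<in> A"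
  by (induction n) (auto intro: A1 Amult)

lemma A_prod: "(\<And>i. i \<in> S \<Longrightarrow> f i \<in> A) \<Longrightarrow> prod f S \<in> A"
  by (induction S rule: infinite_finite_induct) (auto intro: A1 Amult)

lemma module_over_A: "module_over A A"
  using A0 Aadd Amult by (auto simp: module_over_def)

lemma module_uminus: "module_over A X \<Longrightarrow> x \<in> X \<Longrightarrow> - x \<in> X"
  using module_overD(3)[of A X "-1" x] Aminus[OF A1] by simp

lemma module_add_subgroup: "module_over A X \<Longrightarrow> add_subgroup X"
  using module_uminus[of X] module_overD(2)[of A X]
  by (auto simp: add_subgroup_def module_overD(1)) (metis add_uminus_conv_diff)

lemma module_diff: "module_over A X \<Longrightarrow> x \<in> X \<Longrightarrow> y \<in> X \<Longrightarrow> x - y \<in> X"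
  using module_add_subgroup add_subgroupD(2) by blast

lemma module_sum: "module_over A X \<Longrightarrow> (\<And>i. i \<in> S \<Longrightarrow> f i \<in> X) \<Longrightarrow> sum f S \<in> X"
  using module_add_subgroup add_subgroup_sum by blast

lemma module_scale:
  assumes "module_over A X"
  shows "module_over A (a *o X)"
  unfolding module_over_def
proof (intro conjI ballI)
  show "0 \<in> a *o X" using module_overD(1)[OF assms] by (intro elt_set_timesI[of 0]) auto
  show "x + y \<in> a *o X" if xy: "x \<in> a *o X" "y \<in> a *o X" for x y
  proof -
    obtain u v where "u \<in> X" "v \<in> X" "x = a * u" "y = a * v" using xy by (auto elim!: elt_set_timesE)
    then show ?thesis using module_overD(2)[OF assms]
      by (intro elt_set_timesI[of "u + v"]) (auto simp: distrib_left)
  qed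
  show "r * x \<in> a *o X" if rx: "r \<in> A" "x \<in> a *o X" for r x
  proof -
    obtain u where "u \<in> X" "x = a * u" using rx by (auto elim!: elt_set_timesE)
    then show ?thesis using module_overD(3)[OF assms rx(1)] by (intro elt_set_timesI[of "r * u"]) auto
  qed
qed

lemma module_plus:
  assumes "module_over A X" "module_over A Y"
  shows "module_over A (X + Y)"
  unfolding module_over_def
proof (intro conjI ballI)
  show "0 \<in> X + Y" using module_overD(1)[OF assms(1)] module_overD(1)[OF assms(2)]
    by (intro set_plusI[of 0 _ 0]) auto
  show "x + y \<in> X + Y" if xy: "x \<in> X + Y" "y \<in> X + Y" for x y
  proof -
    obtain u v u' v' where "u \<in> X" "v \<in> Y" "u' \<in> X" "v' \<in> Y" "x = u + v" "y = u' + v'"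
      using xy by (auto elim!: set_plusE)
    then show ?thesis using module_overD(2)[OF assms(1)] module_overD(2)[OF assms(2)]
      by (intro set_plusI[of "u + u'" _ "v + v'"]) auto
  qed
  show "r * x \<in> X + Y" if rx: "r \<in> A" "x \<in> X + Y" for r x
  proof -
    obtain u v where "u \<in> X" "v \<in> Y" "x = u + v" using rx by (auto elim!: set_plusE)
    then show ?thesis using module_overD(3)[OF assms(1) rx(1)] module_overD(3)[OF assms(2) rx(1)]
      by (intro set_plusI[of "r * u" _ "r * v"]) (auto simp: distrib_left)
  qed
qed

lemma module_principal: "module_over A (x *o A)"
  by (intro module_scale module_over_A)

lemma principal_mem: "x \<in> x *o A" "r \<in> A \<Longrightarrow> r * x \<in> x *o A"
  using A1 by (auto simp: elt_set_times_def mult.commute)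

lemma principal_subset: "module_over A X \<Longrightarrow> x \<in> X \<Longrightarrow> x *o A \<subseteq> X"
  by (auto simp: elt_set_times_def mult.commute[of x] intro: module_overD(3))

lemma plus_principalE:
  assumes "y \<in> X + x *o A"
  obtains u r where "u \<in> X" "r \<in> A" "y = u + r * x"
  using assms by (auto simp: set_plus_def elt_set_times_def mult.commute)

lemma plus_principalI: "u \<in> X \<Longrightarrow> r \<in> A \<Longrightarrow> u + r * x \<in> X + x *o A"
  using principal_mem(2) by (auto simp: set_plus_def)

lemma plus_subset:
  "module_over A Z \<Longrightarrow> X \<subseteq> Z \<Longrightarrow> Y \<subseteq> Z \<Longrightarrow> X + Y \<subseteq> Z"
  using set_plus_subset module_add_subgroup by blast

lemma subset_plus:
  assumes "module_over A X" "module_over A Y"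
  shows "X \<subseteq> X + Y" "Y \<subseteq> X + Y"
  using subset_set_plus assms module_add_subgroup by blast+

lemma module_Int: "module_over A X \<Longrightarrow> module_over A Y \<Longrightarrow> module_over A (X \<inter> Y)"
  by (auto simp: module_over_def)

lemma prod_ideal_commute: "prod_ideal_of I J = prod_ideal_of J I"
proof -
  have "prod_ideal_of I J \<subseteq> prod_ideal_of J I" for I J
  proof (rule prod_ideal_minimal)
    show "a * b \<in> prod_ideal_of J I" if "a \<in> I" "b \<in> J" for a b
      using prod_idealI[OF that(2,1)] by (simp add: mult.commute)
  qed (auto intro: prod_ideal_0 prod_ideal_add)
  then show ?thesis by blast
qed

lemma module_over_prod_right: "module_over A J \<Longrightarrow> module_over A (prod_ideal_of I J)"
  using module_over_prod[of A J I] prod_ideal_commute by metis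

lemma mprod_subset: "module_over A X \<Longrightarrow> I \<subseteq> A \<Longrightarrow> prod_ideal_of I X \<subseteq> X"
  by (rule prod_ideal_subset[of A]) (auto intro: module_overD(3))

text \<open>Maximal ideals; the zero ideal of a field is excluded, so that residue rings are finite.\<close>

definition maxid :: "'a set \<Rightarrow> bool" where
  "maxid m \<longleftrightarrow> ideal_of A m \<and> m \<noteq> {0} \<and> 1 \<notin> m \<and> (\<forall>x\<in>A - m. \<exists>r\<in>A. 1 - r * x \<in> m)"

lemma maxidD:
  assumes "maxid m"
  shows "ideal_of A m" "m \<subseteq> A" "module_over A m" "m \<noteq> {0}" "1 \<notin> m"
    "x \<in> A \<Longrightarrow> x \<notin> m \<Longrightarrow> \<exists>r\<in>A. 1 - r * x \<in> m"
  using assms by (auto simp: maxid_def ideal_of_iff)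

lemma maxid_prime:
  assumes "maxid m" "r \<in> A" "s \<in> A" "r * s \<in> m"
  shows "r \<in> m \<or> s \<in> m"
proof (rule ccontr)
  assume "\<not> (r \<in> m \<or> s \<in> m)"
  then obtain t where t: "t \<in> A" "1 - t * r \<in> m" using maxidD(6)[OF assms(1,2)] by blast
  note m = maxidD(3)[OF assms(1)]
  have "s * (1 - t * r) + t * (r * s) \<in> m"
    using module_overD(2)[OF m module_overD(3)[OF m assms(3) t(2)] module_overD(3)[OF m t(1) assms(4)]] .
  moreover have "s * (1 - t * r) + t * (r * s) = s" by (simp add: algebra_simps)
  ultimately show False using \<open>\<not> (r \<in> m \<or> s \<in> m)\<close> by simp
qed

text \<open>The class of \<open>x\<close> modulo \<open>X\<close> is killed by \<open>m\<close>, and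
  \<open>r\<close> is invertible modulo \<open>m\<close>. This replaces division by units of a
  localization.\<close>

lemma maxid_module_cancel:
  assumes "maxid m" "module_over A X" "\<And>s. s \<in> m \<Longrightarrow> s * x \<in> X" "r \<in> A" "r \<notin> m" "r * x \<in> X"
  shows "x \<in> X"
proof -
  obtain s where s: "s \<in> A" "1 - s * r \<in> m" using maxidD(6)[OF assms(1,4,5)] by blast
  have "(1 - s * r) * x + s * (r * x) \<in> X"
    using module_overD(2)[OF assms(2) assms(3)[OF s(2)] module_overD(3)[OF assms(2) s(1) assms(6)]] .
  then show ?thesis by (simp add: algebra_simps)
qed

text \<open>Multiplication by \<open>x\<close> maps \<open>A/m\<close> onto
  \<open>(X + xA)/X\<close>.\<close>

lemma index_adjoin_le:
  assumes "module_over A X" "\<And>s. s \<in> m \<Longrightarrow> s * x \<in> X" "ideal_of A m" "finite (cosets_of A m)"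
  shows "idl_norm (X + x *o A) X \<le> idl_norm A m" "finite (cosets_of (X + x *o A) X)"
proof -
  have *: "add_subgroup m" "add_subgroup X"
    using assms module_add_subgroup by (auto simp: ideal_of_iff)
  have 1: "r * x - s * x \<in> X" if "r - s \<in> m" for r s
    using assms(2)[OF that] by (simp add: left_diff_distrib)
  have 2: "\<exists>r\<in>A. y - r * x \<in> X" if y: "y \<in> X + x *o A" for y
  proof -
    obtain u r where u: "u \<in> X" "r \<in> A" "y = u + r * x" using y by (rule plus_principalE)
    then show ?thesis by (intro bexI[of _ r]) simp_all
  qed
  show "idl_norm (X + x *o A) X \<le> idl_norm A m" using 1 2 by (rule index_image_le(1)[OF * assms(4)])
  show "finite (cosets_of (X + x *o A) X)" using 1 2 by (rule index_image_le(2)[OF * assms(4)])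
qed

text \<open>The quotient is a line over the field \<open>A/m\<close>. The inverse map picks a
  coefficient \<open>f y\<close> of \<open>x\<close>, which is determined modulo \<open>m\<close>
  since \<open>x \<notin> X\<close>.\<close>

lemma index_adjoin:
  assumes m: "maxid m" and X: "module_over A X" "\<And>s. s \<in> m \<Longrightarrow> s * x \<in> X" "finite (cosets_of A m)"
    and x: "x \<notin> X"
  shows "idl_norm (X + x *o A) X = idl_norm A m"
proof (rule antisym)
  show "idl_norm (X + x *o A) X \<le> idl_norm A m"
    by (rule index_adjoin_le(1)[OF X(1,2) maxidD(1)[OF m] X(3)])
  have fin: "finite (cosets_of (X + x *o A) X)"
    by (rule index_adjoin_le(2)[OF X(1,2) maxidD(1)[OF m] X(3)])
  have "\<exists>r\<in>A. y - r * x \<in> X" if y: "y \<in> X + x *o A" for y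
  proof -
    obtain u r where u: "u \<in> X" "r \<in> A" "y = u + r * x" using y by (rule plus_principalE)
    then show ?thesis by (intro bexI[of _ r]) simp_all
  qed
  then obtain f where f: "\<And>y. y \<in> X + x *o A \<Longrightarrow> f y \<in> A \<and> y - f y * x \<in> X" by metis
  have sub: "add_subgroup m" "add_subgroup X" using maxidD(3)[OF m] X module_add_subgroup by auto
  have *: "r \<in> m" if "r \<in> A" "r * x \<in> X" for r
    using maxid_module_cancel[OF m X(1,2) that(1)] that x by blast
  show "idl_norm A m \<le> idl_norm (X + x *o A) X"
  proof (rule index_image_le(1)[OF sub(2,1) fin, of f])
    fix y z assume yz: "y \<in> X + x *o A" "z \<in> X + x *o A" "y - z \<in> X"
    have "(y - z) - (y - f y * x) + (z - f z * x) \<in> X"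
      using add_subgroupD(4)[OF sub(2) add_subgroupD(2)[OF sub(2) yz(3)]] f[OF yz(1)] f[OF yz(2)] by blast
    then have "(f y - f z) * x \<in> X" by (simp add: algebra_simps)
    then show "f y - f z \<in> m" using * f yz Adiff by auto
  next
    fix r assume r: "r \<in> A"
    have mem: "r * x \<in> X + x *o A" using plus_principalI[OF module_overD(1)[OF X(1)] r, of x] by simp
    have "(r - f (r * x)) * x \<in> X" using f[OF mem] by (simp add: algebra_simps)
    then have "r - f (r * x) \<in> m" using * f[OF mem] r Adiff by auto
    then show "\<exists>y\<in>X + x *o A. r - f y \<in> m" using mem by blast
  qed
qed

lemma idl_norm_maxid_ge_2:
  assumes "maxid m" "finite (cosets_of A m)"
  shows "idl_norm A m \<ge> 2"
proof -
  have "idl_norm A m > 0" using assms(2) A0 by (intro idl_norm_pos) auto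
  moreover have "idl_norm A m \<noteq> 1"
    using idl_norm_eq_1_iff[of m A] maxidD[OF assms(1)] module_add_subgroup add_subgroup_A A1 by auto
  ultimately show ?thesis by simp
qed

text \<open>\<open>Y/X\<close> is a nonzero vector space over \<open>A/m\<close>, so it contains a
  line.\<close>

lemma index_strict:
  assumes m: "maxid m" "finite (cosets_of A m)" and XY: "module_over A X" "module_over A Y" "X \<subset> Y"
    and mY: "\<And>s y. s \<in> m \<Longrightarrow> y \<in> Y \<Longrightarrow> s * y \<in> X" and fin: "finite (cosets_of Y X)"
  shows "idl_norm Y X \<ge> idl_norm A m"
proof -
  obtain x where x: "x \<in> Y" "x \<notin> X" using XY by blast
  have mods: "module_over A (X + x *o A)" "X \<subseteq> X + x *o A" "X + x *o A \<subseteq> Y"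
    using XY x principal_subset[of Y x] subset_plus module_principal plus_subset[of Y X "x *o A"]
    by (auto intro: module_plus)
  have "idl_norm Y X = idl_norm Y (X + x *o A) * idl_norm (X + x *o A) X"
    "finite (cosets_of Y (X + x *o A))"
    using index_tower[of X "X + x *o A" Y] mods XY module_add_subgroup fin by auto
  moreover have "idl_norm Y (X + x *o A) > 0" using calculation(2) x by (intro idl_norm_pos) auto
  moreover have "idl_norm (X + x *o A) X = idl_norm A m"
    by (rule index_adjoin[OF m(1) XY(1) mY[OF _ x(1)] m(2) x(2)])
  ultimately show ?thesis by simp
qed

lemma maxid_comaximal:
  assumes "maxid m" "maxid m'" "m \<noteq> m'"
  shows "\<exists>x\<in>m'. 1 - x \<in> m"
proof -
  have "\<exists>y\<in>m'. y \<notin> m"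
  proof (rule ccontr)
    assume "\<not> ?thesis"
    then have sub: "m' \<subseteq> m" by auto
    then obtain y where y: "y \<in> m" "y \<notin> m'" using assms(3) by auto
    have yA: "y \<in> A" using y maxidD(2)[OF assms(1)] by blast
    obtain r where r: "r \<in> A" "1 - r * y \<in> m'" using maxidD(6)[OF assms(2) yA y(2)] by blast
    have "(1 - r * y) + r * y \<in> m"
      using module_overD(2)[OF maxidD(3)[OF assms(1)] subsetD[OF sub r(2)] module_overD(3)[OF maxidD(3)[OF assms(1)] r(1) y(1)]] .
    then show False using maxidD(5)[OF assms(1)] by simp
  qed
  then obtain y where y: "y \<in> m'" "y \<notin> m" by blast
  have yA: "y \<in> A" using y maxidD(2)[OF assms(2)] by blast
  obtain r where r: "r \<in> A" "1 - r * y \<in> m" using maxidD(6)[OF assms(1) yA y(2)] by blast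
  then show ?thesis using module_overD(3)[OF maxidD(3)[OF assms(2)] r(1) y(1)] by blast
qed

text \<open>For each of the other ideals choose an element of it that is 1 modulo \<open>m\<close>,
  and multiply.\<close>

lemma maxid_idempotent:
  assumes "finite T" "\<And>m. m \<in> T \<Longrightarrow> maxid m" "m \<in> T"
  shows "\<exists>e\<in>A. 1 - e \<in> m \<and> (\<forall>m'\<in>T - {m}. e \<in> m')"
proof -
  have m: "maxid m" using assms by auto
  have "\<forall>m'\<in>T - {m}. \<exists>x\<in>m'. 1 - x \<in> m" using maxid_comaximal assms by blast
  then obtain f where f: "\<And>m'. m' \<in> T - {m} \<Longrightarrow> f m' \<in> m' \<and> 1 - f m' \<in> m" by metis
  have fA: "f m' \<in> A" if "m' \<in> T - {m}" for m' using f[OF that] maxidD(2)[of m'] assms(2) that by auto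
  have "1 - prod f S \<in> m" if "S \<subseteq> T - {m}" for S
    using finite_subset[OF that finite_Diff[OF assms(1)]] that
  proof (induction S rule: finite_induct)
    case empty
    then show ?case using module_overD(1)[OF maxidD(3)[OF m]] by simp
  next
    case (insert m' S)
    have "prod f S \<in> A" using fA insert by (intro A_prod) auto
    moreover have "1 - prod f S \<in> m" "1 - f m' \<in> m" using insert f by auto
    ultimately have "(1 - prod f S) + prod f S * (1 - f m') \<in> m"
      using module_overD(2,3)[OF maxidD(3)[OF m]] by blast
    then show ?case using insert by (simp add: algebra_simps)
  qed
  moreover have "prod f (T - {m}) \<in> m'" if "m' \<in> T - {m}" for m'
  proof -
    have "prod f (T - {m}) = prod f (T - {m} - {m'}) * f m'"
      using assms(1) that by (subst prod.remove[of _ m']) (auto simp: mult.commute)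
    moreover have "prod f (T - {m} - {m'}) \<in> A" using fA by (intro A_prod) auto
    moreover have "maxid m'" using assms(2) that by auto
    ultimately show ?thesis using f[OF that] module_overD(3)[OF maxidD(3)] by metis
  qed
  moreover have "prod f (T - {m}) \<in> A" using fA by (intro A_prod)
  ultimately show ?thesis by blast
qed

text \<open>The values \<open>f m\<close>, weighted with the elements of
  \<open>maxid_idempotent\<close>, add up to a solution as in the Chinese remainder theorem. A
  nonzero solution is demanded because \<open>ex_approx_pair\<close> uses that a nonzero element
  lies in finitely many maximal ideals.\<close>

lemma maxid_approx:
  assumes T: "finite T" "\<And>m. m \<in> T \<Longrightarrow> maxid m" and X: "module_over A X" "X \<noteq> {0}"
    and f: "\<And>m. m \<in> T \<Longrightarrow> f m \<in> X" and w: "w \<in> A" "w \<noteq> 0" "\<And>m. m \<in> T \<Longrightarrow> w \<in> m"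
  shows "\<exists>x\<in>X. x \<noteq> 0 \<and> (\<forall>m\<in>T. x - f m \<in> prod_ideal_of m X)"
proof -
  have "\<forall>m\<in>T. \<exists>e\<in>A. 1 - e \<in> m \<and> (\<forall>m'\<in>T - {m}. e \<in> m')" using maxid_idempotent[OF T] by blast
  then have "\<exists>e. \<forall>m\<in>T. e m \<in> A \<and> 1 - e m \<in> m \<and> (\<forall>m'\<in>T - {m}. e m \<in> m')"
    by (intro bchoice) (simp only: Bex_def)
  then obtain e where e: "\<And>m. m \<in> T \<Longrightarrow> e m \<in> A" "\<And>m. m \<in> T \<Longrightarrow> 1 - e m \<in> m"
    "\<And>m m'. m \<in> T \<Longrightarrow> m' \<in> T - {m} \<Longrightarrow> e m \<in> m'" by blast
  define x where "x = (\<Sum>m\<in>T. e m * f m)"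
  have xX: "x \<in> X" unfolding x_def using e f by (intro module_sum X module_overD(3)[OF X(1)])
  have mX: "module_over A (prod_ideal_of m X)" for m using module_over_prod_right X by blast
  have x: "x - f m \<in> prod_ideal_of m X" if m: "m \<in> T" for m
  proof -
    have "x = e m * f m + (\<Sum>m'\<in>T - {m}. e m' * f m')" unfolding x_def using m T(1) by (rule sum.remove[rotated])
    then have "x - f m = (\<Sum>m'\<in>T - {m}. e m' * f m') - (1 - e m) * f m" by (simp add: algebra_simps)
    also have "\<dots> \<in> prod_ideal_of m X"
      using e m f by (intro module_diff[OF mX] module_sum[OF mX] prod_idealI) auto
    finally show ?thesis .
  qed
  show ?thesis
  proof (cases "x = 0")
    case False
    then show ?thesis using x xX by blast
  next
    case True
    \<comment> \<open>A solution equal to 0 is shifted by \<open>w * z\<close>, which lies in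
      \<open>mX\<close> for every \<open>m \<in> T\<close>.\<close>
    obtain z where z: "z \<in> X" "z \<noteq> 0" using X module_overD(1)[OF X(1)] by blast
    have "w * z - f m \<in> prod_ideal_of m X" if m: "m \<in> T" for m
      using add_subgroupD(4)[OF module_add_subgroup[OF mX] x[OF m] prod_idealI[OF w(3)[OF m] z(1)]] True
      by simp
    then show ?thesis using z w module_overD(3)[OF X(1) w(1) z(1)] by (intro bexI[of _ "w * z"]) auto
  qed
qed

end

section \<open>Number rings: finite quotients and the local-global principle\<close>

lemma algebraic_of_finite_dim:
  assumes "finite B" "\<And>i::nat. x ^ i \<in> rat.span B"
  shows "algebraic (x::'a::field_char_0)"
proof (cases "inj_on (\<lambda>i. x ^ i) {..card B}")
  case False
  \<comment> \<open>If two powers agree, the set of powers may be too small to be dependent, but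
    then the difference of two monomials has the root \<open>x\<close>.\<close>
  then obtain i j where ij: "i \<noteq> j" "x ^ i = x ^ j" by (auto simp: inj_on_def)
  show ?thesis
  proof (rule algebraicI)
    show "coeff (monom 1 i - monom 1 j :: 'a poly) k \<in> \<int>" for k by (simp add: coeff_monom)
    show "(monom 1 i - monom 1 j :: 'a poly) \<noteq> 0"
      using ij by (metis monom_eq_iff' eq_iff_diff_eq_0 one_neq_zero)
    show "poly (monom 1 i - monom 1 j) x = 0" using ij by (simp add: poly_monom)
  qed
next
  case True
  let ?S = "(\<lambda>i. x ^ i) ` {..card B}"
  have "card ?S = card B + 1" using True by (simp add: card_image)
  then have "rat.dependent ?S"
    using rat.independent_span_bound[OF assms(1), of ?S] assms(2) by auto
  then obtain u v where u: "v \<in> ?S" "u v \<noteq> 0" "(\<Sum>v\<in>?S. of_rat (u v) * v) = 0"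
    using rat.dependent_finite[of ?S] by auto
  let ?p = "\<Sum>i\<le>card B. monom (of_rat (u (x ^ i))) i :: 'a poly"
  have c: "coeff ?p k = (if k \<le> card B then of_rat (u (x ^ k)) else 0)" for k
    by (auto simp: coeff_sum coeff_monom)
  show ?thesis
  proof (rule algebraicI')
    show "coeff ?p k \<in> \<rat>" for k by (simp add: c)
    obtain i where "i \<le> card B" "v = x ^ i" using u(1) by auto
    then have "coeff ?p i \<noteq> 0" using u(2) by (simp add: c)
    then show "?p \<noteq> 0" by force
    show "poly ?p x = 0"
      using u(3) by (simp add: poly_sum poly_monom sum.reindex[OF True])
  qed
qed

locale num_ring =
  fixes A :: "'a::field_char_0 set"
  assumes number_ring: "number_ring A"

sublocale num_ring \<subseteq> subring
  using number_ring by unfold_locales (simp add: number_ring_def)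

context num_ring
begin

abbreviation K :: "'a set" where "K \<equiv> frac_field A"

lemma KE:
  assumes "x \<in> K"
  obtains a b where "a \<in> A" "b \<in> A" "b \<noteq> 0" "x = a / b"
  using assms by (auto simp: frac_field_def)

lemma KI: "a \<in> A \<Longrightarrow> b \<in> A \<Longrightarrow> b \<noteq> 0 \<Longrightarrow> a / b \<in> K"
  by (auto simp: frac_field_def)

lemma A_subset_K: "A \<subseteq> K"
  using KI[OF _ A1] by force

lemma K_mult: "x \<in> K \<Longrightarrow> y \<in> K \<Longrightarrow> x * y \<in> K"
  by (elim KE) (auto intro!: KI Amult)

lemma K_inverse: "x \<in> K \<Longrightarrow> inverse x \<in> K"
proof (elim KE)
  fix a b assume "a \<in> A" "b \<in> A" "b \<noteq> 0" "x = a / b"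
  then show "inverse x \<in> K"
    using KI[of b a] A_subset_K A0 by (cases "a = 0") auto
qed

lemma K_divide: "x \<in> K \<Longrightarrow> y \<in> K \<Longrightarrow> x / y \<in> K"
  by (simp add: divide_inverse K_mult K_inverse)

lemma K_diff: "x \<in> K \<Longrightarrow> y \<in> K \<Longrightarrow> x - y \<in> K"
proof (elim KE)
  fix a b c d assume *: "a \<in> A" "b \<in> A" "b \<noteq> 0" "x = a / b" "c \<in> A" "d \<in> A" "d \<noteq> 0" "y = c / d"
  then have "x - y = (a * d - c * b) / (b * d)" by (simp add: field_simps)
  then show "x - y \<in> K" using * by (auto intro!: KI Amult Adiff)
qed

lemma add_subgroup_K: "add_subgroup K"
  using K_diff A_subset_K A0 by (auto simp: add_subgroup_def)

lemma K_add: "x \<in> K \<Longrightarrow> y \<in> K \<Longrightarrow> x + y \<in> K"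
  by (rule add_subgroupD(4)[OF add_subgroup_K])

lemma subring_K: "subring_of K"
  using A0 A1 A_subset_K K_add K_diff K_mult by (auto simp: subring_of_def)

lemma K_power: "x \<in> K \<Longrightarrow> x ^ n \<in> K"
  using subring.A_power[of K] subring_K by (auto simp: subring_def)

lemma K_of_rat: "of_rat q \<in> K"
  using KI[of "of_int (fst (quotient_of q))" "of_int (snd (quotient_of q))"] quotient_of_denom_pos'[of q]
  by (subst quotient_of_div[of q "fst (quotient_of q)" "snd (quotient_of q)"])
     (auto simp: of_rat_divide A_of_int)

lemma K_finite_dim: "\<exists>B. finite B \<and> K \<subseteq> rat.span B"
proof -
  obtain B where B: "finite B" "K \<subseteq> {\<Sum>b\<in>B. of_rat (c b) * b | c. True}"
    using number_ring by (auto simp: number_ring_def)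
  moreover have "{\<Sum>b\<in>B. of_rat (c b) * b | c. True} \<subseteq> rat.span B"
    by (auto simp: rat.span_finite[OF B(1)])
  ultimately show ?thesis by blast
qed

lemma K_algebraic: "x \<in> K \<Longrightarrow> algebraic x"
proof -
  assume "x \<in> K"
  moreover obtain B where "finite B" "K \<subseteq> rat.span B" using K_finite_dim by blast
  ultimately show "algebraic x" using K_power by (intro algebraic_of_finite_dim[of B]) auto
qed

lemma A_poly: "x \<in> A \<Longrightarrow> poly (map_poly of_int p) x \<in> A"
  by (induction p) (auto simp: map_poly_pCons A0 intro!: Aadd Amult A_of_int)

text \<open>In an integral equation for \<open>x\<close> whose constant term is nonzero, that term
  is a multiple of \<open>x\<close>; the induction on the polynomial divides out factors
  \<open>x\<close> until this is the case. Hence every nonzero ideal contains a positive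
  integer.\<close>

lemma ex_nat_multiple:
  assumes "x \<in> A" "x \<noteq> 0"
  shows "\<exists>n>0. \<exists>c\<in>A. c * x = of_nat n"
proof -
  obtain p :: "int poly" where p: "p \<noteq> 0" "poly (map_poly of_int p) x = 0"
    using algebraicE'[OF K_algebraic[OF subsetD[OF A_subset_K assms(1)]]] by blast
  from p have "\<exists>k::int. k \<noteq> 0 \<and> (\<exists>c\<in>A. c * x = of_int k)"
  proof (induction p)
    case (pCons a p)
    have c: "poly (map_poly of_int p) x \<in> A" using assms A_poly by blast
    show ?case
    proof (cases "a = 0")
      case True
      then show ?thesis using pCons assms by (auto simp: map_poly_pCons)
    next
      case False
      have "(- poly (map_poly of_int p) x) * x = of_int a"
        using pCons.prems by (simp add: map_poly_pCons algebra_simps add_eq_0_iff)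
      then show ?thesis using False Aminus[OF c] by blast
    qed
  qed simp
  then obtain k c where k: "k \<noteq> 0" "c \<in> A" "c * x = of_int k" by blast
  show ?thesis
  proof (cases "k > 0")
    case True
    then show ?thesis using k by (intro exI[of _ "nat k"] conjI bexI[of _ c]) auto
  next
    case False
    then show ?thesis using k Aminus by (intro exI[of _ "nat (-k)"] conjI bexI[of _ "-c"]) auto
  qed
qed

lemma module_nat_mem:
  assumes "module_over A I" "I \<subseteq> A" "I \<noteq> {0}"
  shows "\<exists>n>0. of_nat n \<in> I"
proof -
  obtain x where "x \<in> I" "x \<noteq> 0" using assms module_overD(1) by blast
  then show ?thesis using ex_nat_multiple[of x] module_overD(3)[OF assms(1)] assms(2) by (metis subsetD)
qed

lemma finite_index:
  assumes "add_subgroup X" "add_subgroup Y" "X \<subseteq> K" "Y \<subseteq> X" "n > 0" "\<And>x. x \<in> X \<Longrightarrow> of_nat n * x \<in> Y"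
  shows "finite (cosets_of X Y)"
proof -
  obtain B where B: "finite B" "K \<subseteq> rat.span B" using K_finite_dim by blast
  have "finite (cosets_of X (of_nat n *o X))"
    using assms B by (intro finite_index_multiple[of B]) auto
  moreover have "of_nat n *o X \<subseteq> Y" using assms(6) by (auto elim: elt_set_timesE)
  ultimately show ?thesis using index_tower(2)[of "of_nat n *o X" Y X] assms add_subgroup_scale by blast
qed

lemma finite_index_ideal:
  assumes "module_over A X" "module_over A Y" "Y \<subseteq> X" "X \<subseteq> A" "Y \<noteq> {0}"
  shows "finite (cosets_of X Y)"
proof -
  obtain n where n: "n > 0" "of_nat n \<in> Y" using module_nat_mem[of Y] assms by blast
  show ?thesis
  proof (rule finite_index[OF _ _ _ assms(3) n(1)])
    fix x assume "x \<in> X"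
    then show "of_nat n * x \<in> Y"
      using module_overD(3)[OF assms(2), of x "of_nat n"] n assms(4) by (auto simp: mult.commute)
  qed (use assms module_add_subgroup A_subset_K in auto)
qed

lemma finite_maxid: "maxid m \<Longrightarrow> finite (cosets_of A m)"
  using maxidD[of m] by (intro finite_index_ideal module_over_A) auto

text \<open>A submodule \<open>M\<close> that contains \<open>L\<close> and is maximal among the
  proper ones gives a simple quotient \<open>X/M\<close>, whose annihilator is a maximal ideal
  \<open>m\<close> with \<open>mX \<subseteq> M\<close>. This local-global principle takes the place
  of Nakayama's lemma.\<close>

lemma ex_separating_maxid:
  assumes "module_over A L" "module_over A X" "L \<subset> X" "X \<subseteq> A" "L \<noteq> {0}"
  shows "\<exists>m. maxid m \<and> L + prod_ideal_of m X \<noteq> X"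
proof -
  define P where "P = (\<lambda>M. module_over A M \<and> L \<subseteq> M \<and> M \<subset> X)"
  have "P L" using assms by (auto simp: P_def)
  \<comment> \<open>Finite index replaces the ascending chain condition: least index in
    \<open>X\<close> means maximal.\<close>
  then obtain M where M: "P M" "\<And>M'. P M' \<Longrightarrow> idl_norm X M \<le> idl_norm X M'"
    using ex_has_least_nat[of P L "idl_norm X"] by blast
  have Mm: "module_over A M" "L \<subseteq> M" "M \<subset> X" using M by (auto simp: P_def)
  have "{0} \<subset> L" using assms module_overD(1) by blast
  then have M0: "M \<noteq> {0}" using Mm by blast
  have gen: "M + x *o A = X" if x: "x \<in> X" "x \<notin> M" for x
  proof (rule ccontr)
    assume ne: "M + x *o A \<noteq> X"
    have mod: "module_over A (M + x *o A)" "M \<subseteq> M + x *o A" "M + x *o A \<subseteq> X" "x \<in> M + x *o A"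
      using Mm x principal_mem(1)[of x] principal_subset[of X x] subset_plus[of M "x *o A"] module_principal[of x]
        plus_subset[of X M "x *o A"] assms(2)
      by (auto intro: module_plus)
    then have "P (M + x *o A)" using ne Mm by (auto simp: P_def)
    then have "idl_norm X M \<le> idl_norm X (M + x *o A)" using M by blast
    moreover have t: "idl_norm X M = idl_norm X (M + x *o A) * idl_norm (M + x *o A) M"
      using mod Mm assms by (intro index_tower module_add_subgroup) auto
    moreover have "finite (cosets_of X M)" using assms Mm M0 by (intro finite_index_ideal) auto
    then have "idl_norm X M > 0" using x by (intro idl_norm_pos) auto
    moreover have "idl_norm (M + x *o A) M \<noteq> 1"
      using idl_norm_eq_1_iff[of M "M + x *o A"] mod Mm x module_add_subgroup by auto
    ultimately show False by (cases "idl_norm (M + x *o A) M") auto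
  qed
  obtain x where x: "x \<in> X" "x \<notin> M" using Mm by auto
  define m where "m = {r \<in> A. r * x \<in> M}"
  have id: "ideal_of A m"
    unfolding ideal_of_iff module_over_def m_def using module_overD[OF Mm(1)] A0 Aadd Amult
    by (auto simp: distrib_right mult.assoc)
  have "m \<noteq> {0}"
  proof -
    obtain l where l: "l \<in> L" "l \<noteq> 0" using \<open>{0} \<subset> L\<close> by auto
    have "x * l \<in> M" using l Mm module_overD(3)[OF Mm(1)] x assms by auto
    then have "l \<in> m" using l Mm assms by (auto simp: m_def mult.commute)
    then show ?thesis using l by auto
  qed
  moreover have "1 \<notin> m" using x by (auto simp: m_def)
  moreover have "\<exists>r\<in>A. 1 - r * s \<in> m" if s: "s \<in> A - m" for s
  proof -
    have "s * x \<in> X" "s * x \<notin> M" using s x module_overD(3)[OF assms(2)] by (auto simp: m_def)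
    then have "x \<in> M + (s * x) *o A" using gen x by auto
    then obtain u r where u: "u \<in> M" "r \<in> A" "x = u + r * (s * x)" by (rule plus_principalE)
    then have "(1 - r * s) * x = u" by (simp add: algebra_simps)
    moreover have "1 - r * s \<in> A" using u s A1 by (intro Adiff Amult) auto
    ultimately show ?thesis using u by (auto simp: m_def intro!: bexI[of _ r])
  qed
  ultimately have max: "maxid m" using id by (simp add: maxid_def)
  have "prod_ideal_of m X \<subseteq> M"
  proof (rule prod_ideal_subset[OF Mm(1)])
    fix s y assume s: "s \<in> m" and "y \<in> X"
    then have "y \<in> M + x *o A" using gen[OF x] by simp
    then obtain u r where u: "u \<in> M" "r \<in> A" "y = u + r * x" by (rule plus_principalE)
    have "s * x \<in> M" "s \<in> A" using s by (auto simp: m_def)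
    then have "s * u + r * (s * x) \<in> M" using u module_overD(2,3)[OF Mm(1)] by blast
    then show "s * y \<in> M" using u by (simp add: algebra_simps)
  qed
  then have "L + prod_ideal_of m X \<subseteq> M" using Mm by (intro plus_subset) auto
  then show ?thesis using max x by blast
qed

lemma ex_maxid:
  assumes "ideal_of A L" "L \<noteq> {0}" "1 \<notin> L"
  shows "\<exists>m. maxid m \<and> L \<subseteq> m"
proof -
  have L: "module_over A L" "L \<subset> A" using assms A1 by (auto simp: ideal_of_iff)
  obtain m where m: "maxid m" "L + prod_ideal_of m A \<noteq> A"
    using ex_separating_maxid[OF L(1) module_over_A L(2) _ assms(2)] by auto
  have mA: "m \<subseteq> prod_ideal_of m A" using prod_idealI[OF _ A1] by force
  have "x \<in> m" if x: "x \<in> L" for x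
  proof (rule ccontr)
    assume "x \<notin> m"
    moreover have "x \<in> A" using L x by auto
    ultimately obtain r where r: "r \<in> A" "1 - r * x \<in> m" using maxidD(6)[OF m(1)] by meson
    have mod: "module_over A (L + prod_ideal_of m A)"
      by (intro module_plus L module_over_prod maxidD(3) m)
    have "r * x + (1 - r * x) \<in> L + prod_ideal_of m A"
      using r mA x module_overD(3)[OF L(1)] by (intro set_plus_intro) auto
    then have "1 \<in> L + prod_ideal_of m A" by simp
    then have "A \<subseteq> L + prod_ideal_of m A" using module_overD(3)[OF mod, of _ 1] by auto
    moreover have "L + prod_ideal_of m A \<subseteq> A"
      using L mprod_subset[OF module_over_A maxidD(2)[OF m(1)]] by (intro plus_subset[OF module_over_A]) auto
    ultimately show False using m by blast
  qed
  then show ?thesis using m by blast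
qed

text \<open>An ideal containing \<open>a\<close> is a union of cosets of \<open>aA\<close>, of which
  there are finitely many. This stands in for the Noetherian property in
  \<open>S_equation\<close>.\<close>

lemma finite_ideals_containing:
  assumes "a \<in> A" "a \<noteq> 0"
  shows "finite {I. ideal_of A I \<and> a \<in> I}"
proof -
  let ?C = "cosets_of A (a *o A)"
  have ne: "a *o A \<noteq> {0}" using principal_mem(1)[of a] assms by auto
  have sub: "a *o A \<subseteq> A" using assms by (intro principal_subset module_over_A)
  have fin: "finite ?C" using sub ne by (intro finite_index_ideal module_over_A module_principal) auto
  have rec: "I = {x \<in> A. (+) x ` (a *o A) \<in> {c \<in> ?C. c \<subseteq> I}}" if I: "ideal_of A I" "a \<in> I" for I
  proof -
    have Im: "module_over A I" "I \<subseteq> A" using I by (auto simp: ideal_of_iff)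
    have "a *o A \<subseteq> I" using Im(1) I(2) by (rule principal_subset)
    then have "(+) x ` (a *o A) \<subseteq> I" if "x \<in> I" for x
      using that module_overD(2)[OF Im(1)] by auto
    moreover have "x \<in> I" if "(+) x ` (a *o A) \<subseteq> I" for x
      using that elt_set_timesI[OF A0, of 0 a] by force
    ultimately show ?thesis using Im(2) by (auto simp: cosets_of_image)
  qed
  have "inj_on (\<lambda>I. {c \<in> ?C. c \<subseteq> I}) {I. ideal_of A I \<and> a \<in> I}"
  proof (rule inj_onI)
    fix I I' assume "I \<in> {I. ideal_of A I \<and> a \<in> I}" "I' \<in> {I. ideal_of A I \<and> a \<in> I}"
      and eq: "{c \<in> ?C. c \<subseteq> I} = {c \<in> ?C. c \<subseteq> I'}"
    then have "I = {x \<in> A. (+) x ` (a *o A) \<in> {c \<in> ?C. c \<subseteq> I}}"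
      "I' = {x \<in> A. (+) x ` (a *o A) \<in> {c \<in> ?C. c \<subseteq> I'}}" using rec by blast+
    then show "I = I'" unfolding eq by simp
  qed
  moreover have "(\<lambda>I. {c \<in> ?C. c \<subseteq> I}) ` {I. ideal_of A I \<and> a \<in> I} \<subseteq> Pow ?C" by auto
  ultimately show ?thesis using fin inj_on_finite[OF _ _ iffD2[OF finite_Pow_iff fin]] by blast
qed

lemma finite_maxids_containing:
  assumes "a \<in> A" "a \<noteq> 0"
  shows "finite {m. maxid m \<and> a \<in> m}"
  by (rule finite_subset[OF _ finite_ideals_containing[OF assms]]) (auto dest: maxidD(1))

section \<open>Three generators imply super-multiplicativity\<close>

lemma index_adjoin_3_le:
  assumes m: "maxid m" and P: "module_over A P"
    and mem: "\<And>s x. s \<in> m \<Longrightarrow> x \<in> {a, b, c} \<Longrightarrow> s * x \<in> P"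
  shows "idl_norm (P + a *o A + b *o A + c *o A) P \<le> idl_norm A m ^ 3"
proof -
  define X1 X2 X3 where "X1 = P + a *o A" and "X2 = X1 + b *o A" and "X3 = X2 + c *o A"
  have mods: "module_over A X1" "module_over A X2" "module_over A X3"
    unfolding X1_def X2_def X3_def by (intro module_plus P module_principal)+
  have sub: "P \<subseteq> X1" "X1 \<subseteq> X2" "X2 \<subseteq> X3"
    unfolding X1_def X2_def X3_def
    by (intro subset_plus(1) P module_principal mods[unfolded X1_def X2_def X3_def])+
  have step: "idl_norm (Y + y *o A) Y \<le> idl_norm A m"
    if y: "module_over A Y" "P \<subseteq> Y" "y \<in> {a, b, c}" for Y y
  proof -
    have "s * y \<in> Y" if "s \<in> m" for s using mem[OF that y(3)] y(2) by blast
    from index_adjoin_le(1)[OF y(1) this maxidD(1)[OF m] finite_maxid[OF m]]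
    show ?thesis .
  qed
  have s1: "idl_norm X1 P \<le> idl_norm A m" unfolding X1_def by (rule step[OF P order_refl]) simp
  have s2: "idl_norm X2 X1 \<le> idl_norm A m" unfolding X2_def by (rule step[OF mods(1) sub(1)]) simp
  have s3: "idl_norm X3 X2 \<le> idl_norm A m"
    unfolding X3_def by (rule step[OF mods(2) order_trans[OF sub(1,2)]]) simp
  note sg = module_add_subgroup
  have "idl_norm X3 P = idl_norm X3 X2 * (idl_norm X2 X1 * idl_norm X1 P)"
    using index_tower(1)[OF sg[OF P] sg[OF mods(2)] sg[OF mods(3)] order_trans[OF sub(1,2)] sub(3)]
      index_tower(1)[OF sg[OF P] sg[OF mods(1)] sg[OF mods(2)] sub(1,2)] by simp
  also have "\<dots> \<le> idl_norm A m * (idl_norm A m * idl_norm A m)"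
    by (intro mult_mono s1 s2 s3) auto
  finally show ?thesis by (simp add: X3_def X2_def X1_def power3_eq_cube)
qed

lemma index_generated_by_3:
  assumes m: "maxid m" and "module_over A X" "generated_by_3 A X"
  shows "idl_norm X (prod_ideal_of m X) \<le> idl_norm A m ^ 3"
proof -
  let ?P = "prod_ideal_of m X"
  obtain a b c where abc: "X = {r * a + s * b + t * c | r s t. r \<in> A \<and> s \<in> A \<and> t \<in> A}"
    using assms(3) by (auto simp: generated_by_3_def)
  have P: "module_over A ?P" "?P \<subseteq> X"
    using module_over_prod_right[OF assms(2)] mprod_subset[OF assms(2) maxidD(2)[OF m]] by auto
  have comb: "r * a + s * b + t * c \<in> X" if "r \<in> A" "s \<in> A" "t \<in> A" for r s t
    using abc that by blast
  have mem: "a \<in> X" "b \<in> X" "c \<in> X"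
    using comb[OF A1 A0 A0] comb[OF A0 A1 A0] comb[OF A0 A0 A1] by auto
  have "X \<subseteq> ?P + a *o A + b *o A + c *o A"
  proof
    fix x assume "x \<in> X"
    then obtain r s t where rst: "r \<in> A" "s \<in> A" "t \<in> A" "x = r * a + s * b + t * c" using abc by blast
    have "((0 + r * a) + s * b) + t * c \<in> ?P + a *o A + b *o A + c *o A"
      by (intro plus_principalI module_overD(1)[OF P(1)] rst)
    then show "x \<in> ?P + a *o A + b *o A + c *o A" using rst by simp
  qed
  moreover have "?P + a *o A + b *o A + c *o A \<subseteq> X"
    by (intro plus_subset[OF assms(2)] principal_subset[OF assms(2)] mem P)
  ultimately have "X = ?P + a *o A + b *o A + c *o A" by blast
  moreover have "idl_norm (?P + a *o A + b *o A + c *o A) ?P \<le> idl_norm A m ^ 3"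
    using mem by (intro index_adjoin_3_le[OF m P(1)]) (auto intro: prod_idealI)
  ultimately show ?thesis by simp
qed

text \<open>Each strict inclusion contributes a factor of at least \<open>[A:m]\<close> by
  \<open>index_strict\<close>, so four of them force an index of at least
  \<open>[A:m] ^ 4\<close>.\<close>

lemma no_chain_of_length_4:
  assumes m: "maxid m" and X: "module_over A X"
    and fin: "finite (cosets_of X (prod_ideal_of m X))"
    and small: "idl_norm X (prod_ideal_of m X) < idl_norm A m ^ 4"
    and mods: "module_over A Y1" "module_over A Y2" "module_over A Y3"
    and strict: "prod_ideal_of m X \<subset> Y1" "Y1 \<subset> Y2" "Y2 \<subset> Y3" "Y3 \<subset> X"
  shows False
proof -
  let ?P = "prod_ideal_of m X"
  have P: "module_over A ?P" using X by (rule module_over_prod_right)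
  have le: "?P \<subseteq> Y1" "Y1 \<subseteq> Y2" "Y2 \<subseteq> Y3" "Y3 \<subseteq> X" using strict by auto
  note sg = module_add_subgroup
  note t3 = index_tower[OF sg[OF P] sg[OF mods(3)] sg[OF X] order_trans[OF order_trans[OF le(1,2)] le(3)] le(4)]
  note t2 = index_tower[OF sg[OF P] sg[OF mods(2)] sg[OF mods(3)] order_trans[OF le(1,2)] le(3)]
  note t1 = index_tower[OF sg[OF P] sg[OF mods(1)] sg[OF mods(2)] le(1,2)]
  have fins: "finite (cosets_of X Y3)" "finite (cosets_of Y3 Y2)" "finite (cosets_of Y2 Y1)" "finite (cosets_of Y1 ?P)"
    using t1(2) t2(2) t3(2) fin by auto
  have mY: "s * y \<in> Y" if "s \<in> m" "y \<in> X" "?P \<subseteq> Y" for s y Y using prod_idealI[OF that(1,2)] that(3) by blast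
  note st = index_strict[OF m finite_maxid[OF m]]
  have "idl_norm X Y3 \<ge> idl_norm A m"
    by (rule st[OF mods(3) X strict(4) mY fins(1)]) (use le in auto)
  moreover have "idl_norm Y3 Y2 \<ge> idl_norm A m"
    by (rule st[OF mods(2,3) strict(3) mY fins(2)]) (use le in auto)
  moreover have "idl_norm Y2 Y1 \<ge> idl_norm A m"
    by (rule st[OF mods(1,2) strict(2) mY fins(3)]) (use le in auto)
  moreover have "idl_norm Y1 ?P \<ge> idl_norm A m"
    by (rule st[OF P mods(1) strict(1) mY fins(4)]) (use le in auto)
  ultimately have "idl_norm A m * (idl_norm A m * (idl_norm A m * idl_norm A m)) \<le>
      idl_norm X Y3 * (idl_norm Y3 Y2 * (idl_norm Y2 Y1 * idl_norm Y1 ?P))"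
    by (intro mult_mono) auto
  then show False using small t1(1) t2(1) t3(1) by (simp add: power4_eq_xxxx mult.assoc)
qed

text \<open>If \<open>x\<close> did not span \<open>uJ\<close> modulo \<open>P\<close>, the chain
  \<open>P \<subset> P + xA \<subset> uJ + P \<subset> uJ + vI + P \<subset> X\<close> would be too
  long for dimension 3. A suitable \<open>v\<close> exists, since otherwise \<open>uJ + P\<close>
  would contain all of \<open>IJ\<close>.\<close>

lemma products_on_a_line:
  assumes m: "maxid m" and IJ: "module_over A I" "module_over A J"
    and X: "X = prod_ideal_of I J" and P: "P = prod_ideal_of m X"
    and fin: "finite (cosets_of X P)" and small: "idl_norm X P < idl_norm A m ^ 4"
    and no: "\<And>u v. u \<in> I \<Longrightarrow> v \<in> J \<Longrightarrow> u *o J + v *o I + P \<noteq> X"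
    and u: "u \<in> I" and x: "x \<in> u *o J + P" "x \<notin> P"
  shows "u *o J + P = P + x *o A"
proof (rule ccontr)
  assume ne: "u *o J + P \<noteq> P + x *o A"
  have Xm1: "module_over A X" unfolding X using IJ by (intro module_over_prod)
  have Xm: "module_over A X" "module_over A P" "P \<subseteq> X"
    using Xm1 module_over_prod_right[OF Xm1] mprod_subset[OF Xm1 maxidD(2)[OF m]] unfolding P by auto
  let ?L = "u *o J + P"
  have L: "module_over A ?L" "P \<subseteq> ?L"
    using module_plus[OF module_scale[OF IJ(2)] Xm(2)] subset_plus(2)[OF module_scale[OF IJ(2)] Xm(2)] by auto
  have uJ: "u *o J \<subseteq> X" "v *o I \<subseteq> X" if "u \<in> I" "v \<in> J" for u v
    using that unfolding X by (auto elim!: elt_set_timesE intro: prod_idealI simp: mult.commute[of v])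
  have D: "u *o J + v *o I + P \<subset> X" "module_over A (u *o J + v *o I + P)" if v: "v \<in> J" for v
    using no[OF u v] plus_subset[OF Xm(1) plus_subset[OF Xm(1) uJ[OF u v]] Xm(3)]
      module_plus[OF module_plus[OF module_scale[OF IJ(2)] module_scale[OF IJ(1)]] Xm(2)] by auto
  have "\<exists>v\<in>J. ?L \<noteq> u *o J + v *o I + P"
  proof (rule ccontr)
    assume "\<not> ?thesis"
    then have eq: "?L = u *o J + v *o I + P" if "v \<in> J" for v using that by blast
    have "X \<subseteq> ?L" unfolding X
    proof (rule prod_ideal_subset[OF L(1)])
      fix a v assume a: "a \<in> I" and v: "v \<in> J"
      have "0 + a * v + 0 \<in> u *o J + v *o I + P"
        using a by (intro set_plus_intro module_overD(1)[OF Xm(2)] module_overD(1)[OF module_scale[OF IJ(2)]])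
          (auto intro: elt_set_timesI simp: mult.commute)
      then show "a * v \<in> ?L" using eq[OF v] by simp
    qed
    moreover obtain v where v: "v \<in> J" using module_overD(1)[OF IJ(2)] by blast
    ultimately show False using D(1)[OF v] eq[OF v] by blast
  qed
  then obtain v where v: "v \<in> J" "?L \<noteq> u *o J + v *o I + P" by blast
  have "?L \<subseteq> u *o J + v *o I + P"
    by (rule set_plus_mono2[OF subset_plus(1)[OF module_scale[OF IJ(2)] module_scale[OF IJ(1)]] order_refl])
  then have "?L \<subset> u *o J + v *o I + P" using v by blast
  moreover have "P + x *o A \<subset> ?L"
    using ne plus_subset[OF L(1) L(2) principal_subset[OF L(1) x(1)]] by blast
  moreover have "P \<subset> P + x *o A"
    using subset_plus[OF Xm(2) module_principal[of x]] principal_mem(1)[of x] x by blast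
  ultimately show False
    using no_chain_of_length_4[OF m Xm(1), folded P, OF fin small module_plus[OF Xm(2) module_principal] L(1) D(2)[OF v(1)]]
      D(1)[OF v(1)] by blast
qed

text \<open>
  Modulo \<open>m\<close> this is a statement on bilinear maps whose values span a space of dimension at most 3.
\<close>

lemma ex_spanning_pair:
  assumes m: "maxid m" and IJ: "module_over A I" "module_over A J"
    and X: "X = prod_ideal_of I J" and P: "P = prod_ideal_of m X"
    and fin: "finite (cosets_of X P)" and small: "idl_norm X P < idl_norm A m ^ 4"
  shows "\<exists>u\<in>I. \<exists>v\<in>J. u *o J + v *o I + P = X"
proof (rule ccontr)
  assume "\<not> ?thesis"
  then have no: "u *o J + v *o I + P \<noteq> X" if "u \<in> I" "v \<in> J" for u v using that by blast
  have no': "v *o I + u *o J + P \<noteq> X" if "v \<in> J" "u \<in> I" for u v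
    using no[OF that(2,1)] by (simp add: add.commute)
  have X': "X = prod_ideal_of J I" using X prod_ideal_commute by simp
  have Xm1: "module_over A X" unfolding X using IJ by (intro module_over_prod)
  have Xm: "module_over A X" "module_over A P" "P \<subseteq> X"
    using Xm1 module_over_prod_right[OF Xm1] mprod_subset[OF Xm1 maxidD(2)[OF m]] unfolding P by auto
  have uv: "u * v \<in> u *o J + P" "u * v \<in> v *o I + P" if "u \<in> I" "v \<in> J" for u v
    using that module_overD(1)[OF Xm(2)]
    by (auto intro!: set_plusI[of _ _ 0] elt_set_timesI simp: mult.commute)
  have line: "u *o J + P = P + (u * v) *o A" "v *o I + P = P + (u * v) *o A"
    if "u \<in> I" "v \<in> J" "u * v \<notin> P" for u v
    using products_on_a_line[OF m IJ X P fin small no that(1) uv(1)[OF that(1,2)] that(3)]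
      products_on_a_line[OF m IJ(2,1) X' P fin small no' that(2) uv(2)[OF that(1,2)] that(3)] by auto
  have D_sub: "u *o J + P \<subseteq> u *o J + v *o I + P" "u *o J + v *o I + P \<subseteq> X" if "u \<in> I" "v \<in> J" for u v
  proof -
    show "u *o J + P \<subseteq> u *o J + v *o I + P"
      by (rule set_plus_mono2[OF subset_plus(1)[OF module_scale[OF IJ(2)] module_scale[OF IJ(1)]] order_refl])
    have "u *o J \<subseteq> X" "v *o I \<subseteq> X"
      using that unfolding X by (auto elim!: elt_set_timesE intro: prod_idealI simp: mult.commute[of v])
    then show "u *o J + v *o I + P \<subseteq> X" using Xm by (intro plus_subset)
  qed
  \<comment> \<open>Otherwise \<open>uJ + P = X\<close>, and \<open>u\<close> together with any
    \<open>v\<close> would span.\<close>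
  have escape: "\<exists>u'\<in>I. \<exists>v'\<in>J. u' * v' \<notin> u *o J + P" if u: "u \<in> I" for u
  proof (rule ccontr)
    assume "\<not> ?thesis"
    then have "X \<subseteq> u *o J + P" unfolding X
      using IJ Xm by (intro prod_ideal_subset[of A] module_plus module_scale) auto
    moreover obtain v where v: "v \<in> J" using module_overD(1)[OF IJ(2)] by blast
    ultimately show False using D_sub[OF u v] no[OF u v] by blast
  qed
  obtain u1 v1 where p1: "u1 \<in> I" "v1 \<in> J" "u1 * v1 \<notin> P"
    using escape[OF module_overD(1)[OF IJ(1)]] subset_plus(2)[OF module_scale[OF IJ(2), of 0] Xm(2)] by blast
  define L1 where "L1 = P + (u1 * v1) *o A"
  have L1: "module_over A L1" "P \<subseteq> L1"
    unfolding L1_def using module_plus[OF Xm(2) module_principal] subset_plus(1)[OF Xm(2) module_principal] by auto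
  obtain u2 v2 where p2: "u2 \<in> I" "v2 \<in> J" "u2 * v2 \<notin> L1"
    using escape[OF p1(1)] line(1)[OF p1] unfolding L1_def by auto
  have p2': "u2 * v2 \<notin> P" using p2 L1 by blast
  define L2 where "L2 = P + (u2 * v2) *o A"
  have int: "z \<in> P" if z: "z \<in> L1" "z \<in> L2" for z
  proof -
    obtain p r where pr: "p \<in> P" "r \<in> A" "z = p + r * (u2 * v2)"
      using z(2) unfolding L2_def by (rule plus_principalE)
    have mX: "s * (u2 * v2) \<in> P" if "s \<in> m" for s
      using that p2 unfolding P X by (intro prod_idealI)
    show ?thesis
    proof (cases "r \<in> m")
      case True
      then show ?thesis using pr mX module_overD(2)[OF Xm(2)] by blast
    next
      case False
      have "z - p \<in> L1" using module_diff[OF L1(1) z(1)] pr L1 by blast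
      then have "r * (u2 * v2) \<in> L1" using pr by simp
      then have "u2 * v2 \<in> L1"
        using maxid_module_cancel[OF m L1(1) _ pr(2) False] mX L1(2) by blast
      then show ?thesis using p2 by blast
    qed
  qed
  \<comment> \<open>\<open>u1 * v2\<close> lies on the line of \<open>u1\<close>, which is
    \<open>L1\<close>, and on the line of \<open>v2\<close>, which is \<open>L2\<close>; so it
    vanishes modulo \<open>P\<close>, and so does \<open>u2 * v1\<close>.\<close>
  have "u1 * v2 \<in> L1" using uv(1)[OF p1(1) p2(2)] line(1)[OF p1] unfolding L1_def by simp
  moreover have "u1 * v2 \<in> L2" using uv(2)[OF p1(1) p2(2)] line(2)[OF p2(1,2) p2'] unfolding L2_def by simp
  ultimately have z12: "u1 * v2 \<in> P" by (rule int)
  have "u2 * v1 \<in> L1" using uv(2)[OF p2(1) p1(2)] line(2)[OF p1] unfolding L1_def by simp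
  moreover have "u2 * v1 \<in> L2" using uv(1)[OF p2(1) p1(2)] line(1)[OF p2(1,2) p2'] unfolding L2_def by simp
  ultimately have z21: "u2 * v1 \<in> P" by (rule int)
  \<comment> \<open>Modulo \<open>P\<close>, the element \<open>u1 + u2\<close> sends
    \<open>v1\<close> to \<open>u1 * v1\<close> and \<open>v2\<close> to \<open>u2 * v2\<close>, so
    its values would lie on two different lines.\<close>
  have u: "u1 + u2 \<in> I" using module_overD(2)[OF IJ(1)] p1 p2 by blast
  have nP: "(u1 + u2) * v1 \<notin> P"
  proof
    assume "(u1 + u2) * v1 \<in> P"
    then have "(u1 + u2) * v1 - u2 * v1 \<in> P" using z21 by (rule module_diff[OF Xm(2)])
    then show False using p1 by (simp add: distrib_right)
  qed
  have "(u1 + u2) * v1 \<in> L1"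
  proof -
    have "u1 * v1 \<in> L1" using uv(1)[OF p1(1,2)] line(1)[OF p1] unfolding L1_def by simp
    then show ?thesis using module_overD(2)[OF L1(1)] z21 L1(2) by (auto simp: distrib_right)
  qed
  then have "P + ((u1 + u2) * v1) *o A \<subseteq> L1" by (intro plus_subset[OF L1(1)] principal_subset L1)
  moreover have "(u1 + u2) * v2 \<in> P + ((u1 + u2) * v1) *o A"
    using uv(1)[OF u p2(2)] line(1)[OF u p1(2) nP] by simp
  ultimately have "(u1 + u2) * v2 - u1 * v2 \<in> L1"
    using z12 L1 by (intro module_diff[OF L1(1)]) auto
  then show False using p2 by (simp add: distrib_right)
qed

text \<open>At the finitely many maximal ideals containing \<open>W\<close> both elements are
  prescribed. For the remaining ones \<open>a\<close> is found first; being nonzero, it lies in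
  finitely many of them, and \<open>c\<close> is then kept out of these. So at each maximal ideal
  that does not contain \<open>W\<close>, one of the two is a local unit.\<close>

lemma ex_approx_pair:
  assumes U: "module_over A U" "U \<subseteq> A" and V: "module_over A V" "V \<subseteq> A"
    and W: "W \<subseteq> U" "W \<subseteq> V" "w \<in> W" "w \<noteq> 0"
    and f: "\<And>n. maxid n \<Longrightarrow> W \<subseteq> n \<Longrightarrow> f n \<in> U" and g: "\<And>n. maxid n \<Longrightarrow> W \<subseteq> n \<Longrightarrow> g n \<in> V"
  shows "\<exists>a\<in>U. \<exists>c\<in>V. a \<noteq> 0
    \<and> (\<forall>n. maxid n \<and> W \<subseteq> n \<longrightarrow> a - f n \<in> prod_ideal_of n U \<and> c - g n \<in> prod_ideal_of n V)
    \<and> (\<forall>n. maxid n \<and> \<not> W \<subseteq> n \<longrightarrow> a \<notin> n \<or> c \<notin> n)"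
proof -
  have wA: "w \<in> A" using W U by auto
  have U0: "U \<noteq> {0}" "V \<noteq> {0}" using W by auto
  define T where "T = {n. maxid n \<and> W \<subseteq> n}"
  have "finite T" using finite_maxids_containing[OF wA W(4)] W(3) by (auto simp: T_def intro: finite_subset[rotated])
  obtain a where a: "a \<in> U" "a \<noteq> 0" "\<And>n. n \<in> T \<Longrightarrow> a - f n \<in> prod_ideal_of n U"
    using maxid_approx[OF \<open>finite T\<close> _ U(1) U0(1), of f w] f wA W by (auto simp: T_def)
  have aA: "a \<in> A" using a U by auto
  define T' where "T' = {n. maxid n \<and> a \<in> n \<and> \<not> W \<subseteq> n}"
  have "finite T'" using finite_maxids_containing[OF aA a(2)] by (auto simp: T'_def intro: finite_subset[rotated])
  have "\<exists>y\<in>V. y \<notin> n" if "n \<in> T'" for n using that W(2) by (auto simp: T'_def)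
  then have "\<exists>k. \<forall>n\<in>T'. k n \<in> V \<and> k n \<notin> n" by (intro bchoice) blast
  then obtain k where k: "\<And>n. n \<in> T' \<Longrightarrow> k n \<in> V" "\<And>n. n \<in> T' \<Longrightarrow> k n \<notin> n" by blast
  define h where "h = (\<lambda>n. if n \<in> T then g n else k n)"
  have "\<exists>c\<in>V. c \<noteq> 0 \<and> (\<forall>n\<in>T \<union> T'. c - h n \<in> prod_ideal_of n V)"
  proof (rule maxid_approx[OF _ _ V(1) U0(2)])
    \<comment> \<open>\<open>maxid_approx\<close> asks for one nonzero element in all the ideals at
      once: the factor \<open>w\<close> serves for \<open>T\<close>, the factor \<open>a\<close> for
      \<open>T'\<close>.\<close>
    show "w * a \<in> A" "w * a \<noteq> 0" using wA aA W a Amult by auto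
    fix n assume n: "n \<in> T \<union> T'"
    then have max: "maxid n" by (auto simp: T_def T'_def)
    then show "maxid n" .
    show "h n \<in> V" using n g k by (auto simp: h_def T_def)
    show "w * a \<in> n"
    proof (cases "n \<in> T")
      case True
      then have "a * w \<in> n" using W(3) aA module_overD(3)[OF maxidD(3)[OF max]] by (auto simp: T_def)
      then show ?thesis by (simp add: mult.commute)
    next
      case False
      then have "a \<in> n" using n by (auto simp: T'_def)
      then show ?thesis using wA module_overD(3)[OF maxidD(3)[OF max]] by auto
    qed
  qed (use \<open>finite T\<close> \<open>finite T'\<close> in auto)
  then obtain c where c: "c \<in> V" "\<And>n. n \<in> T \<union> T' \<Longrightarrow> c - h n \<in> prod_ideal_of n V" by blast
  have "c \<notin> n" if n: "n \<in> T'" for n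
  proof -
    have max: "maxid n" and nT: "n \<notin> T" using n by (auto simp: T_def T'_def)
    have "prod_ideal_of n V \<subseteq> n"
      using mprod_subset[OF maxidD(3)[OF max] V(2)] prod_ideal_commute[of n V] by simp
    then have "c - k n \<in> n" using c(2)[of n] n nT by (auto simp: h_def)
    then show ?thesis using k(2)[OF n] module_diff[OF maxidD(3)[OF max], of c "c - k n"] by auto
  qed
  then have "\<forall>n. maxid n \<and> \<not> W \<subseteq> n \<longrightarrow> a \<notin> n \<or> c \<notin> n" by (auto simp: T'_def)
  moreover have "a - f n \<in> prod_ideal_of n U \<and> c - g n \<in> prod_ideal_of n V" if "maxid n \<and> W \<subseteq> n" for n
    using a(3)[of n] c(2)[of n] that by (simp add: T_def h_def)
  ultimately show ?thesis using a(1,2) c(1) by blast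
qed

text \<open>\<open>[A:aA] [A:J] = [A:aJ] = [A:IJ] [IJ:aJ] \<le> [A:IJ] [I:aA]\<close> and
  \<open>[A:aA] = [A:I] [I:aA]\<close>; cancel \<open>[I:aA]\<close>, which is finite and positive
  because \<open>a \<noteq> 0\<close>.\<close>

lemma norm_le_norm_prod:
  assumes IJ: "ideal_of A I" "ideal_of A J" and a: "a \<in> I" "a \<noteq> 0" and c: "c \<in> J"
    and sum: "a *o J + c *o I = prod_ideal_of I J"
  shows "idl_norm A I * idl_norm A J \<le> idl_norm A (prod_ideal_of I J)"
proof -
  let ?X = "prod_ideal_of I J"
  have m: "module_over A I" "module_over A J" "I \<subseteq> A" "J \<subseteq> A" "module_over A ?X"
    using IJ by (auto simp: ideal_of_iff intro: module_over_prod)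
  have aA: "a *o A \<subseteq> I" "a *o J \<subseteq> a *o A" "a *o J \<subseteq> ?X" "?X \<subseteq> J"
    using principal_subset[OF m(1) a(1)] m(4) subset_plus(1)[OF module_scale[OF m(2)] module_scale[OF m(1)], of a c] sum
      mprod_subset[OF m(2,3)] by (auto elim!: elt_set_timesE intro: elt_set_timesI)
  have ne: "a *o A \<noteq> {0}" using principal_mem(1)[of a] a by auto
  have fin: "finite (cosets_of I (a *o A))"
    using m aA ne by (intro finite_index_ideal module_principal) auto
  have sg: "add_subgroup A" "add_subgroup I" "add_subgroup J" "add_subgroup ?X" "add_subgroup (a *o A)" "add_subgroup (a *o J)"
    using m module_add_subgroup module_principal[of a] module_scale[of J a] add_subgroup_A by blast+
  have le: "idl_norm ?X (a *o J) \<le> idl_norm I (a *o A)"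
  proof (rule index_image_le(1)[OF sg(5,6) fin])
    show "c * x - c * y \<in> a *o J" if xy: "x - y \<in> a *o A" for x y
    proof -
      obtain r where r: "r \<in> A" "x - y = a * r" using xy by (rule elt_set_timesE)
      have "c * x - c * y = c * (x - y)" by (rule right_diff_distrib[symmetric])
      also have "\<dots> = a * (r * c)" unfolding r(2) by (simp only: mult_ac)
      finally show ?thesis using module_overD(3)[OF m(2) r(1) c] by (rule elt_set_timesI[rotated])
    qed
    fix z assume "z \<in> ?X"
    then obtain y x where "y \<in> a *o J" "x \<in> I" "z = y + c * x"
      unfolding sum[symmetric] by (auto elim!: set_plusE elt_set_timesE)
    then show "\<exists>x\<in>I. z - c * x \<in> a *o J" by (intro bexI[of _ x]) auto
  qed
  have "idl_norm A (a *o A) * idl_norm A J = idl_norm A (a *o J)"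
    using index_tower(1)[OF sg(6,5,1) aA(2)] aA(1) m(3) index_scale(1)[OF sg(3) a(2), of A] by auto
  also have "\<dots> = idl_norm A ?X * idl_norm ?X (a *o J)"
    using index_tower(1)[OF sg(6,4,1) aA(3)] aA(4) m(4) by auto
  also have "\<dots> \<le> idl_norm A ?X * idl_norm I (a *o A)" using le by simp
  finally have "idl_norm A I * idl_norm I (a *o A) * idl_norm A J \<le> idl_norm A ?X * idl_norm I (a *o A)"
    using index_tower(1)[OF sg(5,2,1) aA(1) m(3)] by simp
  moreover have "idl_norm I (a *o A) > 0" using fin a by (intro idl_norm_pos) auto
  ultimately show ?thesis by (simp add: ac_simps)
qed

lemma super_multiplicative_if_generated_by_3:
  assumes gen: "\<And>I. ideal_of A I \<Longrightarrow> generated_by_3 A I"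
  shows "super_multiplicative A"
  unfolding super_multiplicative_def
proof (intro allI impI, elim conjE)
  fix I J assume IJ: "ideal_of A I" "ideal_of A J" and fin: "finite (cosets_of A (prod_ideal_of I J))"
  let ?X = "prod_ideal_of I J"
  have m: "module_over A I" "module_over A J" "I \<subseteq> A" "J \<subseteq> A" "module_over A ?X"
    using IJ by (auto simp: ideal_of_iff intro: module_over_prod)
  have XIJ: "?X \<subseteq> J" "?X \<subseteq> I"
    using mprod_subset[OF m(2,3)] mprod_subset[OF m(1,4)] prod_ideal_commute[of I J] by auto
  \<comment> \<open>A number ring is infinite, so its zero ideal has infinite index.\<close>
  have X0: "?X \<noteq> {0}"
  proof
    assume "?X = {0}"
    then have "cosets_of A ?X = (\<lambda>x. {x}) ` A" by (auto simp: cosets_of_image)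
    then have "finite A" using fin by (auto dest: finite_imageD simp: inj_on_def)
    moreover have "range of_nat \<subseteq> A" using A_of_nat by auto
    ultimately have "finite (range (of_nat :: nat \<Rightarrow> 'a))" by (rule finite_subset[rotated])
    then show False using finite_imageD[of "of_nat :: nat \<Rightarrow> 'a" UNIV] inj_of_nat by auto
  qed
  then obtain w where w: "w \<in> ?X" "w \<noteq> 0" using prod_ideal_0 by blast
  have wA: "w \<in> A" using w XIJ m by auto
  have I0: "I \<noteq> {0}" "J \<noteq> {0}" using w XIJ by auto
  have Xid: "ideal_of A ?X" using m XIJ by (auto simp: ideal_of_iff)
  have pair: "\<exists>u\<in>I. \<exists>v\<in>J. u *o J + v *o I + prod_ideal_of n ?X = ?X" if n: "maxid n" for n
  proof (rule ex_spanning_pair[OF n m(1,2) refl refl])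
    have "prod_ideal_of n ?X \<noteq> {0}"
    proof -
      obtain s where s: "s \<in> n" "s \<noteq> 0" using maxidD(4)[OF n] module_overD(1)[OF maxidD(3)[OF n]] by blast
      have "s * w \<noteq> 0" using s(2) w(2) by simp
      then show ?thesis using prod_idealI[OF s(1) w(1)] by (metis singletonD)
    qed
    then show "finite (cosets_of ?X (prod_ideal_of n ?X))"
      by (rule finite_index_ideal[OF m(5) module_over_prod_right[OF m(5)] mprod_subset[OF m(5) maxidD(2)[OF n]]
          order_trans[OF XIJ(1) m(4)]])
    have "idl_norm ?X (prod_ideal_of n ?X) \<le> idl_norm A n ^ 3"
      by (rule index_generated_by_3[OF n m(5) gen[OF Xid]])
    also have "\<dots> < idl_norm A n ^ 4"
      using idl_norm_maxid_ge_2[OF n finite_maxid[OF n]] by (intro power_strict_increasing) auto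
    finally show "idl_norm ?X (prod_ideal_of n ?X) < idl_norm A n ^ 4" .
  qed
  have "\<exists>f. \<forall>n\<in>Collect maxid. fst (f n) \<in> I \<and> snd (f n) \<in> J \<and> fst (f n) *o J + snd (f n) *o I + prod_ideal_of n ?X = ?X"
    using pair by (intro bchoice) force
  then obtain f where f: "\<And>n. maxid n \<Longrightarrow> fst (f n) \<in> I" "\<And>n. maxid n \<Longrightarrow> snd (f n) \<in> J"
    "\<And>n. maxid n \<Longrightarrow> fst (f n) *o J + snd (f n) *o I + prod_ideal_of n ?X = ?X" by blast
  obtain a c where a: "a \<in> I" "a \<noteq> 0" and c: "c \<in> J"
    and ac: "\<And>n. maxid n \<Longrightarrow> ?X \<subseteq> n \<Longrightarrow> a - fst (f n) \<in> prod_ideal_of n I \<and> c - snd (f n) \<in> prod_ideal_of n J"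
    "\<And>n. maxid n \<Longrightarrow> \<not> ?X \<subseteq> n \<Longrightarrow> a \<notin> n \<or> c \<notin> n"
    using ex_approx_pair[OF m(1,3,2,4) XIJ(2,1) w, of "\<lambda>n. fst (f n)" "\<lambda>n. snd (f n)", OF f(1,2)] by blast
  have aA: "a \<in> A" using a m by auto
  define L where "L = a *o J + c *o I"
  have LX: "L \<subseteq> ?X" unfolding L_def using a c
    by (intro plus_subset[OF m(5)]) (auto elim!: elt_set_timesE intro: prod_idealI simp: mult.commute[of c])
  have Lm: "module_over A L" unfolding L_def using m by (intro module_plus module_scale)
  have Lmem: "a * y \<in> L" "c * x \<in> L" if "x \<in> I" "y \<in> J" for x y
    using subset_plus[OF module_scale[OF m(2), of a] module_scale[OF m(1), of c]]
      elt_set_timesI[OF that(1), of "c * x" c] elt_set_timesI[OF that(2), of "a * y" a]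
    unfolding L_def by auto
  have Xmem: "s * (x * y) \<in> prod_ideal_of n ?X" if "s \<in> n" "x \<in> I" "y \<in> J" for s n x y
    using that by (intro prod_idealI)
  have "L = ?X"
  proof (rule ccontr)
    assume "L \<noteq> ?X"
    moreover have "L \<noteq> {0}"
    proof -
      obtain y where "y \<in> J" "y \<noteq> 0" using I0 module_overD(1)[OF m(2)] by blast
      then show ?thesis using Lmem(1)[OF a(1) \<open>y \<in> J\<close>] a by auto
    qed
    ultimately obtain n where n: "maxid n" "L + prod_ideal_of n ?X \<noteq> ?X"
      using ex_separating_maxid[OF Lm m(5)] LX XIJ m by blast
    let ?P = "prod_ideal_of n ?X"
    have P: "module_over A ?P" "?P \<subseteq> ?X"
      using module_over_prod_right[OF m(5)] mprod_subset[OF m(5) maxidD(2)[OF n(1)]] by auto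
    let ?M = "L + ?P"
    have M: "module_over A ?M" "L \<subseteq> ?M" "?P \<subseteq> ?M" "?M \<subseteq> ?X"
      using module_plus[OF Lm P(1)] subset_plus[OF Lm P(1)] plus_subset[OF m(5) LX P(2)] by auto
    \<comment> \<open>Locally at \<open>n\<close> the factor \<open>e\<close> is invertible, so it
      suffices that \<open>e\<close> moves the products of \<open>I\<close> and \<open>J\<close>
      into \<open>L + ?P\<close>.\<close>
    have unit: "?X \<subseteq> ?M"
      if e: "e \<in> A" "e \<notin> n" and eM: "\<And>x y. x \<in> I \<Longrightarrow> y \<in> J \<Longrightarrow> e * (x * y) \<in> ?M" for e
    proof (rule prod_ideal_subset[OF M(1)])
      fix x y assume xy: "x \<in> I" "y \<in> J"
      show "x * y \<in> ?M"
        by (rule maxid_module_cancel[OF n(1) M(1) _ e eM[OF xy]]) (use Xmem[OF _ xy] M in blast)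
    qed
    have "?X \<subseteq> ?M"
    proof (cases "?X \<subseteq> n")
      case True
      note near = ac(1)[OF n(1) True]
      \<comment> \<open>Replacing \<open>fst (f n)\<close> by \<open>a\<close> changes its products
        with \<open>J\<close> only by elements of \<open>?P\<close>; \<open>pm2\<close> says the
        same for \<open>c\<close> and \<open>I\<close>.\<close>
      have pm1: "prod_ideal_of n I \<subseteq> {z. \<forall>y\<in>J. z * y \<in> ?P}"
      proof (rule prod_ideal_minimal)
        show "s * x \<in> {z. \<forall>y\<in>J. z * y \<in> ?P}" if "s \<in> n" "x \<in> I" for s x
          using Xmem[OF that] by (simp add: mult.assoc)
      qed (use module_overD(1,2)[OF P(1)] in \<open>auto simp: distrib_right\<close>)
      have pm2: "prod_ideal_of n J \<subseteq> {z. \<forall>x\<in>I. z * x \<in> ?P}"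
      proof (rule prod_ideal_minimal)
        show "s * y \<in> {z. \<forall>x\<in>I. z * x \<in> ?P}" if "s \<in> n" "y \<in> J" for s y
          using Xmem[OF that(1) _ that(2)] by (simp add: mult.assoc mult.commute[of y])
      qed (use module_overD(1,2)[OF P(1)] in \<open>auto simp: distrib_right\<close>)
      have "fst (f n) *o J + snd (f n) *o I + ?P \<subseteq> ?M"
      proof (intro plus_subset[OF M(1)] M subsetI)
        fix z assume "z \<in> fst (f n) *o J"
        then obtain y where y: "y \<in> J" "z = fst (f n) * y" by (rule elt_set_timesE)
        then have "z = a * y - (a - fst (f n)) * y" by (simp add: algebra_simps)
        also have "\<dots> \<in> ?M"
        proof (rule module_diff[OF M(1)])
          show "a * y \<in> ?M" using Lmem(1)[OF a(1) y(1)] M(2) by blast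
          show "(a - fst (f n)) * y \<in> ?M" using pm1 near y(1) M(3) by blast
        qed
        finally show "z \<in> ?M" .
      next
        fix z assume "z \<in> snd (f n) *o I"
        then obtain x where x: "x \<in> I" "z = snd (f n) * x" by (rule elt_set_timesE)
        then have "z = c * x - (c - snd (f n)) * x" by (simp add: algebra_simps)
        also have "\<dots> \<in> ?M"
        proof (rule module_diff[OF M(1)])
          show "c * x \<in> ?M" using Lmem(2)[OF x(1) c] M(2) by blast
          show "(c - snd (f n)) * x \<in> ?M" using pm2 near x(1) M(3) by blast
        qed
        finally show "z \<in> ?M" .
      qed
      then show ?thesis using f(3)[OF n(1)] by simp
    next
      case False
      show ?thesis
      proof (cases "a \<in> n")
        case True
        then have "c \<notin> n" using ac(2)[OF n(1) False] by blast
        then show ?thesis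
        proof (rule unit[rotated])
          show "c \<in> A" using c m by auto
          show "c * (x * y) \<in> ?M" if "x \<in> I" "y \<in> J" for x y
          proof -
            have "y \<in> A" using that m(4) by blast
            then have "c * (y * x) \<in> L" by (rule Lmem(2)[OF module_overD(3)[OF m(1) _ that(1)] c])
            then show ?thesis using M(2) by (auto simp: mult.commute[of y])
          qed
        qed
      next
        case False
        then show ?thesis
        proof (rule unit[OF aA])
          show "a * (x * y) \<in> ?M" if "x \<in> I" "y \<in> J" for x y
            using Lmem(1)[OF a(1) module_overD(3)[OF m(2) subsetD[OF m(3) that(1)] that(2)]] M(2) by blast
        qed
      qed
    qed
    then show False using n M by blast
  qed
  then show "idl_norm A I * idl_norm A J \<le> idl_norm A ?X"
    unfolding L_def using IJ a c by (intro norm_le_norm_prod)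
qed

section \<open>Passing to overrings\<close>

lemma num_ring_overring:
  assumes "subring_of B" "A \<subseteq> B" "B \<subseteq> K"
  shows "num_ring B"
proof
  have "frac_field B \<subseteq> K" using assms(3) K_divide unfolding frac_field_def[of B] by blast
  then show "number_ring B" using assms(1) number_ring unfolding number_ring_def by blast
qed

lemma common_K_denominator:
  assumes "finite F" "F \<subseteq> K"
  shows "\<exists>d\<in>A. d \<noteq> 0 \<and> (\<forall>t\<in>F. d * t \<in> A)"
  using assms
proof (induction F rule: finite_induct)
  case empty
  then show ?case using A1 by (intro bexI[of _ 1]) auto
next
  case (insert x F)
  then obtain d where d: "d \<in> A" "d \<noteq> 0" "\<And>t. t \<in> F \<Longrightarrow> d * t \<in> A" by auto
  obtain a b where ab: "a \<in> A" "b \<in> A" "b \<noteq> 0" "x = a / b" using insert.prems by (auto elim: KE)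
  show ?case
  proof (intro bexI[of _ "b * d"] conjI ballI)
    show "b * d \<in> A" "b * d \<noteq> 0" using ab d Amult by auto
    fix t assume "t \<in> insert x F"
    then consider "t = x" | "t \<in> F" by auto
    then show "b * d * t \<in> A"
    proof cases
      case 1
      then have "b * d * t = d * a" using ab by simp
      then show ?thesis using Amult[OF d(1) ab(1)] by (simp only:)
    next
      case 2
      then show ?thesis using Amult[OF ab(2) d(3)] by (simp add: mult.assoc)
    qed
  qed
qed

text \<open>\<open>X\<close> is generated over \<open>B\<close> by finitely many elements, namely
  \<open>n\<close> and representatives of \<open>X/nB\<close>. If \<open>d\<close> clears their
  denominators, three generators of the \<open>A\<close>-ideal \<open>dX \<inter> A\<close>, divided
  by \<open>d\<close>, produce all of them already over \<open>A\<close>.\<close>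

lemma generated_by_3_overring:
  assumes gen: "\<And>I. ideal_of A I \<Longrightarrow> generated_by_3 A I"
    and B: "subring_of B" "A \<subseteq> B" "B \<subseteq> K" and X: "ideal_of B X"
  shows "generated_by_3 B X"
proof -
  interpret B: num_ring B using B by (rule num_ring_overring)
  have Xm: "module_over B X" "X \<subseteq> B" using X by (auto simp: ideal_of_iff)
  show ?thesis
  proof (cases "X = {0}")
    case True
    then show ?thesis unfolding generated_by_3_def using B.A0 by (intro bexI[of _ 0]) auto
  next
    case False
    then obtain n where n: "n > 0" "of_nat n \<in> X" using B.module_nat_mem[OF Xm] by blast
    let ?N = "of_nat n *o B"
    have N: "?N \<subseteq> X" "module_over B ?N" "?N \<noteq> {0}"
      using B.principal_subset[OF Xm(1) n(2)] B.module_principal B.principal_mem(1)[of "of_nat n"] n(1) by auto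
    obtain T where T: "transversal T X ?N" using ex_transversal[OF B.module_add_subgroup[OF N(2)]] .
    have "finite T"
      using transversal_card(2)[OF B.module_add_subgroup[OF N(2)] T] B.finite_index_ideal[OF Xm(1) N(2,1) Xm(2) N(3)] by simp
    moreover have TX: "T \<subseteq> X" using T by (simp add: transversal_def)
    ultimately obtain d where d: "d \<in> A" "d \<noteq> 0" "\<And>t. t \<in> insert (of_nat n) T \<Longrightarrow> d * t \<in> A"
      using common_K_denominator[of "insert (of_nat n) T"] Xm(2) B(3) n(2) by blast
    have mod: "module_over A (d *o X)" "module_over A A"
      using module_scale module_over_subset[OF Xm(1) B(2)] module_over_A by auto
    have "ideal_of A (d *o X \<inter> A)" using module_Int[OF mod] by (simp add: ideal_of_iff)
    from gen[OF this] obtain a b c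
      where abc: "d *o X \<inter> A = {r * a + s * b + t * c | r s t. r \<in> A \<and> s \<in> A \<and> t \<in> A}"
      unfolding generated_by_3_def by blast
    have comb: "r * a + s * b + t * c \<in> d *o X" if "r \<in> A" "s \<in> A" "t \<in> A" for r s t using abc that by blast
    have "a \<in> d *o X" "b \<in> d *o X" "c \<in> d *o X"
      using comb[OF A1 A0 A0] comb[OF A0 A1 A0] comb[OF A0 A0 A1] by auto
    then obtain a' b' c' where abc': "a' \<in> X" "b' \<in> X" "c' \<in> X" "a = d * a'" "b = d * b'" "c = d * c'"
      by (auto elim!: elt_set_timesE)
    have rep: "\<exists>r s t. r \<in> A \<and> s \<in> A \<and> t \<in> A \<and> y = r * a' + s * b' + t * c'" if y: "y \<in> insert (of_nat n) T" for y
    proof -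
      have "d * y \<in> d *o X \<inter> A" using y d(3)[OF y] TX n by (auto intro: elt_set_timesI)
      then obtain r s t where rst: "r \<in> A" "s \<in> A" "t \<in> A" "d * y = r * a + s * b + t * c" using abc by blast
      then have "d * y = d * (r * a' + s * b' + t * c')" using abc' by (simp add: algebra_simps)
      then show ?thesis using d(2) rst by (intro exI[of _ r] exI[of _ s] exI[of _ t]) simp
    qed
    obtain r0 s0 t0 where n0: "r0 \<in> A" "s0 \<in> A" "t0 \<in> A" "of_nat n = r0 * a' + s0 * b' + t0 * c'"
      using rep[of "of_nat n"] by blast
    have "X = {r * a' + s * b' + t * c' | r s t. r \<in> B \<and> s \<in> B \<and> t \<in> B}"
    proof (intro equalityI subsetI)
      fix x assume x: "x \<in> X"
      obtain y where y: "y \<in> T" "x - y \<in> ?N" using T x unfolding transversal_def by blast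
      obtain u where u: "u \<in> B" "x - y = of_nat n * u" using y(2) by (rule elt_set_timesE)
      obtain r s t where rst: "r \<in> A" "s \<in> A" "t \<in> A" "y = r * a' + s * b' + t * c'" using rep[of y] y by blast
      have "x = y + of_nat n * u" using u by (simp add: algebra_simps)
      then have "x = (r + r0 * u) * a' + (s + s0 * u) * b' + (t + t0 * u) * c'"
        unfolding n0 rst by (simp add: algebra_simps)
      moreover have "r + r0 * u \<in> B" "s + s0 * u \<in> B" "t + t0 * u \<in> B"
        using rst n0 u B(2) by (auto intro!: B.Aadd B.Amult)
      ultimately show "x \<in> {r * a' + s * b' + t * c' | r s t. r \<in> B \<and> s \<in> B \<and> t \<in> B}" by blast
    next
      fix x assume "x \<in> {r * a' + s * b' + t * c' | r s t. r \<in> B \<and> s \<in> B \<and> t \<in> B}"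
      then obtain r s t where rst: "r \<in> B" "s \<in> B" "t \<in> B" "x = r * a' + s * b' + t * c'" by blast
      show "x \<in> X" unfolding rst(4)
        by (rule module_overD(2)[OF Xm(1) module_overD(2)[OF Xm(1) module_overD(3)[OF Xm(1) rst(1) abc'(1)]
              module_overD(3)[OF Xm(1) rst(2) abc'(2)]] module_overD(3)[OF Xm(1) rst(3) abc'(3)]])
    qed
    moreover have "a' \<in> B" "b' \<in> B" "c' \<in> B" using abc'(1-3) Xm(2) by auto
    ultimately show ?thesis unfolding generated_by_3_def
      by (intro bexI[of _ a'] bexI[of _ b'] bexI[of _ c'])
  qed
qed

end

section \<open>The normalization\<close>

lemma int_bezout_family:
  fixes a :: "nat \<Rightarrow> int"
  shows "\<exists>t. \<forall>i\<le>n. (\<Sum>i\<le>n. t i * a i) dvd a i"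
proof (induction n)
    case 0
    show ?case by (intro exI[of _ "\<lambda>_. 1"]) auto
  next
    case (Suc n)
    then obtain t where t: "\<And>i. i \<le> n \<Longrightarrow> (\<Sum>i\<le>n. t i * a i) dvd a i" by blast
    define g where "g = (\<Sum>i\<le>n. t i * a i)"
    obtain u v where uv: "u * g + v * a (Suc n) = gcd g (a (Suc n))" using bezout_int by blast
    define t' where "t' = (\<lambda>i. if i \<le> n then u * t i else v)"
    have "(\<Sum>i\<le>n. t' i * a i) = u * g"
      unfolding g_def sum_distrib_left by (intro sum.cong) (auto simp: t'_def)
    then have "(\<Sum>i\<le>Suc n. t' i * a i) = gcd g (a (Suc n))" using uv by (simp add: t'_def)
    moreover have "gcd g (a (Suc n)) dvd a i" if "i \<le> Suc n" for i
    proof (cases "i = Suc n")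
      case False
      then have "g dvd a i" using t[of i] that by (simp add: g_def)
      then show ?thesis by (rule dvd_trans[OF gcd_dvd1])
    qed simp
    ultimately show ?case by (intro exI[of _ t']) simp
  qed

definition power_span :: "nat \<Rightarrow> 'a::field_char_0 \<Rightarrow> 'a set" where
  "power_span n x = range (\<lambda>a::nat \<Rightarrow> int. \<Sum>i<n. of_int (a i) * x ^ i)"

text \<open>The multiplier ring \<open>(M : M)\<close>; for a nonzero lattice \<open>M\<close> it
  consists of integral elements.\<close>

definition stabilizer :: "'a::field_char_0 set \<Rightarrow> 'a set" where
  "stabilizer M = {y. \<forall>x\<in>M. y * x \<in> M}"

lemma add_subgroup_power_span: "add_subgroup (power_span n x)"
  unfolding add_subgroup_def
proof (intro conjI ballI)
  show "0 \<in> power_span n x" unfolding power_span_def by (intro image_eqI[of _ _ "\<lambda>_. 0"]) auto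
  fix y z assume "y \<in> power_span n x" "z \<in> power_span n x"
  then obtain a b :: "nat \<Rightarrow> int" where "y = (\<Sum>i<n. of_int (a i) * x ^ i)" "z = (\<Sum>i<n. of_int (b i) * x ^ i)"
    unfolding power_span_def by blast
  then show "y - z \<in> power_span n x" unfolding power_span_def
    by (intro image_eqI[of _ _ "\<lambda>i. a i - b i"]) (auto simp: sum_subtractf left_diff_distrib)
qed

lemma power_span_base: "i < n \<Longrightarrow> x ^ i \<in> power_span n x"
  unfolding power_span_def
proof (intro image_eqI[of _ _ "\<lambda>j. if j = i then 1 else 0"])
  assume "i < n"
  have "(\<Sum>j<n. of_int (if j = i then 1 else 0) * x ^ j) = (\<Sum>j<n. if j = i then x ^ j else 0)"
    by (intro sum.cong) auto
  then show "x ^ i = (\<Sum>j<n. of_int (if j = i then 1 else 0) * x ^ j)" using \<open>i < n\<close> by simp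
qed auto

lemma power_span_minimal:
  "add_subgroup X \<Longrightarrow> (\<And>i. i < n \<Longrightarrow> x ^ i \<in> X) \<Longrightarrow> power_span n x \<subseteq> X"
  unfolding power_span_def by (auto intro!: add_subgroup_sum add_subgroup_of_int)

lemma subring_stabilizer:
  assumes "add_subgroup M"
  shows "subring_of (stabilizer M)"
  unfolding subring_of_def stabilizer_def using add_subgroupD[OF assms]
  by (auto simp: distrib_right left_diff_distrib mult.assoc)

text \<open>
  For a root \<open>x\<close> of \<open>\<Sum> a\<^sub>i X\<^sup>i\<close> the elements \<open>c\<^sub>j = \<Sum> a\<^sub>i x\<^sup>i\<^sup>-\<^sup>j\<close> (sum over \<open>i \<ge> j\<close>) are integral and satisfy
  \<open>a\<^sub>j = c\<^sub>j - x c\<^sub>j\<^sub>+\<^sub>1\<close>. If the polynomial is primitive, some integral combination of the \<open>a\<^sub>j\<close> is 1,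
  which shows that the fractional ideal generated by 1 and \<open>x\<close> is invertible.
\<close>

lemma stabilizer_pruefer:
  assumes "algebraic (x::'a::field_char_0)"
  shows "\<exists>n>0. \<exists>u v. u + v * x = 1 \<and> {u, v, u * x, v * x} \<subseteq> stabilizer (power_span n x)"
proof -
  obtain p0 :: "int poly" where p0: "p0 \<noteq> 0" "poly (map_poly of_int p0) x = 0"
    using algebraicE'[OF assms] by blast
  define p where "p = primitive_part p0"
  have p: "p \<noteq> 0" "content p = 1" using p0 by (auto simp: p_def)
  have "map_poly (of_int :: int \<Rightarrow> 'a) p0 = smult (of_int (content p0)) (map_poly of_int p)"
  proof (rule poly_eqI)
    fix i
    have "coeff p0 i = content p0 * coeff p i"
      unfolding p_def coeff_smult[symmetric] content_times_primitive_part ..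
    then show "coeff (map_poly (of_int :: int \<Rightarrow> 'a) p0) i = coeff (smult (of_int (content p0)) (map_poly of_int p)) i"
      by (simp add: coeff_map_poly)
  qed
  then have root: "poly (map_poly of_int p) x = 0" using p0 by simp
  define n where "n = degree p"
  define a where "a = coeff p"
  have n0: "n > 0"
  proof (rule ccontr)
    assume "\<not> n > 0"
    then obtain k where "p = [:k:]" using degree_eq_zeroE[of p] by (auto simp: n_def)
    then show False using root p by (simp add: map_poly_pCons)
  qed
  have sum0: "(\<Sum>i\<le>n. of_int (a i) * x ^ i) = 0"
  proof -
    have "degree (map_poly (of_int :: int \<Rightarrow> 'a) p) = n" unfolding n_def by (rule degree_map_poly) simp
    then show ?thesis using root by (simp add: poly_altdef a_def coeff_map_poly)
  qed
  obtain t where t: "(\<Sum>j\<le>n. t j * a j) = 1"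
  proof -
    obtain t where "\<forall>i\<le>n. (\<Sum>j\<le>n. t j * a j) dvd a i" using int_bezout_family[of n a] by blast
    then have "(\<Sum>j\<le>n. t j * a j) dvd coeff p i" for i
      by (cases "i \<le> n") (auto simp: a_def n_def coeff_eq_0)
    then have "is_unit (\<Sum>j\<le>n. t j * a j)"
      using const_poly_dvd_iff_dvd_content[of "\<Sum>j\<le>n. t j * a j" p] p(2) by (simp add: const_poly_dvd_iff)
    then have "(\<Sum>j\<le>n. t j * a j) = 1 \<or> (\<Sum>j\<le>n. (- t j) * a j) = 1"
      by (auto simp: zdvd1_eq sum_negf abs_if split: if_splits)
    then show thesis using that[of t] that[of "\<lambda>j. - t j"] by auto
  qed
  define c where "c = (\<lambda>j. \<Sum>i\<in>{j..n}. of_int (a i) * x ^ (i - j))"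
  define M where "M = power_span n x"
  have M: "add_subgroup M" unfolding M_def by (rule add_subgroup_power_span)
  have pw: "x ^ i \<in> M" if "i < n" for i using that unfolding M_def by (rule power_span_base)
  interpret St: subring "stabilizer M" by unfold_locales (rule subring_stabilizer[OF M])
  have c_rec: "c j = of_int (a j) + x * c (Suc j)" if "j \<le> n" for j
  proof -
    have "c j = of_int (a j) * x ^ (j - j) + (\<Sum>i\<in>{Suc j..n}. of_int (a i) * x ^ (i - j))"
      unfolding c_def using that by (simp add: sum.atLeast_Suc_atMost)
    also have "(\<Sum>i\<in>{Suc j..n}. of_int (a i) * x ^ (i - j)) = x * c (Suc j)"
      unfolding c_def sum_distrib_left
    proof (intro sum.cong refl)
      fix i assume "i \<in> {Suc j..n}"
      then have "i - j = Suc (i - Suc j)" by auto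
      then show "of_int (a i) * x ^ (i - j) = x * (of_int (a i) * x ^ (i - Suc j))" by simp
    qed
    finally show ?thesis by simp
  qed
  have c_end: "c 0 = 0" "c (Suc n) = 0"
    using sum0 by (auto simp: c_def atLeast0AtMost)
  have c_stab: "c j \<in> stabilizer M" if "j \<le> Suc n" for j
  proof -
    \<comment> \<open>For \<open>i < j\<close> all exponents stay below \<open>n\<close>. For
      \<open>i \<ge> j\<close> the equation of \<open>x\<close> trades the upper part of the sum for
      its lower part, and the exponents \<open>l + (i - j)\<close> with \<open>l < j\<close> stay
      below \<open>n\<close> as well.\<close>
    have cM: "c j * x ^ i \<in> M" if i: "i < n" for i
    proof (cases "i < j")
      case True
      have "c j * x ^ i = (\<Sum>l\<in>{j..n}. of_int (a l) * x ^ (l - j + i))"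
        unfolding c_def sum_distrib_right by (simp only: power_add mult.assoc)
      also have "\<dots> \<in> M" using True i by (intro add_subgroup_sum add_subgroup_of_int M pw) auto
      finally show ?thesis .
    next
      case False
      have split: "{..n} = {..<j} \<union> {j..n}" using i False by auto
      have "0 = (\<Sum>l<j. of_int (a l) * x ^ l) + (\<Sum>l\<in>{j..n}. of_int (a l) * x ^ l)"
        unfolding sum0[symmetric] split by (rule sum.union_disjoint) auto
      then have "(\<Sum>l\<in>{j..n}. of_int (a l) * x ^ l) = - (\<Sum>l<j. of_int (a l) * x ^ l)"
        by (simp add: eq_neg_iff_add_eq_0 add.commute)
      moreover have "c j * x ^ j = (\<Sum>l\<in>{j..n}. of_int (a l) * x ^ l)"
        unfolding c_def sum_distrib_right
        by (intro sum.cong refl) (simp add: mult.assoc flip: power_add)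
      ultimately have "c j * x ^ j = - (\<Sum>l<j. of_int (a l) * x ^ l)" by simp
      moreover have "x ^ i = x ^ j * x ^ (i - j)" using False by (simp flip: power_add)
      ultimately have "c j * x ^ i = - (\<Sum>l<j. of_int (a l) * x ^ l) * x ^ (i - j)"
        by (simp flip: mult.assoc)
      also have "\<dots> = - (\<Sum>l<j. of_int (a l) * x ^ (l + (i - j)))"
        by (simp only: minus_mult_left[symmetric] sum_distrib_right power_add mult.assoc)
      also have "\<dots> \<in> M" using False i
        by (intro add_subgroupD(3)[OF M] add_subgroup_sum add_subgroup_of_int M pw) auto
      finally show ?thesis .
    qed
    have "M \<subseteq> {y. c j * y \<in> M}" unfolding M_def
    proof (rule power_span_minimal)
      show "add_subgroup {y. c j * y \<in> power_span n x}"
        using add_subgroupD[OF M] by (auto simp: add_subgroup_def M_def right_diff_distrib)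
      show "x ^ i \<in> {y. c j * y \<in> power_span n x}" if "i < n" for i using cM[OF that] by (simp add: M_def)
    qed
    then show ?thesis by (auto simp: stabilizer_def)
  qed
  have xc_stab: "x * c j \<in> stabilizer M" if j: "j \<le> Suc n" for j
  proof (cases j)
    case 0
    then show ?thesis using c_end St.A0 by simp
  next
    case (Suc i)
    then have "x * c j = c i - of_int (a i)" using c_rec[of i] j by simp
    then show ?thesis using St.Adiff[OF c_stab[of i] St.A_of_int] Suc j by simp
  qed
  define u v where "u = (\<Sum>j\<le>n. of_int (t j) * c j)" and "v = - (\<Sum>j\<le>n. of_int (t j) * c (Suc j))"
  have sum_x: "(\<Sum>j\<le>n. of_int (t j) * f j) * x = (\<Sum>j\<le>n. of_int (t j) * (x * f j))" for f
    unfolding sum_distrib_right by (intro sum.cong refl) (simp only: mult_ac)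
  have ux: "u * x = (\<Sum>j\<le>n. of_int (t j) * (x * c j))"
    unfolding u_def by (rule sum_x)
  have vx: "v * x = - (\<Sum>j\<le>n. of_int (t j) * (x * c (Suc j)))"
    unfolding v_def minus_mult_left[symmetric] sum_x ..
  have "u + v * x = (\<Sum>j\<le>n. of_int (t j) * (c j - x * c (Suc j)))"
    unfolding vx by (simp add: u_def sum_subtractf right_diff_distrib)
  also have "\<dots> = (\<Sum>j\<le>n. of_int (t j * a j))" by (intro sum.cong refl) (simp add: c_rec)
  also have "\<dots> = 1" using t by (metis of_int_1 of_int_sum)
  finally have 1: "u + v * x = 1" .
  have comb: "(\<Sum>j\<le>n. of_int (t j) * f j) \<in> stabilizer M" if "\<And>j. j \<le> n \<Longrightarrow> f j \<in> stabilizer M" for f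
    using that by (intro add_subgroup_sum add_subgroup_of_int St.add_subgroup_A) auto
  have "u \<in> stabilizer M" unfolding u_def by (intro comb c_stab) simp
  moreover have "u * x \<in> stabilizer M" unfolding ux by (intro comb xc_stab) simp
  moreover have "v \<in> stabilizer M" unfolding v_def by (intro St.Aminus comb c_stab) simp
  moreover have "v * x \<in> stabilizer M" unfolding vx by (intro St.Aminus comb xc_stab) simp
  ultimately show ?thesis using 1 n0 unfolding M_def by blast
qed

context num_ring
begin

text \<open>Integrality over \<open>A\<close> is encoded by a common integer denominator of all
  powers, which makes closure under sums and products, and the inclusion of multiplier rings, a
  direct check. The theorem is linked to it by \<open>S_subset_normalization\<close>, since the
  intermediate rings to be tested are of the form \<open>A + mS\<close>.\<close>

definition S :: "'a set" where
  "S = {x \<in> K. \<exists>E>0. \<forall>k. of_nat E * x ^ k \<in> A}"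

lemma A_subset_S: "A \<subseteq> S"
  using A_subset_K A_power by (auto simp: S_def intro!: exI[of _ 1])

lemma S_subset_K: "S \<subseteq> K"
  by (auto simp: S_def)

lemma subring_S: "subring_of S"
proof -
  have add: "x + y \<in> S" and mult: "x * y \<in> S" if xy: "x \<in> S" "y \<in> S" for x y
  proof -
    obtain E F where E: "E > 0" "\<And>k. of_nat E * x ^ k \<in> A" and F: "F > 0" "\<And>k. of_nat F * y ^ k \<in> A"
      using xy by (auto simp: S_def)
    have xyK: "x \<in> K" "y \<in> K" using xy S_subset_K by auto
    have EF: "of_nat (E * F) * (x ^ i * y ^ j) \<in> A" for i j
      using Amult[OF E(2)[of i] F(2)[of j]] by (simp add: mult_ac)
    have "of_nat (E * F) * (x + y) ^ k \<in> A" for k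
    proof -
      have "of_nat (E * F) * (x + y) ^ k = (\<Sum>i\<le>k. of_nat (k choose i) * (of_nat (E * F) * (x ^ i * y ^ (k - i))))"
        unfolding binomial_ring sum_distrib_left by (simp only: mult_ac)
      also have "\<dots> \<in> A" by (intro add_subgroup_sum add_subgroup_of_nat add_subgroup_A EF)
      finally show ?thesis .
    qed
    then show "x + y \<in> S" using K_add[OF xyK] E F by (auto simp: S_def intro!: exI[of _ "E * F"])
    have "of_nat (E * F) * (x * y) ^ k \<in> A" for k using EF[of k k] by (simp add: power_mult_distrib)
    then show "x * y \<in> S" using K_mult[OF xyK] E F by (auto simp: S_def intro!: exI[of _ "E * F"])
  qed
  have "x - y \<in> S" if "x \<in> S" "y \<in> S" for x y
    using add[OF that(1) mult[OF _ that(2)], of "-1"] A_subset_S Aminus[OF A1] by auto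
  then show ?thesis using add mult A_subset_S A0 A1 by (auto simp: subring_of_def)
qed

lemma num_ring_S: "num_ring S"
  using num_ring_overring subring_S A_subset_S S_subset_K .

text \<open>The ideals generated by \<open>E, E x, ..., E x ^ k\<close> all contain
  \<open>E\<close>, so two of them coincide; this expresses some \<open>E x ^ (k + 1)\<close> by
  lower terms, and \<open>E\<close> cancels.\<close>

lemma S_equation:
  assumes "x \<in> S"
  shows "\<exists>n>0. \<exists>r. (\<forall>i. r i \<in> A) \<and> x ^ n = (\<Sum>i<n. r i * x ^ i)"
proof -
  obtain E where E: "E > 0" "\<And>k. of_nat E * x ^ k \<in> A" using assms by (auto simp: S_def)
  let ?E = "of_nat E :: 'a"
  define Z where "Z = (\<lambda>k. {\<Sum>i\<le>k. r i * (?E * x ^ i) | r. \<forall>i. r i \<in> A})"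
  have Z_id: "ideal_of A (Z k)" for k
    unfolding ideal_of_def
  proof (intro conjI ballI)
    show "Z k \<subseteq> A"
    proof
      fix y assume "y \<in> Z k"
      then obtain r where "\<forall>i. r i \<in> A" "y = (\<Sum>i\<le>k. r i * (?E * x ^ i))" unfolding Z_def by blast
      then show "y \<in> A" using Amult[OF _ E(2)] by (auto intro!: add_subgroup_sum add_subgroup_A)
    qed
    show "0 \<in> Z k" unfolding Z_def using A0 by (auto intro!: exI[of _ "\<lambda>_. 0"])
    show "y + z \<in> Z k" if yz: "y \<in> Z k" "z \<in> Z k" for y z
    proof -
      obtain r s where "\<forall>i. r i \<in> A" "\<forall>i. s i \<in> A" "y = (\<Sum>i\<le>k. r i * (?E * x ^ i))"
        "z = (\<Sum>i\<le>k. s i * (?E * x ^ i))" using yz unfolding Z_def by blast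
      then show ?thesis unfolding Z_def using Aadd
        by (intro CollectI exI[of _ "\<lambda>i. r i + s i"]) (simp only: sum.distrib distrib_right, simp)
    qed
    show "q * y \<in> Z k" if qy: "q \<in> A" "y \<in> Z k" for q y
    proof -
      obtain r where "\<forall>i. r i \<in> A" "y = (\<Sum>i\<le>k. r i * (?E * x ^ i))" using qy unfolding Z_def by blast
      then show ?thesis unfolding Z_def using Amult qy(1)
        by (intro CollectI exI[of _ "\<lambda>i. q * r i"]) (simp only: sum_distrib_left mult.assoc, simp)
    qed
  qed
  have Z_mem: "?E * x ^ j \<in> Z k" if "j \<le> k" for j k
  proof -
    have "(\<Sum>i\<le>k. (if i = j then 1 else 0) * (?E * x ^ i)) = (\<Sum>i\<le>k. if i = j then ?E * x ^ i else 0)"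
      by (intro sum.cong) auto
    also have "\<dots> = ?E * x ^ j" using that by (subst sum.delta) auto
    finally show ?thesis unfolding Z_def using A0 A1
      by (intro CollectI exI[of _ "\<lambda>i. if i = j then 1 else 0"]) auto
  qed
  have "finite (range Z)"
  proof (rule finite_subset)
    show "range Z \<subseteq> {I. ideal_of A I \<and> ?E \<in> I}" using Z_id Z_mem[of 0] by auto
    show "finite {I. ideal_of A I \<and> ?E \<in> I}" using E(1) by (intro finite_ideals_containing A_of_nat) simp
  qed
  then have "\<not> inj Z" using finite_imageD[of Z UNIV] by auto
  then obtain k l where kl: "k < l" "Z k = Z l" unfolding inj_def by (metis nat_neq_iff)
  have "?E * x ^ Suc k \<in> Z k" using Z_mem[of "Suc k" l] kl by simp
  then obtain r where r: "\<forall>i. r i \<in> A" "?E * x ^ Suc k = (\<Sum>i\<le>k. r i * (?E * x ^ i))"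
    unfolding Z_def by blast
  have "?E * x ^ Suc k = ?E * (\<Sum>i\<le>k. r i * x ^ i)"
    unfolding r(2) sum_distrib_left by (simp only: mult_ac)
  then have "x ^ Suc k = (\<Sum>i\<le>k. r i * x ^ i)" using E(1) by (simp only: mult_cancel_left of_nat_eq_0_iff) simp
  then show ?thesis using r(1) by (intro exI[of _ "Suc k"] conjI exI[of _ r]) (simp_all add: lessThan_Suc_atMost del: power_Suc)
qed

lemma S_subset_normalization: "S \<subseteq> normalization_of A"
proof
  fix x assume x: "x \<in> S"
  obtain n r where r: "\<And>i. r i \<in> A" "x ^ n = (\<Sum>i<n. r i * x ^ i)" using S_equation[OF x] by blast
  define p where "p = monom 1 n - (\<Sum>i<n. monom (r i) i)"
  have c: "coeff p k = (if k = n then 1 else if k < n then - r k else 0)" for k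
    by (simp add: p_def coeff_sum coeff_monom)
  have "degree p = n"
    by (intro antisym degree_le le_degree) (auto simp: c)
  then have "lead_coeff p = 1" by (simp add: c)
  moreover have "coeff p i \<in> A" for i using r(1) A0 A1 Aminus by (simp add: c)
  moreover have "poly p x = 0" using r(2) by (simp add: p_def poly_sum poly_monom)
  ultimately show "x \<in> normalization_of A"
    using x S_subset_K unfolding normalization_of_def integral_over_def by blast
qed

lemma power_span_denominator:
  assumes "x \<in> K"
  shows "\<exists>E>0. \<forall>y\<in>power_span n x. of_nat E * y \<in> A"
proof -
  obtain d where d: "d \<in> A" "d \<noteq> 0" "\<And>t. t \<in> (\<lambda>i. x ^ i) ` {..<n} \<Longrightarrow> d * t \<in> A"
    using common_K_denominator[of "(\<lambda>i. x ^ i) ` {..<n}"] K_power[OF assms] by blast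
  obtain E c where E: "E > 0" "c \<in> A" "c * d = of_nat E" using ex_nat_multiple[OF d(1,2)] by blast
  have "power_span n x \<subseteq> {y. of_nat E * y \<in> A}"
  proof (rule power_span_minimal)
    show "add_subgroup {y. of_nat E * y \<in> A}"
      using A0 Adiff by (auto simp: add_subgroup_def right_diff_distrib)
    show "x ^ i \<in> {y. of_nat E * y \<in> A}" if "i < n" for i
      using Amult[OF E(2) d(3)[of "x ^ i"]] that by (simp flip: E(3) mult.assoc)
  qed
  then show ?thesis using E(1) by blast
qed

lemma power_span_subset_K: "x \<in> K \<Longrightarrow> power_span n x \<subseteq> K"
  by (intro power_span_minimal add_subgroup_K K_power)

text \<open>As \<open>n > 0\<close>, the span contains 1 and hence all powers of \<open>y\<close>,
  so a common denominator of the span serves them all.\<close>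

lemma stabilizer_subset_S:
  assumes "x \<in> K" "n > 0"
  shows "stabilizer (power_span n x) \<subseteq> S"
proof
  fix y assume y: "y \<in> stabilizer (power_span n x)"
  obtain E where E: "E > 0" "\<And>y. y \<in> power_span n x \<Longrightarrow> of_nat E * y \<in> A"
    using power_span_denominator[OF assms(1)] by blast
  have "y ^ k \<in> power_span n x" for k
  proof (induction k)
    case 0
    show ?case using power_span_base[OF assms(2), of x] by simp
  next
    case (Suc k)
    then show ?case using y by (simp add: stabilizer_def)
  qed
  from this[of 1] this show "y \<in> S"
    using E power_span_subset_K[OF assms(1)] by (auto simp: S_def)
qed

text \<open>At each maximal ideal of \<open>S\<close> one of \<open>\<alpha>\<close> and
  \<open>1 - \<alpha>\<close> is a unit, so locally one of \<open>x\<close> and \<open>y\<close>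
  divides the other: this is how locally principal ideals are expressed. With
  \<open>\<xi> = x / y\<close> and \<open>u + v \<xi> = 1\<close>, the witness is
  \<open>u\<close>.\<close>

lemma pruefer:
  assumes "x \<in> K" "y \<in> K"
  shows "\<exists>\<alpha>\<in>S. \<alpha> * x \<in> y *o S \<and> (1 - \<alpha>) * y \<in> x *o S"
proof (cases "y = 0")
  case True
  have "0 \<in> S" using A_subset_S A0 by auto
  then show ?thesis using True by (intro bexI[of _ 0]) (auto intro: elt_set_timesI[of 0])
next
  case False
  let ?\<xi> = "x / y"
  have \<xi>: "?\<xi> \<in> K" using assms K_divide by blast
  obtain n u v where n: "n > 0" and uv: "u + v * ?\<xi> = 1"
    "{u, v, u * ?\<xi>, v * ?\<xi>} \<subseteq> stabilizer (power_span n ?\<xi>)"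
    using stabilizer_pruefer[OF K_algebraic[OF \<xi>]] by blast
  have mem: "u \<in> S" "v \<in> S" "u * ?\<xi> \<in> S" using uv(2) stabilizer_subset_S[OF \<xi> n] by auto
  have "u * x = y * (u * ?\<xi>)" using False by simp
  moreover have "(1 - u) * y = x * v"
  proof -
    have "1 - u = v * ?\<xi>" using uv(1) by (simp add: algebra_simps)
    then show ?thesis using False by simp
  qed
  ultimately show ?thesis using mem by (intro bexI[of _ u]) (auto intro: elt_set_timesI)
qed

text \<open>An element of \<open>S\<close> is integral over \<open>A\<close> but in general not over
  the integers, so \<open>lattice_conductor\<close> does not apply to it directly. It is written as
  an \<open>A\<close>-combination of elements of one multiplier ring of a lattice, and to these the
  uniform \<open>D\<close> applies.\<close>

lemma conductor: "\<exists>D>0. \<forall>x\<in>S. of_nat D * x \<in> A"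
proof -
  obtain B where B: "finite B" "K \<subseteq> rat.span B" using K_finite_dim by blast
  obtain V where V: "V \<subseteq> A" "rat.independent V" "A \<subseteq> rat.span V"
    by (rule rat.maximal_independent_subset)
  have finV: "finite V"
    using rat.independent_span_bound[OF B(1) V(2)] V(1) A_subset_K B(2) by blast
  have K_sub: "rat.subspace K"
    by (intro rat.subspaceI) (use A_subset_K A0 K_add K_mult K_of_rat in auto)
  have spanV: "rat.span V = K"
  proof
    show "rat.span V \<subseteq> K" using V(1) A_subset_K by (intro rat.span_minimal K_sub) auto
    show "K \<subseteq> rat.span V"
    proof
      fix x assume "x \<in> K"
      then obtain a b where ab: "a \<in> A" "b \<in> A" "b \<noteq> 0" "x = a / b" by (rule KE)
      obtain n c where n: "n > 0" "c \<in> A" "c * b = of_nat n" using ex_nat_multiple[OF ab(2,3)] by blast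
      have c0: "c \<noteq> 0" using n(1,3) by auto
      have "x = (a * c) / (c * b)" using ab c0 by (simp add: field_simps)
      also have "\<dots> = of_rat (1 / of_nat n) * (a * c)" unfolding n(3) by (simp add: of_rat_divide)
      also have "\<dots> \<in> rat.span V" using V(3) Amult[OF ab(1) n(2)] by (intro rat.span_scale) auto
      finally show "x \<in> rat.span V" .
    qed
  qed
  have "v * w \<in> rat.span V" if "v \<in> V" "w \<in> V" for v w
    using V(1,3) Amult[of v w] that by blast
  then have "V * V \<subseteq> rat.span V" by (auto simp: set_times_def)
  then obtain N where N0: "N > 0" "\<forall>z\<in>V * V. of_nat N * z \<in> zspan V"
    using common_denominator[OF finV finite_set_times[OF finV finV]] by blast
  then have N: "N > 0" "\<And>v w. v \<in> V \<Longrightarrow> w \<in> V \<Longrightarrow> of_nat N * (v * w) \<in> zspan V"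
    by (auto simp: set_times_def)
  \<comment> \<open>Rescaling by \<open>N\<close> makes the integral span multiplicatively closed:
    \<open>(N v) (N w) = N (N v w)\<close>, and \<open>N v w\<close> lies in
    \<open>zspan V\<close>.\<close>
  define W where "W = (\<lambda>v. of_nat N * v) ` V"
  have inj: "inj_on (\<lambda>v. of_nat N * v) V" using N(1) by (auto simp: inj_on_def)
  have finW: "finite W" using finV by (simp add: W_def)
  have WA: "W \<subseteq> A" using V(1) by (auto simp: W_def intro: Amult A_of_nat)
  have indW: "rat.independent W"
  proof (rule rat.independent_if_scalars_zero[OF finW])
    fix f x assume f: "(\<Sum>x\<in>W. of_rat (f x) * x) = 0" and x: "x \<in> W"
    have "of_nat N * (\<Sum>v\<in>V. of_rat (f (of_nat N * v)) * v) = 0"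
      using f unfolding W_def sum.reindex[OF inj] sum_distrib_left o_def by (simp only: mult_ac)
    then have "(\<Sum>v\<in>V. of_rat (f (of_nat N * v)) * v) = 0" using N(1) by simp
    then have "f (of_nat N * v) = 0" if "v \<in> V" for v
      using rat.independentD[OF V(2) finV order_refl, of "\<lambda>v. f (of_nat N * v)"] that by blast
    then show "f x = 0" using x by (auto simp: W_def)
  qed
  have spanW: "rat.span W = K"
  proof
    show "rat.span W \<subseteq> K" using WA A_subset_K by (intro rat.span_minimal K_sub) auto
    have "V \<subseteq> rat.span W"
    proof
      fix v assume "v \<in> V"
      then have "of_rat (1 / of_nat N) * (of_nat N * v) \<in> rat.span W"
        by (intro rat.span_scale rat.span_base) (auto simp: W_def)
      then show "v \<in> rat.span W" using N(1) by (simp add: of_rat_divide)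
    qed
    then show "K \<subseteq> rat.span W" unfolding spanV[symmetric] by (intro rat.span_minimal) auto
  qed
  have WW: "v * w \<in> zspan W" if vw: "v \<in> W" "w \<in> W" for v w
  proof -
    obtain v' w' where v': "v' \<in> V" "w' \<in> V" "v = of_nat N * v'" "w = of_nat N * w'"
      using vw by (auto simp: W_def)
    have "zspan V \<subseteq> {z. of_nat N * z \<in> zspan W}"
    proof (rule zspan_minimal)
      show "add_subgroup {z. of_nat N * z \<in> zspan W}"
        using add_subgroupD[OF add_subgroup_zspan[of W]] by (auto simp: add_subgroup_def right_diff_distrib)
      show "V \<subseteq> {z. of_nat N * z \<in> zspan W}" using zspan_base[OF finW] by (auto simp: W_def)
    qed
    then have "of_nat N * (of_nat N * (v' * w')) \<in> zspan W" using N(2)[OF v'(1,2)] by blast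
    then show ?thesis by (simp add: v' mult_ac)
  qed
  obtain D where D: "D > 0" "\<And>y M. add_subgroup M \<Longrightarrow> 1 \<in> M \<Longrightarrow> (\<forall>x\<in>M. y * x \<in> M) \<Longrightarrow>
      (\<exists>E>0. \<forall>x\<in>M. of_nat E * x \<in> zspan W) \<Longrightarrow> of_nat D * y \<in> zspan W"
    using lattice_conductor[OF finW indW, unfolded spanW, OF subsetD[OF A_subset_K A1] K_mult K_inverse WW]
    by metis
  have zW: "zspan W \<subseteq> A" using zspan_minimal[OF add_subgroup_A WA] .
  have D_stab: "of_nat D * y \<in> A" if x: "x \<in> K" "n > 0" and y: "y \<in> stabilizer (power_span n x)" for x y n
  proof -
    have "\<exists>E>0. \<forall>z\<in>power_span n x. of_nat E * z \<in> zspan W"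
    proof -
      have "(\<lambda>i. x ^ i) ` {..<n} \<subseteq> rat.span W" unfolding spanW using K_power[OF x(1)] by auto
      then obtain E where E: "E > 0" "\<forall>z\<in>(\<lambda>i. x ^ i) ` {..<n}. of_nat E * z \<in> zspan W"
        using common_denominator[OF finW, of "(\<lambda>i. x ^ i) ` {..<n}"] by auto
      have "power_span n x \<subseteq> {z. of_nat E * z \<in> zspan W}"
      proof (rule power_span_minimal)
        show "add_subgroup {z. of_nat E * z \<in> zspan W}"
          using add_subgroupD[OF add_subgroup_zspan[of W]] by (auto simp: add_subgroup_def right_diff_distrib)
      qed (use E in auto)
      then show ?thesis using E(1) by blast
    qed
    then have "of_nat D * y \<in> zspan W"
      using y power_span_base[OF x(2), of x]
      by (intro D(2)[OF add_subgroup_power_span[of n x]]) (auto simp: stabilizer_def)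
    then show ?thesis using zW by blast
  qed
  have "of_nat D * x \<in> A" if xS: "x \<in> S" for x
  proof -
    have xK: "x \<in> K" using xS S_subset_K by blast
    obtain k r where r: "k > 0" "\<And>i. r i \<in> A" "x ^ k = (\<Sum>i<k. r i * x ^ i)" using S_equation[OF xS] by blast
    obtain m where m: "k = Suc m" using r(1) by (cases k) auto
    obtain n u v where n: "n > 0" and uv: "u + v * x = 1"
      "{u, v, u * x, v * x} \<subseteq> stabilizer (power_span n x)"
      using stabilizer_pruefer[OF K_algebraic[OF xK]] by blast
    let ?T = "stabilizer (power_span n x)"
    interpret T: subring ?T by unfold_locales (rule subring_stabilizer[OF add_subgroup_power_span])
    note DT = D_stab[OF xK n]
    have mem: "u \<in> ?T" "v \<in> ?T" "u * x \<in> ?T" "v * x \<in> ?T" using uv(2) by auto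
    \<comment> \<open>Expand this power. The terms containing \<open>u\<close> are products of
      \<open>u * x\<close>, \<open>v * x\<close> and \<open>u\<close>, all in the multiplier ring.
      The remaining term is \<open>v ^ m x ^ k\<close> with \<open>k = m + 1\<close>; the equation
      of degree \<open>k\<close> lowers the exponent of \<open>x\<close> to at most
      \<open>m\<close>, so that every \<open>x\<close> can be paired with a
      \<open>v\<close>.\<close>
    have "x = x * (v * x + u) ^ m" using uv(1) by (simp add: add.commute)
    also have "\<dots> = (\<Sum>j\<le>m. of_nat (m choose j) * (x * (v * x) ^ j * u ^ (m - j)))"
      unfolding binomial_ring sum_distrib_left by (simp only: mult_ac)
    finally have "of_nat D * x = of_nat D * (\<Sum>j\<le>m. of_nat (m choose j) * (x * (v * x) ^ j * u ^ (m - j)))"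
      by (rule arg_cong)
    also have "\<dots> = (\<Sum>j\<le>m. of_nat (m choose j) * (of_nat D * (x * (v * x) ^ j * u ^ (m - j))))"
      unfolding sum_distrib_left by (simp only: mult.left_commute)
    also have "\<dots> \<in> A"
    proof (rule add_subgroup_sum[OF add_subgroup_A], rule add_subgroup_of_nat[OF add_subgroup_A])
      fix j assume j: "j \<in> {..m}"
      show "of_nat D * (x * (v * x) ^ j * u ^ (m - j)) \<in> A"
      proof (cases "j = m")
        case False
        then obtain i where i: "m - j = Suc i" using j by (cases "m - j") auto
        have "x * (v * x) ^ j * u ^ (m - j) = (v * x) ^ j * (u * x) * u ^ i" unfolding i by (simp add: mult_ac)
        also have "\<dots> \<in> ?T" by (rule T.Amult[OF T.Amult[OF T.A_power[OF mem(4)] mem(3)] T.A_power[OF mem(1)]])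
        finally show ?thesis by (rule DT)
      next
        case True
        have "x * (v * x) ^ j * u ^ (m - j) = v ^ m * x ^ k" unfolding True m by (simp add: power_mult_distrib mult_ac)
        also have "\<dots> = (\<Sum>i<k. r i * (v ^ (m - i) * (v * x) ^ i))"
          unfolding r(3) sum_distrib_left
        proof (intro sum.cong refl)
          fix i assume "i \<in> {..<k}"
          then have "v ^ m = v ^ (m - i) * v ^ i" using m by (simp flip: power_add)
          then show "v ^ m * (r i * x ^ i) = r i * (v ^ (m - i) * (v * x) ^ i)"
            by (simp add: power_mult_distrib mult_ac)
        qed
        finally have "of_nat D * (x * (v * x) ^ j * u ^ (m - j)) = of_nat D * (\<Sum>i<k. r i * (v ^ (m - i) * (v * x) ^ i))"
          by (rule arg_cong)
        also have "\<dots> = (\<Sum>i<k. r i * (of_nat D * (v ^ (m - i) * (v * x) ^ i)))"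
          unfolding sum_distrib_left by (simp only: mult.left_commute)
        also have "\<dots> \<in> A"
          by (intro add_subgroup_sum[OF add_subgroup_A] Amult[OF r(2) DT[OF T.Amult[OF T.A_power[OF mem(2)] T.A_power[OF mem(4)]]]])
        finally show ?thesis .
      qed
    qed
    finally show ?thesis .
  qed
  then show ?thesis using D(1) by blast
qed

end

section \<open>Generators of ideals are bounded by generators of the normalization\<close>

text \<open>If \<open>c > d > 0\<close>, then \<open>(c / d) ^ N\<close> exceeds the constant
  \<open>d ^ s\<close> for large \<open>N\<close>.\<close>

lemma power_le_imp_le:
  assumes "\<And>N. c ^ N \<le> d ^ (N + s)"
  shows "(c::nat) \<le> d"
proof (rule ccontr)
  assume "\<not> c \<le> d"
  then have cd: "d < c" by simp
  have d0: "d > 0"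
  proof (rule ccontr)
    assume "\<not> d > 0"
    then show False using assms[of 1] cd by simp
  qed
  then have "1 < real c / real d" using cd by simp
  then obtain N where N: "real d ^ s < (real c / real d) ^ N" using real_arch_pow by blast
  then have "real d ^ s * real d ^ N < real c ^ N" using d0 by (simp add: power_divide pos_less_divide_eq)
  then have "real (d ^ (N + s)) < real (c ^ N)" by (simp add: power_add mult.commute)
  then show False using assms[of N] by linarith
qed

text \<open>
  Multiplication by a fixed polynomial maps \<open>X/F\<close>-polynomials with \<open>N\<close> coefficients injectively to
  \<open>X'/F'\<close>-polynomials with \<open>N + s\<close> coefficients; compare the cardinalities for large \<open>N\<close>.
\<close>

lemma index_le_of_poly_mult:
  fixes g :: "'a::field_char_0 poly"
  assumes sg: "add_subgroup X" "add_subgroup F" "add_subgroup X'" "add_subgroup F'"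
    and fin: "finite (cosets_of X F)" "finite (cosets_of X' F')"
    and g: "\<And>h. (\<And>j. coeff h j \<in> X) \<Longrightarrow> (\<And>k. coeff (g * h) k \<in> X')"
    and inj: "\<And>h. (\<And>j. coeff h j \<in> X) \<Longrightarrow> (\<And>k. coeff (g * h) k \<in> F') \<Longrightarrow> (\<And>j. coeff h j \<in> F)"
  shows "idl_norm X F \<le> idl_norm X' F'"
proof -
  obtain T where T: "transversal T X F" using ex_transversal[OF sg(2)] .
  obtain T' where T': "transversal T' X' F'" using ex_transversal[OF sg(4)] .
  have TX: "T \<subseteq> X" using T by (simp add: transversal_def)
  have fT: "finite T" "card T = idl_norm X F" using transversal_card[OF sg(2) T] fin by auto
  have fT': "finite T'" "card T' = idl_norm X' F'" using transversal_card[OF sg(4) T'] fin by auto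
  have "\<exists>\<rho>. \<forall>x\<in>X'. \<rho> x \<in> T' \<and> x - \<rho> x \<in> F'"
    using T' unfolding transversal_def by (intro bchoice) blast
  then obtain \<rho> where \<rho>: "\<And>x. x \<in> X' \<Longrightarrow> \<rho> x \<in> T'" "\<And>x. x \<in> X' \<Longrightarrow> x - \<rho> x \<in> F'" by blast
  have "card T ^ N \<le> card T' ^ (N + degree g)" for N
  proof -
    define P where "P = (\<lambda>f. \<Sum>i<N. monom (f i :: 'a) i)"
    have P: "coeff (P f) i = (if i < N then f i else 0)" for f i
      by (simp add: P_def coeff_sum coeff_monom)
    have PX: "coeff (P f) i \<in> X" if "f \<in> {..<N} \<rightarrow>\<^sub>E T" for f i
      using that TX add_subgroupD(1)[OF sg(1)] by (auto simp: P)
    have deg: "coeff (g * P f) k = 0" if "k \<ge> N + degree g" for f k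
    proof (cases "P f = 0")
      case False
      have "degree (P f) < N"
      proof (rule ccontr)
        assume "\<not> degree (P f) < N"
        then have "lead_coeff (P f) = 0" by (simp add: P)
        then show False using False by simp
      qed
      then have "degree (g * P f) < k" using degree_mult_le[of g "P f"] that by linarith
      then show ?thesis by (rule coeff_eq_0)
    qed simp
    \<comment> \<open>The coefficients of the product are recorded by their representatives modulo
      \<open>F'\<close>, so equal records put the coefficients of \<open>g * (P f - P f')\<close>
      into \<open>F'\<close>. Recording \<open>N + degree g\<close> of them suffices, as all later
      ones vanish.\<close>
    define \<Phi> where "\<Phi> = (\<lambda>f. \<lambda>k\<in>{..<N + degree g}. \<rho> (coeff (g * P f) k))"
    have "\<Phi> f \<in> {..<N + degree g} \<rightarrow>\<^sub>E T'" if f: "f \<in> {..<N} \<rightarrow>\<^sub>E T" for f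
      unfolding \<Phi>_def using \<rho>(1)[OF g[OF PX[OF f]]] by (rule restrict_PiE_iff[THEN iffD2, OF ballI])
    then have "\<Phi> ` ({..<N} \<rightarrow>\<^sub>E T) \<subseteq> {..<N + degree g} \<rightarrow>\<^sub>E T'" by blast
    moreover have "inj_on \<Phi> ({..<N} \<rightarrow>\<^sub>E T)"
    proof (rule inj_onI)
      fix f f' assume f: "f \<in> {..<N} \<rightarrow>\<^sub>E T" "f' \<in> {..<N} \<rightarrow>\<^sub>E T" and eq: "\<Phi> f = \<Phi> f'"
      have "coeff (g * (P f - P f')) k \<in> F'" for k
      proof (cases "k < N + degree g")
        case True
        have "\<rho> (coeff (g * P f) k) = \<rho> (coeff (g * P f') k)" using fun_cong[OF eq, of k] True by (simp add: \<Phi>_def)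
        then have "(coeff (g * P f) k - \<rho> (coeff (g * P f) k)) - (coeff (g * P f') k - \<rho> (coeff (g * P f) k)) \<in> F'"
          using add_subgroupD(2)[OF sg(4) \<rho>(2)[OF g[OF PX[OF f(1)]], of k] \<rho>(2)[OF g[OF PX[OF f(2)]], of k]]
          by (simp only:)
        then show ?thesis by (simp add: right_diff_distrib)
      next
        case False
        then show ?thesis using deg[of k] add_subgroupD(1)[OF sg(4)] by (simp add: right_diff_distrib)
      qed
      moreover have "coeff (P f - P f') j \<in> X" for j
        using add_subgroupD(2)[OF sg(1) PX[OF f(1)] PX[OF f(2)], of j] by simp
      ultimately have F: "coeff (P f - P f') j \<in> F" for j by (intro inj)
      have "f i = f' i" if i: "i < N" for i
      proof -
        have "f i - f' i \<in> F" using F[of i] i by (simp add: P)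
        moreover have "f i - f i \<in> F" using add_subgroupD(1)[OF sg(2)] by simp
        moreover have "f i \<in> T" "f' i \<in> T" using f i by auto
        ultimately show ?thesis using transversal_unique[OF T, of "f i" "f i" "f' i"] TX by auto
      qed
      then show "f = f'" using f by (intro PiE_ext[of f "{..<N}" "\<lambda>_. T" f']) auto
    qed
    ultimately have "card ({..<N} \<rightarrow>\<^sub>E T) \<le> card ({..<N + degree g} \<rightarrow>\<^sub>E T')"
      using fT'(1) by (intro card_inj_on_le[of \<Phi>] finite_PiE) auto
    then show ?thesis by (simp add: card_PiE)
  qed
  then show ?thesis using power_le_imp_le[of "card T" "card T'" "degree g"] fT fT' by simp
qed

section \<open>Valuations of the normalization and Gauss' lemma\<close>

context num_ring
begin

interpretation Sr: num_ring S by (rule num_ring_S)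

text \<open>\<open>vle Q x y\<close> says that \<open>y / x\<close> lies in the localization of \<open>S\<close> at \<open>Q\<close>, a valuation ring by \<open>pruefer\<close>.\<close>

definition vle :: "'a set \<Rightarrow> 'a \<Rightarrow> 'a \<Rightarrow> bool" where
  "vle Q x y \<longleftrightarrow> (\<exists>s\<in>S. s \<notin> Q \<and> s * y \<in> x *o S)"

lemma vle_refl: "Sr.maxid Q \<Longrightarrow> vle Q x x"
  unfolding vle_def using Sr.A1 Sr.maxidD(5) Sr.principal_mem(1) by (intro bexI[of _ 1]) auto

lemma vle_0: "Sr.maxid Q \<Longrightarrow> vle Q x 0"
  unfolding vle_def using Sr.A1 Sr.maxidD(5) module_overD(1)[OF Sr.module_principal] by (intro bexI[of _ 1]) auto

lemma vle_trans:
  assumes Q: "Sr.maxid Q" and xy: "vle Q x y" and yz: "vle Q y z"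
  shows "vle Q x z"
proof -
  obtain s a where s: "s \<in> S" "s \<notin> Q" "a \<in> S" "s * y = x * a" using xy by (auto simp: vle_def elim: elt_set_timesE)
  obtain t b where t: "t \<in> S" "t \<notin> Q" "b \<in> S" "t * z = y * b" using yz by (auto simp: vle_def elim: elt_set_timesE)
  have "s * t * z = s * (t * z)" by simp
  also have "\<dots> = (s * y) * b" unfolding t(4) by simp
  also have "\<dots> = x * (a * b)" unfolding s(4) by simp
  finally have "s * t * z = x * (a * b)" .
  then have "s * t * z \<in> x *o S" using Sr.Amult[OF s(3) t(3)] by (intro elt_set_timesI)
  moreover have "s * t \<notin> Q" using Sr.maxid_prime[OF Q s(1) t(1)] s t by blast
  ultimately show ?thesis unfolding vle_def using Sr.Amult[OF s(1) t(1)] by blast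
qed

text \<open>\<open>pruefer\<close> provides the denominator: if \<open>y / x\<close> is not in the
  valuation ring, then \<open>1 - \<alpha> \<in> Q\<close>, hence
  \<open>\<alpha> \<notin> Q\<close>, and \<open>x / y\<close> lies in the maximal ideal.\<close>

lemma not_vle_imp_strict:
  assumes Q: "Sr.maxid Q" and xy: "x \<in> K" "y \<in> K" "\<not> vle Q x y"
  shows "\<exists>s\<in>S. s \<notin> Q \<and> s * x \<in> y *o Q"
proof -
  obtain \<alpha> where \<alpha>: "\<alpha> \<in> S" "\<alpha> * x \<in> y *o S" "(1 - \<alpha>) * y \<in> x *o S" using pruefer[OF xy(1,2)] by blast
  have "1 - \<alpha> \<in> S" using Sr.Adiff[OF Sr.A1 \<alpha>(1)] .
  then have "1 - \<alpha> \<in> Q" using \<alpha>(3) xy(3) unfolding vle_def by blast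
  then have \<alpha>Q: "\<alpha> \<notin> Q" using module_overD(2)[OF Sr.maxidD(3)[OF Q], of \<alpha> "1 - \<alpha>"] Sr.maxidD(5)[OF Q] by auto
  obtain t where t: "t \<in> S" "\<alpha> * x = y * t" using \<alpha>(2) by (rule elt_set_timesE)
  have "t \<in> Q"
  proof (rule ccontr)
    assume "t \<notin> Q"
    moreover have "t * y = x * \<alpha>" using t(2) by (simp add: mult.commute)
    ultimately show False using xy(3) t(1) \<alpha>(1) unfolding vle_def by (auto intro: elt_set_timesI)
  qed
  then show ?thesis using \<alpha>(1) \<alpha>Q t(2) by (auto intro: elt_set_timesI)
qed

lemma vle_total:
  assumes Q: "Sr.maxid Q" and xy: "x \<in> K" "y \<in> K"
  shows "vle Q x y \<or> vle Q y x"
proof (rule disjCI)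
  assume "\<not> vle Q y x"
  then obtain s where "s \<in> S" "s \<notin> Q" "s * y \<in> x *o Q" using not_vle_imp_strict[OF Q xy(2,1)] by blast
  moreover have "x *o Q \<subseteq> x *o S" using Sr.maxidD(2)[OF Q] by (rule set_times_mono)
  ultimately show "vle Q x y" unfolding vle_def by blast
qed

text \<open>Gauss' lemma needs a pivot: a coefficient of least valuation such that all earlier ones
  have strictly larger valuation.\<close>

lemma ex_first_vle_minimal:
  fixes f :: "nat \<Rightarrow> 'a"
  assumes Q: "Sr.maxid Q" and f: "\<And>i. f i \<in> K"
  shows "\<exists>i0\<le>n. (\<forall>i\<le>n. vle Q (f i0) (f i)) \<and> (\<forall>i<i0. \<not> vle Q (f i) (f i0))"
proof -
  have ex: "\<exists>i0\<le>n. \<forall>i\<le>n. vle Q (f i0) (f i)" for n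
  proof (induction n)
    case 0
    show ?case using vle_refl[OF Q] by simp
  next
    case (Suc n)
    then obtain i0 where i0: "i0 \<le> n" "\<And>i. i \<le> n \<Longrightarrow> vle Q (f i0) (f i)" by blast
    show ?case
    proof (cases "vle Q (f i0) (f (Suc n))")
      case True
      then show ?thesis using i0 by (intro exI[of _ i0]) (auto simp: le_Suc_eq)
    next
      case False
      then have *: "vle Q (f (Suc n)) (f i0)" using vle_total[OF Q f f] by blast
      have "vle Q (f (Suc n)) (f i)" if "i \<le> Suc n" for i
      proof (cases "i = Suc n")
        case True
        then show ?thesis using vle_refl[OF Q] by simp
      next
        case False
        then show ?thesis using vle_trans[OF Q * i0(2)[of i]] that by simp
      qed
      then show ?thesis by blast
    qed
  qed
  define i0 where "i0 = (LEAST i0. i0 \<le> n \<and> (\<forall>i\<le>n. vle Q (f i0) (f i)))"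
  have i0: "i0 \<le> n" "\<And>i. i \<le> n \<Longrightarrow> vle Q (f i0) (f i)"
    using LeastI_ex[OF ex[of n]] unfolding i0_def by auto
  have "\<not> vle Q (f i) (f i0)" if i: "i < i0" for i
  proof
    assume *: "vle Q (f i) (f i0)"
    have "vle Q (f i) (f j)" if "j \<le> n" for j using vle_trans[OF Q * i0(2)[OF that]] .
    then have "i0 \<le> i" unfolding i0_def using i i0(1) by (intro Least_le) auto
    then show False using i by simp
  qed
  then show ?thesis using i0 by blast
qed

text \<open>\<open>Q\<close> is prime, so finitely many denominators outside \<open>Q\<close>
  multiply to one outside \<open>Q\<close>.\<close>

lemma ex_common_multiplier:
  assumes Q: "Sr.maxid Q" and "finite F"
    and "\<And>i. i \<in> F \<Longrightarrow> module_over S (Z i)" "\<And>i. i \<in> F \<Longrightarrow> \<exists>s\<in>S. s \<notin> Q \<and> s * f i \<in> Z i"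
  shows "\<exists>s\<in>S. s \<notin> Q \<and> (\<forall>i\<in>F. s * f i \<in> Z i)"
  using assms(2-4)
proof (induction F rule: finite_induct)
  case empty
  then show ?case using Sr.A1 Sr.maxidD(5)[OF Q] by (intro bexI[of _ 1]) auto
next
  case (insert j F)
  obtain s where s: "s \<in> S" "s \<notin> Q" "\<And>i. i \<in> F \<Longrightarrow> s * f i \<in> Z i" using insert.IH insert.prems by auto
  obtain t where t: "t \<in> S" "t \<notin> Q" "t * f j \<in> Z j" using insert.prems(2)[of j] by auto
  have "s * t * f i \<in> Z i" if "i \<in> insert j F" for i
  proof (cases "i = j")
    case True
    then show ?thesis using module_overD(3)[OF insert.prems(1)[of j] s(1) t(3)] by (simp add: mult.assoc)
  next
    case False
    then have i: "i \<in> F" using that by simp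
    then show ?thesis using module_overD(3)[OF insert.prems(1)[of i] t(1) s(3)[OF i]] by (simp add: mult_ac)
  qed
  moreover have "s * t \<notin> Q" using Sr.maxid_prime[OF Q s(1) t(1)] s t by blast
  ultimately show ?case using Sr.Amult[OF s(1) t(1)] by blast
qed

text \<open>At a maximal ideal \<open>Q\<close>, the product of the pivots of \<open>g\<close> and
  \<open>h\<close> dominates one coefficient of \<open>g * h\<close>. This coefficient lies in the
  content of \<open>g\<close>, so the pivot of \<open>h\<close>, and with it all of
  \<open>h\<close>, has nonnegative valuation. The content is represented by \<open>M\<close>, about
  which only minimality among the \<open>S\<close>-modules containing the coefficients is
  assumed.\<close>

lemma gauss_content:
  fixes g h :: "'a poly"
  assumes g: "\<And>i. coeff g i \<in> K" "g \<noteq> 0" and h: "\<And>i. coeff h i \<in> K"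
    and E: "E > 0" "\<And>i. of_nat E * coeff h i \<in> S"
    and M: "\<And>Z. module_over S Z \<Longrightarrow> (\<And>i. coeff g i \<in> Z) \<Longrightarrow> M \<subseteq> Z"
    and gh: "\<And>k. coeff (g * h) k \<in> M"
  shows "coeff h j \<in> S"
proof -
  \<comment> \<open>This is the ideal of denominators of \<open>h\<close>. It is nonzero by
    \<open>E\<close>, and it will turn out to lie in no maximal ideal.\<close>
  define d where "d = {s \<in> S. \<forall>j. s * coeff h j \<in> S}"
  have d: "ideal_of S d"
    unfolding d_def ideal_of_def using Sr.A0 Sr.Aadd Sr.Amult by (auto simp: distrib_right mult.assoc)
  have Ed: "of_nat E \<in> d" using E(2) Sr.A_of_nat by (auto simp: d_def)
  have "1 \<in> d"
  proof (rule ccontr)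
    assume "1 \<notin> d"
    moreover have "d \<noteq> {0}" using Ed E(1) by auto
    ultimately obtain Q where Q: "Sr.maxid Q" "d \<subseteq> Q" using Sr.ex_maxid[OF d] by blast
    have Q0: "0 \<in> Q" using module_overD(1)[OF Sr.maxidD(3)[OF Q(1)]] .
    have h0: "h \<noteq> 0"
    proof
      assume "h = 0"
      then have "1 \<in> d" using Sr.A0 Sr.A1 by (simp add: d_def)
      then show False using \<open>1 \<notin> d\<close> by simp
    qed
    obtain i0 where i0: "\<And>i. i \<le> degree g \<Longrightarrow> vle Q (coeff g i0) (coeff g i)"
        "\<And>i. i < i0 \<Longrightarrow> \<not> vle Q (coeff g i) (coeff g i0)"
      using ex_first_vle_minimal[OF Q(1), of "coeff g" "degree g"] g(1) by blast
    obtain j0 where j0: "\<And>i. i \<le> degree h \<Longrightarrow> vle Q (coeff h j0) (coeff h i)"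
        "\<And>i. i < j0 \<Longrightarrow> \<not> vle Q (coeff h i) (coeff h j0)"
      using ex_first_vle_minimal[OF Q(1), of "coeff h" "degree h"] h(1) by blast
    have vg: "vle Q (coeff g i0) (coeff g i)" for i
      using i0(1)[of i] vle_0[OF Q(1)] by (cases "i \<le> degree g") (auto simp: coeff_eq_0)
    have vh: "vle Q (coeff h j0) (coeff h i)" for i
      using j0(1)[of i] vle_0[OF Q(1)] by (cases "i \<le> degree h") (auto simp: coeff_eq_0)
    have g0: "coeff g i0 \<noteq> 0"
    proof
      assume 0: "coeff g i0 = 0"
      obtain s where s: "s \<notin> Q" "s * lead_coeff g \<in> coeff g i0 *o S" using vg unfolding vle_def by blast
      have "s * lead_coeff g = 0" using s(2) unfolding 0 by (auto elim: elt_set_timesE)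
      then show False using s(1) Q0 g(2) by auto
    qed
    define n z where "n = i0 + j0" and "z = coeff g i0 * coeff h j0"
    let ?f = "\<lambda>i. coeff g i * coeff h (n - i)"
    have zQ: "module_over S (z *o Q)" by (rule Sr.module_scale[OF Sr.maxidD(3)[OF Q(1)]])
    \<comment> \<open>If \<open>i < i0\<close>, the factor from \<open>g\<close> has strictly larger
      valuation than its pivot; if \<open>i > i0\<close>, then \<open>n - i < j0\<close> and the
      factor from \<open>h\<close> has. So every term but the one at \<open>i0\<close> lies locally
      in \<open>z\<close> times \<open>Q\<close>.\<close>
    have "\<exists>s\<in>S. s \<notin> Q \<and> s * ?f i \<in> z *o Q" if i: "i \<in> {..n} - {i0}" for i
    proof (cases "i < i0")
      case True
      obtain s q where s: "s \<in> S" "s \<notin> Q" "q \<in> Q" "s * coeff g i = coeff g i0 * q"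
        using not_vle_imp_strict[OF Q(1) g(1) g(1) i0(2)[OF True]] by (auto elim: elt_set_timesE)
      obtain t b where t: "t \<in> S" "t \<notin> Q" "b \<in> S" "t * coeff h (n - i) = coeff h j0 * b"
        using vh[of "n - i"] unfolding vle_def by (auto elim: elt_set_timesE)
      have "s * t * ?f i = (s * coeff g i) * (t * coeff h (n - i))" by (simp only: mult_ac)
      also have "\<dots> = z * (b * q)" unfolding s(4) t(4) z_def by (simp only: mult_ac)
      finally have "s * t * ?f i \<in> z *o Q"
        using module_overD(3)[OF Sr.maxidD(3)[OF Q(1)] t(3) s(3)] by (intro elt_set_timesI)
      moreover have "s * t \<notin> Q" using Sr.maxid_prime[OF Q(1) s(1) t(1)] s t by blast
      ultimately show ?thesis using Sr.Amult[OF s(1) t(1)] by blast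
    next
      case False
      then have lt: "n - i < j0" using i by (auto simp: n_def)
      obtain s q where s: "s \<in> S" "s \<notin> Q" "q \<in> Q" "s * coeff h (n - i) = coeff h j0 * q"
        using not_vle_imp_strict[OF Q(1) h(1) h(1) j0(2)[OF lt]] by (auto elim: elt_set_timesE)
      obtain t b where t: "t \<in> S" "t \<notin> Q" "b \<in> S" "t * coeff g i = coeff g i0 * b"
        using vg[of i] unfolding vle_def by (auto elim: elt_set_timesE)
      have "s * t * ?f i = (t * coeff g i) * (s * coeff h (n - i))" by (simp only: mult_ac)
      also have "\<dots> = z * (b * q)" unfolding s(4) t(4) z_def by (simp only: mult_ac)
      finally have "s * t * ?f i \<in> z *o Q"
        using module_overD(3)[OF Sr.maxidD(3)[OF Q(1)] t(3) s(3)] by (intro elt_set_timesI)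
      moreover have "s * t \<notin> Q" using Sr.maxid_prime[OF Q(1) s(1) t(1)] s t by blast
      ultimately show ?thesis using Sr.Amult[OF s(1) t(1)] by blast
    qed
    then obtain s where s: "s \<in> S" "s \<notin> Q" "\<And>i. i \<in> {..n} - {i0} \<Longrightarrow> s * ?f i \<in> z *o Q"
      using ex_common_multiplier[OF Q(1), of "{..n} - {i0}" "\<lambda>_. z *o Q" ?f] zQ by auto
    have "s * (\<Sum>i\<in>{..n} - {i0}. ?f i) \<in> z *o Q"
      unfolding sum_distrib_left using s(3) by (rule Sr.module_sum[OF zQ])
    then obtain q where q: "q \<in> Q" "s * (\<Sum>i\<in>{..n} - {i0}. ?f i) = z * q" by (rule elt_set_timesE)
    have "coeff (g * h) n = (\<Sum>i\<le>n. ?f i)" by (rule coeff_mult)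
    also have "\<dots> = ?f i0 + (\<Sum>i\<in>{..n} - {i0}. ?f i)" by (rule sum.remove) (auto simp: n_def)
    finally have "s * coeff (g * h) n = s * z + z * q"
      unfolding q(2)[symmetric] distrib_left[symmetric] by (simp add: z_def n_def)
    \<comment> \<open>Both \<open>s\<close> and \<open>s + q\<close> are outside \<open>Q\<close>,
      so the coefficient at \<open>n\<close> equals \<open>z\<close> up to a local unit.\<close>
    then have sw: "s * coeff (g * h) n = (s + q) * z" by (simp only: distrib_right mult.commute[of z])
    have "\<exists>s\<in>S. s \<notin> Q \<and> s * coeff g i \<in> coeff g i0 *o S" for i using vg[of i] by (simp add: vle_def)
    then obtain s' where s': "s' \<in> S" "s' \<notin> Q" "\<And>i. i \<le> degree g \<Longrightarrow> s' * coeff g i \<in> coeff g i0 *o S"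
      using ex_common_multiplier[OF Q(1), of "{..degree g}" "\<lambda>_. coeff g i0 *o S" "coeff g"] Sr.module_principal by auto
    have "M \<subseteq> {w. s' * w \<in> coeff g i0 *o S}"
    proof (rule M)
      show "module_over S {w. s' * w \<in> coeff g i0 *o S}"
        using module_overD[OF Sr.module_principal[of "coeff g i0"]]
        by (auto simp: module_over_def distrib_left mult.left_commute[of s'])
      show "coeff g i \<in> {w. s' * w \<in> coeff g i0 *o S}" for i
        using s'(3)[of i] module_overD(1)[OF Sr.module_principal] by (cases "i \<le> degree g") (auto simp: coeff_eq_0)
    qed
    then have "s' * coeff (g * h) n \<in> coeff g i0 *o S" using gh by blast
    then have "s * (s' * coeff (g * h) n) \<in> coeff g i0 *o S" by (rule module_overD(3)[OF Sr.module_principal s(1)])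
    then obtain b where b: "b \<in> S" "s * (s' * coeff (g * h) n) = coeff g i0 * b" by (rule elt_set_timesE)
    define \<sigma> where "\<sigma> = s' * (s + q)"
    have qS: "q \<in> S" using q(1) Sr.maxidD(2)[OF Q(1)] by blast
    have sqQ: "s + q \<notin> Q" using Sr.module_diff[OF Sr.maxidD(3)[OF Q(1)] _ q(1), of "s + q"] s(2) by auto
    have \<sigma>: "\<sigma> \<in> S" "\<sigma> \<notin> Q"
      using Sr.Amult[OF s'(1) Sr.Aadd[OF s(1) qS]] Sr.maxid_prime[OF Q(1) s'(1) Sr.Aadd[OF s(1) qS]] s'(2) sqQ
      by (auto simp: \<sigma>_def)
    have "coeff g i0 * (\<sigma> * coeff h j0) = s' * ((s + q) * z)" unfolding \<sigma>_def z_def by (simp only: mult_ac)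
    also have "\<dots> = coeff g i0 * b" unfolding sw[symmetric] b(2)[symmetric] by (simp only: mult_ac)
    finally have \<sigma>h: "\<sigma> * coeff h j0 \<in> S" using g0 b(1) by simp
    have "\<exists>s\<in>S. s \<notin> Q \<and> s * coeff h i \<in> coeff h j0 *o S" for i using vh[of i] by (simp add: vle_def)
    then obtain r where r: "r \<in> S" "r \<notin> Q" "\<And>i. i \<le> degree h \<Longrightarrow> r * coeff h i \<in> coeff h j0 *o S"
      using ex_common_multiplier[OF Q(1), of "{..degree h}" "\<lambda>_. coeff h j0 *o S" "coeff h"] Sr.module_principal by auto
    have "\<sigma> * r * coeff h i \<in> S" for i
    proof (cases "i \<le> degree h")
      case True
      then obtain c where c: "c \<in> S" "r * coeff h i = coeff h j0 * c" using r(3) by (auto elim: elt_set_timesE)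
      have "\<sigma> * r * coeff h i = \<sigma> * coeff h j0 * c" using c(2) by (simp add: mult.assoc)
      then show ?thesis using Sr.Amult[OF \<sigma>h c(1)] by (simp only:)
    next
      case False
      then show ?thesis using Sr.A0 by (simp add: coeff_eq_0)
    qed
    then have "\<sigma> * r \<in> d" using Sr.Amult[OF \<sigma>(1) r(1)] by (simp add: d_def)
    then show False using Q(2) Sr.maxid_prime[OF Q(1) \<sigma>(1) r(1)] \<sigma>(2) r(2) by blast
  qed
  then show ?thesis by (simp add: d_def)
qed

text \<open>Generators are a positive integer \<open>n\<close> in \<open>m\<close> and
  representatives of the finite group \<open>m/nA\<close>.\<close>

lemma maxid_finitely_generated:
  assumes m: "maxid m"
  shows "\<exists>F. finite F \<and> F \<subseteq> m \<and> (\<forall>Z. module_over A Z \<and> F \<subseteq> Z \<longrightarrow> m \<subseteq> Z)"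
proof -
  note mm = maxidD(3)[OF m] maxidD(2)[OF m]
  obtain n where n: "n > 0" "of_nat n \<in> m" using module_nat_mem[OF mm maxidD(4)[OF m]] by blast
  let ?N = "of_nat n *o A"
  have N: "?N \<subseteq> m" "module_over A ?N" "?N \<noteq> {0}"
    using principal_subset[OF mm(1) n(2)] module_principal principal_mem(1)[of "of_nat n"] n(1) by auto
  obtain T where T: "transversal T m ?N" using ex_transversal[OF module_add_subgroup[OF N(2)]] .
  have "finite T"
    using transversal_card(2)[OF module_add_subgroup[OF N(2)] T] finite_index_ideal[OF mm(1) N(2,1) mm(2) N(3)] by simp
  moreover have "T \<subseteq> m" using T by (simp add: transversal_def)
  moreover have "m \<subseteq> Z" if Z: "module_over A Z" "insert (of_nat n) T \<subseteq> Z" for Z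
  proof
    fix x assume "x \<in> m"
    then obtain t where t: "t \<in> T" "x - t \<in> ?N" using T unfolding transversal_def by blast
    have "t + (x - t) \<in> Z"
      using t Z principal_subset[OF Z(1), of "of_nat n"] by (intro module_overD(2)[OF Z(1)]) auto
    then show "x \<in> Z" by simp
  qed
  ultimately show ?thesis using n(2) by (intro exI[of _ "insert (of_nat n) T"]) blast
qed

text \<open>Both indices are compared through \<open>ES \<subseteq> X\<close>: one has
  \<open>[X:mX] [mX:EmS] = [X:ES] [S:mS]\<close>. It remains to see
  \<open>[X:ES] \<le> [mX:EmS]\<close>, which \<open>index_le_of_poly_mult\<close> gives for a
  polynomial \<open>g\<close> whose coefficients generate \<open>m\<close>; its injectivity
  hypothesis is Gauss' lemma.\<close>

lemma index_le_index_S: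
  assumes m: "maxid m" and X: "ideal_of A X" "X \<noteq> {0}"
  shows "idl_norm X (prod_ideal_of m X) \<le> idl_norm S (prod_ideal_of m S)"
proof -
  have Xm: "module_over A X" "X \<subseteq> A" using X by (auto simp: ideal_of_iff)
  note mm = maxidD(3)[OF m] maxidD(2)[OF m]
  have SA: "module_over A S" by (rule module_over_subset[OF Sr.module_over_A A_subset_S])
  let ?mS = "prod_ideal_of m S" and ?mX = "prod_ideal_of m X"
  have mods: "module_over A ?mS" "module_over A ?mX" "?mS \<subseteq> S" "?mX \<subseteq> X"
    using module_over_prod_right SA Xm mprod_subset[OF SA mm(2)] mprod_subset[OF Xm(1) mm(2)] by auto
  have SmS: "module_over S ?mS" by (rule Sr.module_over_prod_right[OF Sr.module_over_A])
  obtain n where n: "n > 0" "of_nat n \<in> X" using module_nat_mem[OF Xm X(2)] by blast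
  obtain D where D: "D > 0" "\<And>x. x \<in> S \<Longrightarrow> of_nat D * x \<in> A" using conductor by blast
  \<comment> \<open>\<open>D\<close> moves \<open>S\<close> into \<open>A\<close>, and
    \<open>n\<close> moves \<open>A\<close> into \<open>X\<close>.\<close>
  define E where "E = n * D"
  have E: "E > 0" using n D by (simp add: E_def)
  let ?E = "of_nat E :: 'a"
  have E0: "?E \<noteq> 0" using E by simp
  have ES: "?E * x \<in> X" if "x \<in> S" for x
    using module_overD(3)[OF Xm(1) D(2)[OF that] n(2)] by (simp add: E_def mult_ac)
  have ESX: "?E *o S \<subseteq> X" using ES by (auto elim: elt_set_timesE)
  have EmS: "?E *o ?mS \<subseteq> ?mX"
  proof -
    have "?mS \<subseteq> {x. ?E * x \<in> ?mX}"
    proof (rule prod_ideal_minimal)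
      show "a * s \<in> {x. ?E * x \<in> ?mX}" if "a \<in> m" "s \<in> S" for a s
        using prod_idealI[OF that(1) ES[OF that(2)]] by (simp add: mult.left_commute)
    qed (use module_overD(1,2)[OF mods(2)] in \<open>auto simp: distrib_left\<close>)
    then show ?thesis by (auto elim: elt_set_timesE)
  qed
  have EmS': "?E *o ?mS \<subseteq> ?E *o S" using mods(3) by (rule set_times_mono)
  have sg: "add_subgroup X" "add_subgroup (?E *o S)" "add_subgroup ?mX" "add_subgroup (?E *o ?mS)" "add_subgroup S" "add_subgroup ?mS"
    using Xm mods SA module_add_subgroup add_subgroup_scale by blast+
  have XS: "X \<subseteq> S" using Xm A_subset_S by blast
  have XK: "X \<subseteq> K" using XS S_subset_K by blast
  have fin1: "finite (cosets_of X (?E *o S))"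
    using XS by (intro finite_index[OF sg(1,2) XK ESX E]) (auto intro: elt_set_timesI)
  have "?mX \<subseteq> ?mS" using XS prod_idealI by (intro prod_ideal_subset[OF mods(1)]) blast
  then have fin2: "finite (cosets_of ?mX (?E *o ?mS))"
    using mods(4) XK by (intro finite_index[OF sg(3,4) _ EmS E]) (auto intro: elt_set_timesI)
  obtain F where F': "finite F \<and> F \<subseteq> m \<and> (\<forall>Z. module_over A Z \<and> F \<subseteq> Z \<longrightarrow> m \<subseteq> Z)"
    using maxid_finitely_generated[OF m] ..
  have F: "finite F" "F \<subseteq> m" "\<And>Z. module_over A Z \<Longrightarrow> F \<subseteq> Z \<Longrightarrow> m \<subseteq> Z"
    using F' by simp_all
  obtain fs where fs: "set fs = F" using finite_list[OF F(1)] by blast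
  define g where "g = Poly fs"
  have gm: "coeff g i \<in> m" for i
    using F(2) fs module_overD(1)[OF mm(1)] nth_mem[of i fs] by (auto simp: g_def nth_default_def)
  have Fg: "\<exists>i. x = coeff g i" if x: "x \<in> F" for x
  proof -
    obtain i where i: "i < length fs" "fs ! i = x" using x unfolding fs[symmetric] in_set_conv_nth by blast
    have "coeff g i = x" using i by (simp add: g_def nth_default_def)
    then show ?thesis by blast
  qed
  have g0: "g \<noteq> 0"
  proof
    assume "g = 0"
    then have "F \<subseteq> {0}" using Fg by fastforce
    then have "m \<subseteq> {0}" by (intro F(3)) (auto simp: module_over_def)
    then show False using maxidD(4)[OF m] module_overD(1)[OF mm(1)] by auto
  qed
  have le: "idl_norm X (?E *o S) \<le> idl_norm ?mX (?E *o ?mS)"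
  proof (rule index_le_of_poly_mult[OF sg(1-4) fin1 fin2])
    show "coeff (g * h) k \<in> ?mX" if "\<And>j. coeff h j \<in> X" for h k
      unfolding coeff_mult using gm that by (intro add_subgroup_sum[OF sg(3)] prod_idealI)
    fix h :: "'a poly" and j assume h: "\<And>j. coeff h j \<in> X" and gh: "\<And>k. coeff (g * h) k \<in> ?E *o ?mS"
    \<comment> \<open>After division by \<open>E\<close>, the coefficients of \<open>g * h'\<close>
      lie in \<open>mS\<close>, the content of \<open>g\<close>, and those of \<open>h'\<close> are
      claimed to lie in \<open>S\<close>.\<close>
    define h' where "h' = smult (1 / ?E) h"
    have h': "?E * coeff h' i = coeff h i" for i using E0 by (simp add: h'_def)
    have "coeff h' j \<in> S"
    proof (rule gauss_content[OF _ g0 _ E])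
      show "coeff g i \<in> K" for i using gm mm(2) A_subset_K by blast
      show "coeff h' i \<in> K" for i
        using K_divide[of "coeff h i" ?E] h XK A_subset_K A_of_nat[of E] by (simp add: h'_def) blast
      show "?E * coeff h' i \<in> S" for i using h XS h' by auto
      show "coeff (g * h') k \<in> ?mS" for k
      proof -
        obtain w where w: "w \<in> ?mS" "coeff (g * h) k = ?E * w" using gh[of k] by (rule elt_set_timesE)
        have "coeff (g * h') k = (1 / ?E) * coeff (g * h) k" by (simp add: h'_def)
        then show ?thesis using w E0 by simp
      qed
      fix Z assume Z: "module_over S Z" "\<And>i. coeff g i \<in> Z"
      have "m \<subseteq> Z" using F(3)[OF module_over_subset[OF Z(1) A_subset_S]] Fg Z(2) by blast
      then show "?mS \<subseteq> Z"
        unfolding prod_ideal_commute[of m S] using module_overD(3)[OF Z(1)] by (intro prod_ideal_subset[OF Z(1)]) blast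
    qed
    then show "coeff h j \<in> ?E *o S" using h'[of j] by (intro elt_set_timesI[of "coeff h' j"]) auto
  qed
  have "idl_norm X ?mX * idl_norm ?mX (?E *o ?mS) = idl_norm X (?E *o ?mS)"
    by (rule index_tower(1)[OF sg(4,3,1) EmS mods(4), symmetric])
  also have "\<dots> = idl_norm X (?E *o S) * idl_norm (?E *o S) (?E *o ?mS)"
    by (rule index_tower(1)[OF sg(4,2,1) EmS' ESX])
  also have "\<dots> = idl_norm X (?E *o S) * idl_norm S ?mS"
    using index_scale(1)[OF sg(6) E0] by simp
  also have "\<dots> \<le> idl_norm ?mX (?E *o ?mS) * idl_norm S ?mS" using le by simp
  finally have "idl_norm X ?mX * idl_norm ?mX (?E *o ?mS) \<le> idl_norm ?mX (?E *o ?mS) * idl_norm S ?mS" .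
  moreover have "idl_norm ?mX (?E *o ?mS) > 0"
    using module_overD(1)[OF mods(2)] by (intro idl_norm_pos[OF fin2]) auto
  ultimately show ?thesis by (simp add: mult.commute)
qed

end

section \<open>Super-multiplicativity implies three generators\<close>

context num_ring
begin

lemma prod_scale:
  "prod_ideal_of (d *o X) (e *o Y) = (d * e) *o prod_ideal_of X Y"
proof
  show "prod_ideal_of (d *o X) (e *o Y) \<subseteq> (d * e) *o prod_ideal_of X Y"
  proof (rule prod_ideal_minimal)
    show "0 \<in> (d * e) *o prod_ideal_of X Y" using prod_ideal_0 by (intro elt_set_timesI[of 0]) auto
    show "x + y \<in> (d * e) *o prod_ideal_of X Y"
      if "x \<in> (d * e) *o prod_ideal_of X Y" "y \<in> (d * e) *o prod_ideal_of X Y" for x y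
      using that prod_ideal_add by (auto elim!: elt_set_timesE simp: distrib_left[symmetric] intro: elt_set_timesI)
    show "a * b \<in> (d * e) *o prod_ideal_of X Y" if ab: "a \<in> d *o X" "b \<in> e *o Y" for a b
    proof -
      obtain x y where "x \<in> X" "a = d * x" "y \<in> Y" "b = e * y" using ab by (auto elim!: elt_set_timesE)
      then show ?thesis by (intro elt_set_timesI[OF prod_idealI[of x X y Y]]) auto
    qed
  qed
  have "prod_ideal_of X Y \<subseteq> {z. d * e * z \<in> prod_ideal_of (d *o X) (e *o Y)}"
  proof (rule prod_ideal_minimal)
    show "a * b \<in> {z. d * e * z \<in> prod_ideal_of (d *o X) (e *o Y)}" if "a \<in> X" "b \<in> Y" for a b
      using prod_idealI[OF elt_set_timesI[OF that(1) refl] elt_set_timesI[OF that(2) refl], of d e]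
      by (simp add: mult_ac)
  qed (auto simp: distrib_left intro: prod_ideal_0 prod_ideal_add)
  then show "(d * e) *o prod_ideal_of X Y \<subseteq> prod_ideal_of (d *o X) (e *o Y)"
    by (auto elim!: elt_set_timesE)
qed

text \<open>\<open>D\<close> turns the fractional ideals into ideals \<open>DX\<close> and
  \<open>DY\<close> of \<open>B\<close>. Since \<open>[B:DX] [X:B] = [B:DB]\<close>, and similarly
  for \<open>Y\<close> and for \<open>D^2 XY\<close>, the inequality of norms is reversed when it is
  expressed by indices over \<open>B\<close>.\<close>

lemma index_prod_le:
  assumes B: "subring_of B" "A \<subseteq> B" "B \<subseteq> S" and super: "super_multiplicative B"
    and XY: "module_over B X" "module_over B Y" "B \<subseteq> X" "B \<subseteq> Y" "X \<subseteq> S" "Y \<subseteq> S"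
  shows "idl_norm (prod_ideal_of X Y) B \<le> idl_norm X B * idl_norm Y B"
proof -
  interpret B: num_ring B by (rule num_ring_overring[OF B(1,2) order_trans[OF B(3) S_subset_K]])
  interpret Sr: num_ring S by (rule num_ring_S)
  obtain D where D: "D > 0" "\<And>x. x \<in> S \<Longrightarrow> of_nat D * x \<in> A" using conductor by blast
  let ?d = "of_nat D :: 'a"
  have d0: "?d \<noteq> 0" using D by simp
  have dB: "?d *o Z \<subseteq> B" if "Z \<subseteq> S" for Z using D(2) that B(2) by (auto elim!: elt_set_timesE)
  have one: "1 \<in> B" by (rule B.A1)
  let ?XY = "prod_ideal_of X Y"
  have XYm: "module_over B ?XY" by (rule module_over_prod[OF XY(1)])
  have XYS: "?XY \<subseteq> S" using XY Sr.Amult by (intro prod_ideal_subset[OF Sr.module_over_A]) blast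
  have "X \<subseteq> ?XY" using prod_idealI[of _ X 1 Y] XY(4) one by auto
  then have BXY: "B \<subseteq> ?XY" using XY(3) by blast
  have tower: "idl_norm B ((c * ?d) *o Z) * idl_norm Z B = idl_norm B ((c * ?d) *o B)
      \<and> idl_norm Z B > 0 \<and> finite (cosets_of B ((c * ?d) *o Z))"
    if c: "c \<in> B" "c \<noteq> 0" and Z: "module_over B Z" "B \<subseteq> Z" "Z \<subseteq> S" for c Z
  proof -
    have sub: "(c * ?d) *o B \<subseteq> (c * ?d) *o Z" using Z(2) by (rule set_times_mono)
    have subB: "(c * ?d) *o Z \<subseteq> B"
    proof
      fix x assume "x \<in> (c * ?d) *o Z"
      then obtain z where z: "z \<in> Z" "x = c * (?d * z)" by (auto elim!: elt_set_timesE simp: mult.assoc)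
      then show "x \<in> B" using B.Amult[OF c(1)] dB[OF Z(3)] by (auto intro: elt_set_timesI)
    qed
    note sg = B.module_add_subgroup[OF B.module_principal[of "c * ?d"]] B.module_add_subgroup[OF B.module_scale[OF Z(1), of "c * ?d"]]
      B.add_subgroup_A
    have c0: "c * ?d \<noteq> 0" using c d0 by simp
    then have "(c * ?d) *o B \<noteq> {0}" using B.principal_mem(1)[of "c * ?d"] by (metis singletonD)
    then have fin: "finite (cosets_of B ((c * ?d) *o B))"
      by (rule B.finite_index_ideal[OF B.module_over_A B.module_principal order_trans[OF sub subB] order_refl])
    note t = index_tower[OF sg sub subB]
    note sc = index_scale[OF B.add_subgroup_A c0, of Z]
    have "finite (cosets_of Z B)" using fin t(2) sc(2) by blast
    then have "idl_norm Z B > 0" using Z(2) one by (intro idl_norm_pos) auto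
    then show ?thesis using t fin sc(1) by auto
  qed
  have tX: "idl_norm B (?d *o X) * idl_norm X B = idl_norm B (?d *o B)"
    and tY: "idl_norm B (?d *o Y) * idl_norm Y B = idl_norm B (?d *o B)"
    using tower[OF one one_neq_zero XY(1,3,5)] tower[OF one one_neq_zero XY(2,4,6)] by auto
  have dmem: "?d \<in> B" by (rule B.A_of_nat)
  have tXY: "idl_norm B ((?d * ?d) *o ?XY) * idl_norm ?XY B = idl_norm B ((?d * ?d) *o B)"
    and pos: "idl_norm ?XY B > 0" and fin: "finite (cosets_of B ((?d * ?d) *o ?XY))"
    using tower[OF dmem d0 XYm BXY XYS] by auto
  have finB: "finite (cosets_of B (?d *o B))"
    using tower[OF one one_neq_zero B.module_over_A order_refl B(3)] by simp
  have sgB: "add_subgroup (?d *o B)" by (rule B.module_add_subgroup[OF B.module_principal])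
  have sq: "idl_norm B ((?d * ?d) *o B) = idl_norm B (?d *o B) * idl_norm B (?d *o B)"
  proof -
    have "idl_norm B (?d *o (?d *o B)) = idl_norm B (?d *o B) * idl_norm (?d *o B) (?d *o (?d *o B))"
      by (intro index_tower add_subgroup_scale sgB B.add_subgroup_A set_times_mono dB B(3))
    then show ?thesis using index_scale(1)[OF sgB d0, of B] by (simp add: set_times_rearrange2)
  qed
  have "ideal_of B (?d *o X)" "ideal_of B (?d *o Y)"
    using dB XY B.module_scale by (auto simp: ideal_of_iff)
  then have le: "idl_norm B (?d *o X) * idl_norm B (?d *o Y) \<le> idl_norm B ((?d * ?d) *o ?XY)"
    using super fin unfolding super_multiplicative_def prod_scale[symmetric] by blast
  have "idl_norm B (?d *o X) * idl_norm B (?d *o Y) * idl_norm ?XY B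
      \<le> idl_norm B ((?d * ?d) *o ?XY) * idl_norm ?XY B" using le by simp
  also have "\<dots> = (idl_norm B (?d *o X) * idl_norm X B) * (idl_norm B (?d *o Y) * idl_norm Y B)"
    unfolding tXY sq tX tY ..
  also have "\<dots> = idl_norm B (?d *o X) * idl_norm B (?d *o Y) * (idl_norm X B * idl_norm Y B)"
    by (simp only: mult_ac)
  finally have "idl_norm B (?d *o X) * idl_norm B (?d *o Y) * idl_norm ?XY B
      \<le> idl_norm B (?d *o X) * idl_norm B (?d *o Y) * (idl_norm X B * idl_norm Y B)" .
  moreover have "idl_norm B (?d *o X) * idl_norm B (?d *o Y) > 0"
  proof -
    have "idl_norm B (?d *o B) > 0" using finB one by (intro idl_norm_pos) auto
    then show ?thesis using tX tY by (metis mult_is_0 neq0_conv)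
  qed
  ultimately show ?thesis by (simp only: mult_le_cancel1)
qed

end

section \<open>The fibre S/mS as an algebra over A/m\<close>

locale residue = num_ring +
  fixes m :: "'a set"
  assumes m: "maxid m"
begin

sublocale Sr: num_ring S by (rule num_ring_S)

abbreviation P :: "'a set" where "P \<equiv> prod_ideal_of m S"

lemma P_S: "module_over S P" "module_over A P" "P \<subseteq> S"
  using Sr.module_over_prod_right[OF Sr.module_over_A, of m] A_subset_S maxidD(2)[OF m]
    mprod_subset[OF module_over_subset[OF Sr.module_over_A A_subset_S] maxidD(2)[OF m]]
  by (auto intro: module_over_subset)

lemma m_S: "s \<in> m \<Longrightarrow> x \<in> S \<Longrightarrow> s * x \<in> P"
  by (rule prod_idealI)

lemma P_mult: "p \<in> P \<Longrightarrow> x \<in> S \<Longrightarrow> p * x \<in> P"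
  using module_overD(3)[OF P_S(1), of x p] by (simp add: mult.commute)

lemma module_P_adjoin: "module_over A (P + x *o A)" "P \<subseteq> P + x *o A" "x \<in> P + x *o A"
  using module_plus[OF P_S(2) module_principal] subset_plus[OF P_S(2) module_principal, of x] principal_mem(1)[of x]
  by auto

lemma cancel:
  "module_over A X \<Longrightarrow> P \<subseteq> X \<Longrightarrow> x \<in> S \<Longrightarrow> r \<in> A \<Longrightarrow> r \<notin> m \<Longrightarrow> r * x \<in> X \<Longrightarrow> x \<in> X"
  using maxid_module_cancel[OF m, of X x r] m_S by blast

lemma plus_1: "P + 1 *o A = A + P"
  by (simp add: add.commute)

lemma subring_AP: "subring_of (A + P)"
  unfolding subring_of_def
proof (intro conjI ballI)
  have AP: "module_over A (A + P)" by (intro module_plus module_over_A P_S)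
  show "0 \<in> A + P" by (rule module_overD(1)[OF AP])
  show "1 \<in> A + P" using subset_plus(1)[OF module_over_A P_S(2)] A1 by blast
  fix x y assume xy: "x \<in> A + P" "y \<in> A + P"
  show "x + y \<in> A + P" "x - y \<in> A + P" using module_overD(2)[OF AP xy] module_diff[OF AP xy] .
  obtain a p where ap: "a \<in> A" "p \<in> P" "x = a + p" using xy(1) by (rule set_plusE)
  have yS: "y \<in> S" using xy(2) plus_subset[OF module_over_subset[OF Sr.module_over_A A_subset_S] A_subset_S P_S(3)] by blast
  have "a * y + p * y \<in> A + P"
    using module_overD(3)[OF AP ap(1) xy(2)] P_mult[OF ap(2) yS] subset_plus(2)[OF module_over_A P_S(2)]
    by (intro module_overD(2)[OF AP]) auto
  then show "x * y \<in> A + P" unfolding ap(3) by (simp add: distrib_right)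
qed

lemma AP_S: "A \<subseteq> A + P" "A + P \<subseteq> S"
  using subset_plus(1)[OF module_over_A P_S(2)]
    plus_subset[OF module_over_subset[OF Sr.module_over_A A_subset_S] A_subset_S P_S(3)] by auto

lemma module_over_AP:
  assumes "module_over A X" "P \<subseteq> X" "X \<subseteq> S"
  shows "module_over (A + P) X"
  unfolding module_over_def
proof (intro conjI ballI)
  show "0 \<in> X" "\<And>x y. x \<in> X \<Longrightarrow> y \<in> X \<Longrightarrow> x + y \<in> X" using module_overD[OF assms(1)] by auto
  fix r x assume r: "r \<in> A + P" and x: "x \<in> X"
  obtain a p where ap: "a \<in> A" "p \<in> P" "r = a + p" using r by (rule set_plusE)
  have "a * x + p * x \<in> X"
    using module_overD(3)[OF assms(1) ap(1) x] P_mult[OF ap(2), of x] assms(2,3) x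
    by (intro module_overD(2)[OF assms(1)]) auto
  then show "r * x \<in> X" unfolding ap(3) by (simp add: distrib_right)
qed

end

text \<open>
  Here \<open>k = A/m\<close> and \<open>P = mS\<close>. If \<open>S/P\<close> had dimension at least 4 over \<open>k\<close>, super-multiplicativity of
  \<open>A + P\<close> would force \<open>1, a, b, ab\<close> to be dependent in \<open>S/P\<close> for all \<open>a, b\<close>. Such an algebra is \<open>k \<oplus> N\<close>
  with \<open>N\<^sup>2 = 0\<close> and \<open>dim N \<ge> 3\<close>, which is incompatible with every ideal of \<open>S\<close> being locally principal.
\<close>

locale fibre = residue +
  assumes super: "super_multiplicative (A + P)"
    and big: "idl_norm S P \<ge> idl_norm A m ^ 4"
begin

text \<open>With \<open>B = A + P\<close> and \<open>q = [A:m]\<close>, both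
  \<open>X = B + aA\<close> and \<open>Y = B + bA\<close> have index \<open>q\<close> over
  \<open>B\<close>. If \<open>ab\<close> were independent, \<open>XY\<close> would contain the span
  \<open>W\<close> of \<open>B\<close> and \<open>a, b, ab\<close>, of index \<open>q ^ 3\<close>,
  against the bound \<open>q ^ 2\<close> from \<open>index_prod_le\<close>.\<close>

lemma dependent:
  assumes ab: "a \<in> S" "b \<in> S" and a: "a \<notin> P + 1 *o A" and b: "b \<notin> P + 1 *o A + a *o A"
  shows "a * b \<in> P + 1 *o A + a *o A + b *o A"
proof (rule ccontr)
  assume nab: "a * b \<notin> P + 1 *o A + a *o A + b *o A"
  let ?B = "P + 1 *o A"
  define X Y Z W where "X = ?B + a *o A" and "Y = ?B + b *o A" and "Z = ?B + a *o A + b *o A"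
    and "W = ?B + a *o A + b *o A + (a * b) *o A"
  have SA: "module_over A S" by (rule module_over_subset[OF Sr.module_over_A A_subset_S])
  have B: "module_over A ?B" "P \<subseteq> ?B" "?B \<subseteq> S"
    using module_P_adjoin[of 1] AP_S(2) unfolding plus_1 by auto
  have mods: "module_over A X" "module_over A Y" "module_over A Z" "module_over A W"
    unfolding X_def Y_def Z_def W_def by (intro module_plus B module_principal)+
  have sub: "?B \<subseteq> X" "?B \<subseteq> Y" "X \<subseteq> Z" "Z \<subseteq> W"
    using subset_plus(1)[OF B(1) module_principal] subset_plus(1)[OF mods(1) module_principal]
      subset_plus(1)[OF mods(3) module_principal] unfolding X_def Y_def Z_def W_def by auto
  have abS: "a * b \<in> S" using ab by (rule Sr.Amult)
  have SX: "X \<subseteq> S" "Y \<subseteq> S"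
    unfolding X_def Y_def
    by (rule plus_subset[OF SA B(3) principal_subset[OF SA ab(1)]] plus_subset[OF SA B(3) principal_subset[OF SA ab(2)]])+
  note adj = index_adjoin[OF m _ _ finite_maxid[OF m]]
  have q1: "idl_norm X ?B = idl_norm A m" unfolding X_def
    using m_S ab B(2) a by (intro adj B(1)) blast+
  have b': "b \<notin> ?B" using b sub(1) X_def by blast
  have q2: "idl_norm Y ?B = idl_norm A m" unfolding Y_def
    using m_S ab B(2) b' by (intro adj B(1)) blast+
  have q3: "idl_norm Z X = idl_norm A m" unfolding Z_def X_def[symmetric]
    using m_S ab B(2) b sub(1) unfolding X_def[symmetric] by (intro adj mods(1)) blast+
  have q4: "idl_norm W Z = idl_norm A m" unfolding W_def Z_def[symmetric]
    using m_S abS B(2) nab sub(1,3) unfolding Z_def[symmetric] by (intro adj mods(3)) blast+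
  note sg = module_add_subgroup
  have q5: "idl_norm W ?B = idl_norm A m ^ 3"
    using index_tower(1)[OF sg[OF B(1)] sg[OF mods(3)] sg[OF mods(4)] order_trans[OF sub(1,3)] sub(4)]
      index_tower(1)[OF sg[OF B(1)] sg[OF mods(1)] sg[OF mods(3)] sub(1,3)] q1 q3 q4
    by (simp add: power3_eq_cube)
  let ?XY = "prod_ideal_of X Y"
  have XYm: "module_over A ?XY" by (rule module_over_prod[OF mods(1)])
  have XYS: "?XY \<subseteq> S" using SX Sr.Amult by (intro prod_ideal_subset[OF Sr.module_over_A]) blast
  have one: "1 \<in> ?B" using module_P_adjoin(3) .
  have mem: "a \<in> X" "b \<in> Y"
    using subset_plus(2)[OF B(1) module_principal] principal_mem(1) unfolding X_def Y_def by blast+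
  have XXY: "x \<in> ?XY" if "x \<in> X" for x using prod_idealI[OF that subsetD[OF sub(2) one]] by simp
  have bXY: "b \<in> ?XY" using prod_idealI[OF subsetD[OF sub(1) one] mem(2)] by simp
  have BXY: "?B \<subseteq> ?XY" using sub(1) XXY by blast
  have WXY: "W \<subseteq> ?XY" unfolding W_def
    by (rule plus_subset[OF XYm plus_subset[OF XYm plus_subset[OF XYm BXY principal_subset[OF XYm XXY[OF mem(1)]]]
          principal_subset[OF XYm bXY]] principal_subset[OF XYm prod_idealI[OF mem]]])
  have BW: "?B \<subseteq> W" using sub by blast
  obtain D where D: "D > 0" "\<And>x. x \<in> S \<Longrightarrow> of_nat D * x \<in> A" using conductor by blast
  have "finite (cosets_of ?XY ?B)"
    using XYS S_subset_K D(2) AP_S(1) WXY BW unfolding plus_1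
    by (intro finite_index[OF sg[OF XYm] sg[OF B(1), unfolded plus_1] _ _ D(1)]) blast+
  then have "idl_norm ?XY W > 0" and t: "idl_norm ?XY ?B = idl_norm ?XY W * idl_norm A m ^ 3"
    using index_tower[OF sg[OF B(1)] sg[OF mods(4)] sg[OF XYm] BW WXY] q5 prod_ideal_0[of X Y]
    by (auto intro!: idl_norm_pos)
  have le: "idl_norm ?XY ?B \<le> idl_norm X ?B * idl_norm Y ?B"
    unfolding plus_1
    by (rule index_prod_le[OF subring_AP AP_S super
          module_over_AP[OF mods(1) order_trans[OF B(2) sub(1)] SX(1)]
          module_over_AP[OF mods(2) order_trans[OF B(2) sub(2)] SX(2)]
          sub(1)[unfolded plus_1] sub(2)[unfolded plus_1] SX])
  have "idl_norm A m ^ 3 \<le> idl_norm A m ^ 2"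
  proof -
    have "idl_norm A m ^ 3 \<le> idl_norm ?XY W * idl_norm A m ^ 3" using \<open>idl_norm ?XY W > 0\<close> by simp
    also have "\<dots> \<le> idl_norm A m ^ 2" using le t q1 q2 by (simp add: power2_eq_square)
    finally show ?thesis .
  qed
  moreover have "idl_norm A m ^ 2 < idl_norm A m ^ 3"
    using idl_norm_maxid_ge_2[OF m finite_maxid[OF m]] by (intro power_strict_increasing) auto
  ultimately show False by simp
qed

lemma not_span_3:
  assumes "x \<in> S" "y \<in> S" "z \<in> S"
  shows "\<exists>w\<in>S. w \<notin> P + x *o A + y *o A + z *o A"
proof (rule ccontr)
  assume "\<not> ?thesis"
  moreover have "P + x *o A + y *o A + z *o A \<subseteq> S"
    using module_over_subset[OF Sr.module_over_A A_subset_S] P_S(3) assms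
    by (intro plus_subset principal_subset)
  ultimately have "P + x *o A + y *o A + z *o A = S" by blast
  moreover have "idl_norm (P + x *o A + y *o A + z *o A) P \<le> idl_norm A m ^ 3"
    using assms m_S by (intro index_adjoin_3_le[OF m P_S(2)]) auto
  moreover have "idl_norm A m ^ 3 < idl_norm A m ^ 4"
    using idl_norm_maxid_ge_2[OF m finite_maxid[OF m]] by (intro power_strict_increasing) auto
  ultimately show False using big by simp
qed

text \<open>These are the elements whose classes generate ideals of dimension at most 1 in
  \<open>S/P\<close>, the candidates for the square-zero part. Closure under addition is not built
  in; it is shown for the one sum that needs it.\<close>

definition N :: "'a set" where
  "N = {x \<in> S. \<forall>s\<in>S. x * s \<in> P + x *o A}"

text \<open>In the quotient of \<open>S\<close> by \<open>X = P + A + aA\<close> every nonzero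
  vector is an eigenvector of \<open>a\<close> by \<open>dependent\<close>, so \<open>a\<close> acts
  as one scalar \<open>l\<close>, that is, \<open>(a - l) S \<subseteq> X\<close>. A nonzero
  constant term of some \<open>(a - l) s\<close> would make \<open>a - l\<close> invertible modulo
  \<open>P\<close> and force \<open>S = X\<close>.\<close>

lemma ex_shift_N:
  assumes aS: "a \<in> S"
  shows "\<exists>l\<in>A. a - l \<in> N"
proof (cases "a \<in> P + 1 *o A")
  case True
  then obtain p l where pl: "p \<in> P" "l \<in> A" "a = p + l * 1" by (rule plus_principalE)
  then have "a - l = p" by simp
  moreover have "p \<in> N" unfolding N_def
    using pl(1) P_S(3) P_mult[OF pl(1)] module_P_adjoin(2)[of p] by blast
  ultimately show ?thesis using pl(2) by (intro bexI[of _ l]) auto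
next
  case False
  define X where "X = P + 1 *o A + a *o A"
  have X: "module_over A X" unfolding X_def by (intro module_plus P_S module_principal)
  have PX: "P \<subseteq> X" "1 \<in> X" "a \<in> X"
  proof -
    have "P + 1 *o A \<subseteq> X" "a *o A \<subseteq> X" unfolding X_def
      by (rule subset_plus[OF module_P_adjoin(1) module_principal])+
    then show "P \<subseteq> X" "1 \<in> X" "a \<in> X" using module_P_adjoin(2,3)[of 1] principal_mem(1)[of a] by auto
  qed
  have AX: "r \<in> X" if "r \<in> A" for r using module_overD(3)[OF X that PX(2)] by simp
  have oneS: "1 \<in> S" by (rule Sr.A1)
  have SA: "r \<in> S" if "r \<in> A" for r using that A_subset_S by blast
  obtain b where b: "b \<in> S" "b \<notin> X"
  proof -
    obtain w where w: "w \<in> S" "w \<notin> P + 1 *o A + a *o A + 0 *o A"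
      using not_span_3[OF oneS aS Sr.A0] by blast
    then have "w \<notin> X" using subset_plus(1)[OF X module_principal[of 0]] unfolding X_def by blast
    then show ?thesis using that w(1) by blast
  qed
  have Xb: "module_over A (X + b *o A)" "X \<subseteq> X + b *o A" "b \<in> X + b *o A"
    using module_plus[OF X module_principal] subset_plus[OF X module_principal, of b] principal_mem(1)[of b] by auto
  obtain b' where b': "b' \<in> S" "b' \<notin> X + b *o A"
    using not_span_3[OF oneS aS b(1)] unfolding X_def by blast
  have eig: "\<exists>n\<in>A. a * c - n * c \<in> X" if c: "c \<in> S" "c \<notin> X" for c
  proof -
    have "a * c \<in> X + c *o A" using dependent[OF aS c(1) False] c(2) unfolding X_def by blast
    then obtain u n where "u \<in> X" "n \<in> A" "a * c = u + n * c" by (rule plus_principalE)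
    then show ?thesis by (intro bexI[of _ n]) auto
  qed
  obtain l where l: "l \<in> A" "a * b - l * b \<in> X" using eig[OF b] by blast
  \<comment> \<open>\<open>b\<close> and \<open>c\<close> are independent modulo \<open>X\<close>,
    so the eigenvalues \<open>l\<close>, \<open>n\<close> and \<open>k\<close> of \<open>b\<close>,
    \<open>c\<close> and \<open>b + c\<close> agree modulo \<open>m\<close>.\<close>
  have out: "(a - l) * c \<in> X" if c: "c \<in> S" "c \<notin> X + b *o A" for c
  proof -
    have cX: "c \<notin> X" using c Xb by blast
    obtain n where n: "n \<in> A" "a * c - n * c \<in> X" using eig[OF c(1) cX] by blast
    have "b + c \<notin> X"
    proof
      assume "b + c \<in> X"
      then have "(b + c) - b \<in> X + b *o A" using Xb by (intro module_diff[OF Xb(1)]) auto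
      then show False using c by simp
    qed
    then obtain k where k: "k \<in> A" "a * (b + c) - k * (b + c) \<in> X" using eig[OF Sr.Aadd[OF b(1) c(1)]] by blast
    have "(a * (b + c) - k * (b + c)) - (a * b - l * b) - (a * c - n * c) \<in> X"
      by (rule module_diff[OF X module_diff[OF X k(2) l(2)] n(2)])
    then have rel: "(l - k) * b + (n - k) * c \<in> X" by (simp add: algebra_simps)
    have nk: "n - k \<in> m"
    proof (rule ccontr)
      assume nm: "n - k \<notin> m"
      have "((l - k) * b + (n - k) * c) - (l - k) * b \<in> X + b *o A"
        using rel Xb(2) module_overD(3)[OF Xb(1) Adiff[OF l(1) k(1)] Xb(3)] by (intro module_diff[OF Xb(1)]) auto
      then have "(n - k) * c \<in> X + b *o A" by simp
      then show False
        using cancel[OF Xb(1) _ c(1) Adiff[OF n(1) k(1)] nm] PX(1) Xb(2) c(2) by blast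
    qed
    have "((l - k) * b + (n - k) * c) - (n - k) * c \<in> X"
      using rel m_S[OF nk c(1)] PX(1) by (intro module_diff[OF X]) auto
    then have "(l - k) * b \<in> X" by simp
    then have lk: "l - k \<in> m" using cancel[OF X PX(1) b(1) Adiff[OF l(1) k(1)]] b(2) by blast
    have "(n - k) - (l - k) \<in> m" using nk lk by (rule module_diff[OF maxidD(3)[OF m]])
    then have "n - l \<in> m" by simp
    then have "(a * c - n * c) + (n - l) * c \<in> X"
      using n(2) m_S[OF _ c(1)] PX(1) by (intro module_overD(2)[OF X]) auto
    then show ?thesis by (simp add: algebra_simps)
  qed
  \<comment> \<open>A vector in the span of \<open>X\<close> and \<open>b\<close> is a difference of
    two vectors outside it, by means of \<open>b'\<close>; here the fourth dimension enters.\<close>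
  have all: "(a - l) * c \<in> X" if c: "c \<in> S" for c
  proof (cases "c \<in> X + b *o A")
    case True
    have "c + b' \<notin> X + b *o A"
    proof
      assume "c + b' \<in> X + b *o A"
      then have "(c + b') - c \<in> X + b *o A" using True by (rule module_diff[OF Xb(1)])
      then show False using b'(2) by simp
    qed
    then have "(a - l) * (c + b') - (a - l) * b' \<in> X"
      using out[OF Sr.Aadd[OF c b'(1)]] out[OF b'] by (intro module_diff[OF X]) auto
    then show ?thesis by (simp add: algebra_simps)
  next
    case False
    then show ?thesis by (rule out[OF c])
  qed
  let ?a = "a - l"
  have a'S: "?a \<in> S" using Sr.Adiff[OF aS SA[OF l(1)]] .
  have "?a * s \<in> P + ?a *o A" if s: "s \<in> S" for s
  proof -
    obtain u t where u: "u \<in> P + 1 *o A" "t \<in> A" "?a * s = u + t * a"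
      using all[OF s] unfolding X_def by (rule plus_principalE)
    obtain p r where p: "p \<in> P" "r \<in> A" "u = p + r * 1" using u(1) by (rule plus_principalE)
    \<comment> \<open>This is the coefficient of \<open>1\<close> when \<open>(a - l) s\<close> is
      written in terms of \<open>1\<close> and \<open>a - l\<close> instead of \<open>1\<close> and
      \<open>a\<close>.\<close>
    define \<rho> where "\<rho> = r + t * l"
    have \<rho>A: "\<rho> \<in> A" unfolding \<rho>_def using p u l by (intro Aadd Amult)
    have eq: "?a * s = p + \<rho> + t * ?a" using u p by (simp add: \<rho>_def algebra_simps)
    have "\<rho> \<in> m"
    proof (rule ccontr)
      assume \<rho>m: "\<rho> \<notin> m"
      have "c \<in> X" if c: "c \<in> S" for c
      proof -
        have \<rho>: "\<rho> = ?a * (s - t) - p" using eq by (simp add: algebra_simps)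
        have "\<rho> * c = ?a * ((s - t) * c) - p * c" unfolding \<rho> by (simp only: left_diff_distrib mult.assoc)
        also have "\<dots> \<in> X"
          using all[OF Sr.Amult[OF Sr.Adiff[OF s SA[OF u(2)]] c]] P_mult[OF p(1) c] PX(1)
          by (intro module_diff[OF X]) auto
        finally show ?thesis by (rule cancel[OF X PX(1) c \<rho>A \<rho>m])
      qed
      then show False using b by blast
    qed
    then have "p + \<rho> * 1 \<in> P" using p(1) m_S[OF _ oneS] by (intro module_overD(2)[OF P_S(2)]) auto
    then have "(p + \<rho>) + t * ?a \<in> P + ?a *o A" using u(2) by (intro plus_principalI) auto
    then show ?thesis unfolding eq .
  qed
  then show ?thesis using l(1) a'S unfolding N_def by blast
qed

lemma line_Int:
  assumes xy: "y \<in> S" "y \<notin> P + x *o A" and z: "z \<in> P + x *o A" "z \<in> P + y *o A"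
  shows "z \<in> P"
proof -
  obtain p r where pr: "p \<in> P" "r \<in> A" "z = p + r * y" using z(2) by (rule plus_principalE)
  have "r \<in> m"
  proof (rule ccontr)
    assume rm: "r \<notin> m"
    have "z - p \<in> P + x *o A" using z(1) pr(1) module_P_adjoin(2) by (intro module_diff[OF module_P_adjoin(1)]) auto
    then have "r * y \<in> P + x *o A" using pr by simp
    then show False using cancel[OF module_P_adjoin(1,2) xy(1) pr(2) rm] xy(2) by blast
  qed
  then show ?thesis unfolding pr(3) using pr(1) m_S[OF _ xy(1)] by (intro module_overD(2)[OF P_S(2)]) auto
qed

text \<open>The product lies on the line of \<open>x\<close> and on the line of \<open>y\<close>,
  and these meet in \<open>P\<close> only.\<close>

lemma N_mult:
  assumes "x \<in> N" "y \<in> N" "y \<notin> P + x *o A"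
  shows "x * y \<in> P"
proof (rule line_Int[of y x])
  show "y \<in> S" "x * y \<in> P + x *o A" using assms by (auto simp: N_def)
  have "y * x \<in> P + y *o A" using assms by (auto simp: N_def)
  then show "x * y \<in> P + y *o A" by (simp add: mult.commute)
qed (rule assms(3))

text \<open>For independent \<open>x\<close>, \<open>y\<close> in the square-zero part,
  \<open>xS + yS\<close> cannot be locally principal. Concretely, the \<open>\<alpha>\<close> of
  \<open>pruefer\<close> satisfies \<open>\<alpha> x = 0\<close> and
  \<open>(1 - \<alpha>) y = 0\<close> modulo \<open>P\<close>, but acts on both as one scalar
  \<open>k\<close>; so \<open>k\<close> and \<open>1 - k\<close> would lie in
  \<open>m\<close>.\<close>

lemma contradiction: False
proof -
  have oneS: "1 \<in> S" and zS: "0 \<in> S" by (rule Sr.A1, rule Sr.A0)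
  have SA: "r \<in> S" if "r \<in> A" for r using that A_subset_S by blast
  have NS: "x \<in> S" if "x \<in> N" for x using that by (simp add: N_def)
  \<comment> \<open>By \<open>ex_shift_N\<close> every element of \<open>S\<close> differs from one
    of \<open>N\<close> by an element of \<open>A\<close>, so a submodule containing
    \<open>1\<close> misses an element of \<open>N\<close> as soon as it misses one of
    \<open>S\<close>.\<close>
  have shift: "\<exists>x\<in>N. x \<notin> X" if X: "module_over A X" "1 \<in> X" "w \<in> S" "w \<notin> X" for X w
  proof -
    obtain l where l: "l \<in> A" "w - l \<in> N" using ex_shift_N[OF X(3)] by blast
    have "w - l \<notin> X"
    proof
      assume "w - l \<in> X"
      then have "(w - l) + l * 1 \<in> X" using module_overD(3)[OF X(1) l(1) X(2)] by (intro module_overD(2)[OF X(1)])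
      then show False using X(4) by simp
    qed
    then show ?thesis using l by blast
  qed
  have chain: "Y \<subseteq> Y + z *o A" "z \<in> Y + z *o A" "module_over A (Y + z *o A)" if "module_over A Y" for Y z
    using subset_plus[OF that module_principal, of z] principal_mem(1)[of z] module_plus[OF that module_principal] by auto
  define X1 where "X1 = P + 1 *o A"
  have X1: "module_over A X1" "P \<subseteq> X1" "1 \<in> X1" unfolding X1_def by (rule module_P_adjoin)+
  obtain x where x: "x \<in> N" "x \<notin> X1"
  proof -
    obtain w where w: "w \<in> S" "w \<notin> X1 + 0 *o A + 0 *o A" using not_span_3[OF oneS zS zS] unfolding X1_def by blast
    then have "w \<notin> X1" using chain(1)[OF X1(1), of 0] chain(1)[OF chain(3)[OF X1(1)], of 0 0] by blast
    then show ?thesis using shift[OF X1(1,3) w(1)] that by blast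
  qed
  define X2 where "X2 = X1 + x *o A"
  have X2: "module_over A X2" "X1 \<subseteq> X2" "x \<in> X2" unfolding X2_def by (rule chain[OF X1(1)])+
  obtain y where y: "y \<in> N" "y \<notin> X2"
  proof -
    obtain w where w: "w \<in> S" "w \<notin> X2 + 0 *o A"
      using not_span_3[OF oneS NS[OF x(1)] zS] unfolding X2_def X1_def by blast
    then have "w \<notin> X2" using chain(1)[OF X2(1), of 0] by blast
    moreover have "1 \<in> X2" using X1(3) X2(2) by blast
    ultimately show ?thesis using shift[OF X2(1) _ w(1)] that by blast
  qed
  define X3 where "X3 = X2 + y *o A"
  have X3: "module_over A X3" "X2 \<subseteq> X3" "y \<in> X3" unfolding X3_def by (rule chain[OF X2(1)])+
  obtain w where w: "w \<in> N" "w \<notin> X3"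
  proof -
    obtain w where "w \<in> S" "w \<notin> X3"
      using not_span_3[OF oneS NS[OF x(1)] NS[OF y(1)]] unfolding X3_def X2_def X1_def by blast
    moreover have "1 \<in> X3" using X1(3) X2(2) X3(2) by blast
    ultimately show ?thesis using shift[OF X3(1)] that by blast
  qed
  have line_sub: "P + z *o A \<subseteq> Y" if "module_over A Y" "P \<subseteq> Y" "z \<in> Y" for Y z
    by (rule plus_subset[OF that(1,2) principal_subset[OF that(1,3)]])
  have PX: "P \<subseteq> X2" "P \<subseteq> X3" using X1 X2 X3 by auto
  have yx: "y \<notin> P + x *o A" using line_sub[OF X2(1) PX(1) X2(3)] y(2) by blast
  have wx: "w \<notin> P + x *o A" using line_sub[OF X3(1) PX(2), of x] X2(3) X3(2) w(2) by blast
  have wy: "w \<notin> P + y *o A" using line_sub[OF X3(1) PX(2) X3(3)] w(2) by blast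
  have xP: "x \<notin> P" using x(2) X1 by blast
  have yP: "y \<notin> P" using y(2) PX by blast
  have xy0: "x * y \<in> P" by (rule N_mult[OF x(1) y(1) yx])
  have xw0: "x * w \<in> P" by (rule N_mult[OF x(1) w(1) wx])
  have yw0: "y * w \<in> P" by (rule N_mult[OF y(1) w(1) wy])
  have xyS: "x \<in> S" "y \<in> S" "w \<in> S" using x y w NS by auto
  obtain l where l: "l \<in> A" "(x + y) - l \<in> N" using ex_shift_N[OF Sr.Aadd[OF xyS(1,2)]] by blast
  define z where "z = (x + y) - l"
  have zN: "z \<in> N" using l by (simp add: z_def)
  have zX3: "z \<in> X3"
  proof -
    have "x \<in> X3" "l * 1 \<in> X3" using X1 X2 X3 l(1) module_overD(3)[OF X3(1)] by blast+
    then show ?thesis unfolding z_def using X3 module_diff[OF X3(1) module_overD(2)[OF X3(1)]] by simp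
  qed
  \<comment> \<open>\<open>w\<close> annihilates \<open>x + y\<close> modulo \<open>P\<close>, so
    \<open>l * w\<close> lies on the line of \<open>z = x + y - l\<close>. As \<open>w\<close> is
    not on that line, \<open>l\<close> vanishes modulo \<open>m\<close>.\<close>
  have lm: "l \<in> m"
  proof (rule ccontr)
    assume "l \<notin> m"
    have "z * w \<in> P + z *o A" using zN xyS(3) by (simp add: N_def)
    then have "(x * w + y * w) - z * w \<in> P + z *o A"
      using module_overD(2)[OF P_S(2) xw0 yw0] module_P_adjoin(2)[of z] by (intro module_diff[OF module_P_adjoin(1)]) auto
    moreover have "(x * w + y * w) - z * w = l * w" by (simp add: z_def algebra_simps)
    ultimately have "w \<in> P + z *o A" using cancel[OF module_P_adjoin(1,2) xyS(3) l(1) \<open>l \<notin> m\<close>] by simp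
    then show False using line_sub[OF X3(1) PX(2) zX3] w(2) by blast
  qed
  have lP: "l * s \<in> P" if "s \<in> S" for s by (rule m_S[OF lm that])
  have xpy: "x + y \<in> N"
    unfolding N_def
  proof (intro CollectI conjI ballI)
    show "x + y \<in> S" using xyS by (intro Sr.Aadd)
    fix s assume s: "s \<in> S"
    note L = module_P_adjoin[of "x + y"]
    have "z \<in> P + (x + y) *o A" unfolding z_def
      using L lP[OF oneS] by (intro module_diff[OF L(1)]) auto
    then have "P + z *o A \<subseteq> P + (x + y) *o A" by (rule line_sub[OF L(1,2)])
    then have "z * s + l * s \<in> P + (x + y) *o A"
      using zN s lP[OF s] L(2) by (intro module_overD(2)[OF L(1)]) (auto simp: N_def)
    then show "(x + y) * s \<in> P + (x + y) *o A" by (simp add: z_def algebra_simps)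
  qed
  \<comment> \<open>\<open>N_mult\<close> says nothing about squares; they are reached through the
    independent pairs \<open>x, x + y\<close> and \<open>y, x + y\<close>.\<close>
  have "x + y \<notin> P + x *o A"
  proof
    assume "x + y \<in> P + x *o A"
    then have "(x + y) - x \<in> P + x *o A" by (rule module_diff[OF module_P_adjoin(1) _ module_P_adjoin(3)])
    then show False using yx by simp
  qed
  then have "x * (x + y) \<in> P" by (rule N_mult[OF x(1) xpy])
  then have "x * (x + y) - x * y \<in> P" using xy0 by (rule module_diff[OF P_S(2)])
  then have xx: "x * x \<in> P" by (simp add: algebra_simps)
  have "x + y \<notin> P + y *o A"
  proof
    assume "x + y \<in> P + y *o A"
    then have "(x + y) - y \<in> P + y *o A" by (rule module_diff[OF module_P_adjoin(1) _ module_P_adjoin(3)])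
    then have "x \<in> P" using line_Int[OF xyS(2) yx module_P_adjoin(3)] by simp
    then show False using xP by simp
  qed
  then have "y * (x + y) \<in> P" by (rule N_mult[OF y(1) xpy])
  then have "y * (x + y) - x * y \<in> P" using xy0 by (rule module_diff[OF P_S(2)])
  then have yy: "y * y \<in> P" by (simp add: algebra_simps)
  have xyK: "x \<in> K" "y \<in> K" using xyS S_subset_K by auto
  obtain \<alpha> where \<alpha>: "\<alpha> \<in> S" "\<alpha> * x \<in> y *o S" "(1 - \<alpha>) * y \<in> x *o S" using pruefer[OF xyK] by blast
  have \<alpha>1: "1 - \<alpha> \<in> S" using Sr.Adiff[OF oneS \<alpha>(1)] .
  have mulN: "v \<in> P + u *o A" if "u \<in> N" "v \<in> u *o S" for u v
    using that by (auto simp: N_def elim!: elt_set_timesE)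
  have \<alpha>x: "\<alpha> * x \<in> P"
    by (rule line_Int[OF xyS(2) yx mulN[OF x(1) elt_set_timesI[OF \<alpha>(1) mult.commute]] mulN[OF y(1) \<alpha>(2)]])
  have \<alpha>y: "(1 - \<alpha>) * y \<in> P"
    by (rule line_Int[OF xyS(2) yx mulN[OF x(1) \<alpha>(3)] mulN[OF y(1) elt_set_timesI[OF \<alpha>1 mult.commute]]])
  obtain k where k: "k \<in> A" "\<alpha> - k \<in> N" using ex_shift_N[OF \<alpha>(1)] by blast
  \<comment> \<open>\<open>\<alpha> - k\<close> annihilates \<open>u\<close> modulo
    \<open>P\<close>: if it is on the line of \<open>u\<close>, because
    \<open>u * u \<in> P\<close>, and otherwise by \<open>N_mult\<close>.\<close>
  have kill: "(\<alpha> - k) * u \<in> P" if u: "u \<in> N" "u * u \<in> P" for u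
  proof (cases "\<alpha> - k \<in> P + u *o A")
    case True
    then obtain p t where pt: "p \<in> P" "t \<in> A" "\<alpha> - k = p + t * u" by (rule plus_principalE)
    have "p * u + t * (u * u) \<in> P"
      using P_mult[OF pt(1) NS[OF u(1)]] module_overD(3)[OF P_S(2) pt(2) u(2)] by (rule module_overD(2)[OF P_S(2)])
    then show ?thesis unfolding pt(3) by (simp add: distrib_right mult.assoc)
  next
    case False
    then have "u * (\<alpha> - k) \<in> P" by (rule N_mult[OF u(1) k(2)])
    then show ?thesis by (simp add: mult.commute)
  qed
  have "\<alpha> * x - (\<alpha> - k) * x \<in> P" using \<alpha>x kill[OF x(1) xx] by (rule module_diff[OF P_S(2)])
  then have "k * x \<in> P" by (simp add: algebra_simps)
  then have km: "k \<in> m" using cancel[OF P_S(2) order_refl xyS(1) k(1)] xP by blast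
  have "(1 - \<alpha>) * y + (\<alpha> - k) * y \<in> P" using \<alpha>y kill[OF y(1) yy] by (rule module_overD(2)[OF P_S(2)])
  then have "(1 - k) * y \<in> P" by (simp add: algebra_simps)
  then have "1 - k \<in> m" using cancel[OF P_S(2) order_refl xyS(2) Adiff[OF A1 k(1)]] yP by blast
  then have "(1 - k) + k \<in> m" using km by (rule module_overD(2)[OF maxidD(3)[OF m]])
  then show False using maxidD(5)[OF m] by simp
qed

end

section \<open>Gluing local generators\<close>

context num_ring
begin

text \<open>If no triple generates, neither do triples padded with 0, so \<open>a\<close>,
  \<open>b\<close> and \<open>c\<close> can be chosen one after another outside the span so far; the
  resulting strict chain up to \<open>I\<close> is too long.\<close>

lemma ex_local_generators:
  assumes n: "maxid n" and I: "module_over A I" and fin: "finite (cosets_of I (prod_ideal_of n I))"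
    and small: "idl_norm I (prod_ideal_of n I) < idl_norm A n ^ 4"
  shows "\<exists>a\<in>I. \<exists>b\<in>I. \<exists>c\<in>I. prod_ideal_of n I + a *o A + b *o A + c *o A = I"
proof (rule ccontr)
  let ?P = "prod_ideal_of n I"
  assume no: "\<not> ?thesis"
  have P: "module_over A ?P" "?P \<subseteq> I" using module_over_prod_right[OF I] mprod_subset[OF I maxidD(2)[OF n]] by auto
  have grow: "module_over A (Y + y *o A)" "Y \<subseteq> Y + y *o A" "y \<in> Y + y *o A" if "module_over A Y" for Y y
    using module_plus[OF that module_principal] subset_plus[OF that module_principal, of y] principal_mem(1)[of y] by auto
  have sub: "?P + a *o A + b *o A + c *o A \<subset> I" if "a \<in> I" "b \<in> I" "c \<in> I" for a b c
  proof -
    have "?P + a *o A + b *o A + c *o A \<subseteq> I" by (intro plus_subset[OF I] P principal_subset[OF I] that)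
    then show ?thesis using no that by blast
  qed
  note z = module_overD(1)[OF I]
  note gr = grow[OF P(1)]
  obtain a where a: "a \<in> I" "a \<notin> ?P"
    using sub[OF z z z] gr(2)[of 0] grow(2)[OF gr(1)[of 0], of 0] grow(2)[OF grow(1)[OF gr(1)[of 0], of 0], of 0] by blast
  note ga = gr[of a] grow[OF gr(1)[of a]]
  obtain b where b: "b \<in> I" "b \<notin> ?P + a *o A"
    using sub[OF a(1) z z] ga(5)[of 0] grow(2)[OF ga(4)[of 0], of 0] by blast
  note gb = ga(4-6)[of b] grow[OF ga(4)[of b]]
  obtain c where c: "c \<in> I" "c \<notin> ?P + a *o A + b *o A"
    using sub[OF a(1) b(1) z] gb(5)[of 0] by blast
  note gc = gb(4-6)[of c]
  show False
  proof (rule no_chain_of_length_4[OF n I fin small ga(1) gb(1) gc(1)])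
    show "?P \<subset> ?P + a *o A" using ga(2,3) a(2) by blast
    show "?P + a *o A \<subset> ?P + a *o A + b *o A" using gb(2,3) b(2) by blast
    show "?P + a *o A + b *o A \<subset> ?P + a *o A + b *o A + c *o A" using gc(2,3) c(2) by blast
    show "?P + a *o A + b *o A + c *o A \<subset> I" by (rule sub[OF a(1) b(1) c(1)])
  qed
qed

text \<open>The pair \<open>a\<close>, \<open>b\<close> approximates local generators where
  \<open>I \<subseteq> n\<close> and contains a local unit elsewhere, where \<open>I\<close> is
  locally all of \<open>A\<close>. So \<open>c\<close> has to satisfy the approximation
  only.\<close>

lemma generated_by_3_if_local:
  assumes I: "ideal_of A I"
    and small: "\<And>n. maxid n \<Longrightarrow> I \<noteq> {0} \<Longrightarrow> idl_norm I (prod_ideal_of n I) < idl_norm A n ^ 4"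
  shows "generated_by_3 A I"
proof (cases "I = {0}")
  case True
  then show ?thesis unfolding generated_by_3_def using A0 by (intro bexI[of _ 0]) auto
next
  case False
  have m: "module_over A I" "I \<subseteq> A" using I by (auto simp: ideal_of_iff)
  obtain w where w: "w \<in> I" "w \<noteq> 0" using False module_overD(1)[OF m(1)] by blast
  have fin: "finite (cosets_of I (prod_ideal_of n I))" if n: "maxid n" for n
  proof (rule finite_index_ideal[OF m(1) module_over_prod_right[OF m(1)] mprod_subset[OF m(1) maxidD(2)[OF n]] m(2)])
    obtain s where s: "s \<in> n" "s \<noteq> 0" using maxidD(4)[OF n] module_overD(1)[OF maxidD(3)[OF n]] by blast
    have "s * w \<noteq> 0" using s(2) w(2) by simp
    then show "prod_ideal_of n I \<noteq> {0}" using prod_idealI[OF s(1) w(1)] by (metis singletonD)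
  qed
  have gens: "\<exists>v. fst v \<in> I \<and> fst (snd v) \<in> I \<and> snd (snd v) \<in> I \<and>
      prod_ideal_of n I + fst v *o A + fst (snd v) *o A + snd (snd v) *o A = I" if n: "maxid n" for n
  proof -
    obtain a b c where "a \<in> I" "b \<in> I" "c \<in> I" "prod_ideal_of n I + a *o A + b *o A + c *o A = I"
      using ex_local_generators[OF n m(1) fin[OF n] small[OF n False]] by blast
    then show ?thesis by (intro exI[of _ "(a, b, c)"]) simp
  qed
  have "\<exists>f. \<forall>n\<in>Collect maxid. fst (f n) \<in> I \<and> fst (snd (f n)) \<in> I \<and> snd (snd (f n)) \<in> I \<and>
      prod_ideal_of n I + fst (f n) *o A + fst (snd (f n)) *o A + snd (snd (f n)) *o A = I"
    using gens by (intro bchoice) simp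
  then obtain f where f: "\<And>n. maxid n \<Longrightarrow> fst (f n) \<in> I" "\<And>n. maxid n \<Longrightarrow> fst (snd (f n)) \<in> I"
    "\<And>n. maxid n \<Longrightarrow> snd (snd (f n)) \<in> I"
    "\<And>n. maxid n \<Longrightarrow> prod_ideal_of n I + fst (f n) *o A + fst (snd (f n)) *o A + snd (snd (f n)) *o A = I" by blast
  note approx = ex_approx_pair[OF m m order_refl order_refl w]
  obtain a b where a: "a \<in> I" "a \<noteq> 0" and b: "b \<in> I"
    and ab: "\<And>n. maxid n \<Longrightarrow> I \<subseteq> n \<Longrightarrow> a - fst (f n) \<in> prod_ideal_of n I \<and> b - fst (snd (f n)) \<in> prod_ideal_of n I"
    "\<And>n. maxid n \<Longrightarrow> \<not> I \<subseteq> n \<Longrightarrow> a \<notin> n \<or> b \<notin> n"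
    using approx[of "\<lambda>n. fst (f n)" "\<lambda>n. fst (snd (f n))", OF f(1,2)] by blast
  obtain c where c: "c \<in> I" "\<And>n. maxid n \<Longrightarrow> I \<subseteq> n \<Longrightarrow> c - snd (snd (f n)) \<in> prod_ideal_of n I"
    using approx[of "\<lambda>n. snd (snd (f n))" "\<lambda>n. snd (snd (f n))", OF f(3,3)] by blast
  define L where "L = a *o A + b *o A + c *o A"
  have abm: "module_over A (a *o A + b *o A)" by (intro module_plus module_principal)
  have Lm: "module_over A L" unfolding L_def by (intro module_plus module_principal)
  have LI: "L \<subseteq> I" unfolding L_def by (intro plus_subset[OF m(1)] principal_subset[OF m(1)] a b c)
  have Lmem: "a \<in> L" "b \<in> L" "c \<in> L"
    using subset_plus[OF module_principal[of a] module_principal[of b]] subset_plus[OF abm module_principal, of c]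
      principal_mem(1)[of a] principal_mem(1)[of b] principal_mem(1)[of c] unfolding L_def by auto
  have "L = I"
  proof (rule ccontr)
    assume "L \<noteq> I"
    moreover have "L \<noteq> {0}" using Lmem(1) a(2) by auto
    ultimately obtain n where n: "maxid n" "L + prod_ideal_of n I \<noteq> I"
      using ex_separating_maxid[OF Lm m(1) _ m(2)] LI by blast
    let ?P = "prod_ideal_of n I"
    have P: "module_over A ?P" "?P \<subseteq> I"
      using module_over_prod_right[OF m(1)] mprod_subset[OF m(1) maxidD(2)[OF n(1)]] by auto
    let ?M = "L + ?P"
    have M: "module_over A ?M" "L \<subseteq> ?M" "?P \<subseteq> ?M" "?M \<subseteq> I"
      using module_plus[OF Lm P(1)] subset_plus[OF Lm P(1)] plus_subset[OF m(1) LI P(2)] by auto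
    have unit: "I \<subseteq> ?M" if e: "e \<in> L" "e \<notin> n" for e
    proof
      fix x assume x: "x \<in> I"
      have "x * e \<in> ?M" using module_overD(3)[OF Lm _ e(1), of x] x m(2) M(2) by blast
      moreover have "e \<in> A" using e(1) LI m(2) by blast
      moreover have "s * x \<in> ?M" if "s \<in> n" for s using prod_idealI[OF that x] M(3) by blast
      ultimately show "x \<in> ?M"
        using maxid_module_cancel[OF n(1) M(1), of x e] e(2) by (simp add: mult.commute)
    qed
    have "I \<subseteq> ?M"
    proof (cases "I \<subseteq> n")
      case True
      have near: "v \<in> ?M" if uv: "u \<in> L" "u - v \<in> ?P" for u v
      proof -
        have "u - (u - v) \<in> ?M"
          by (rule module_diff[OF M(1) subsetD[OF M(2) uv(1)] subsetD[OF M(3) uv(2)]])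
        then show ?thesis by simp
      qed
      have "fst (f n) \<in> ?M" "fst (snd (f n)) \<in> ?M" "snd (snd (f n)) \<in> ?M"
        using near[OF Lmem(1)] near[OF Lmem(2)] near[OF Lmem(3) c(2)[OF n(1) True]] ab(1)[OF n(1) True] by blast+
      then have "prod_ideal_of n I + fst (f n) *o A + fst (snd (f n)) *o A + snd (snd (f n)) *o A \<subseteq> ?M"
        using M(3) by (intro plus_subset[OF M(1)] principal_subset[OF M(1)])
      then show ?thesis using f(4)[OF n(1)] by simp
    next
      case False
      then show ?thesis using ab(2)[OF n(1)] unit[OF Lmem(1)] unit[OF Lmem(2)] by blast
    qed
    then show False using n(2) M(4) by blast
  qed
  moreover have "L = {r * a + s * b + t * c | r s t. r \<in> A \<and> s \<in> A \<and> t \<in> A}"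
    unfolding L_def set_plus_def elt_set_times_def by (auto simp: mult.commute)
  ultimately have eq: "I = {r * a + s * b + t * c | r s t. r \<in> A \<and> s \<in> A \<and> t \<in> A}" by simp
  have "a \<in> A" "b \<in> A" "c \<in> A" using a b c m(2) by auto
  then show ?thesis unfolding generated_by_3_def using eq
    by (intro bexI[of _ a] bexI[of _ b] bexI[of _ c])
qed

text \<open>By \<open>index_le_index_S\<close> it suffices to bound the fibre of \<open>S\<close> at
  \<open>n\<close>, and a fibre of dimension at least 4 contradicts super-multiplicativity of the
  single ring \<open>A + nS\<close>.\<close>

lemma generated_by_3_if_super_multiplicative:
  assumes super: "\<And>B. subring_of B \<Longrightarrow> A \<subseteq> B \<Longrightarrow> B \<subseteq> normalization_of A \<Longrightarrow> super_multiplicative B"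
    and I: "ideal_of A I"
  shows "generated_by_3 A I"
proof (rule generated_by_3_if_local[OF I])
  fix n assume n: "maxid n" and I0: "I \<noteq> {0}"
  interpret Sr: num_ring S by (rule num_ring_S)
  have "idl_norm S (prod_ideal_of n S) < idl_norm A n ^ 4"
  proof (rule ccontr)
    assume big: "\<not> ?thesis"
    interpret residue A n by unfold_locales (rule n)
    have "super_multiplicative (A + prod_ideal_of n S)"
      using subring_AP AP_S S_subset_normalization by (intro super) auto
    then interpret fibre A n using big by unfold_locales auto
    show False by (rule contradiction)
  qed
  then show "idl_norm I (prod_ideal_of n I) < idl_norm A n ^ 4"
    using index_le_index_S[OF n I I0] by linarith
qed

end

theorem theorem1p1:
  fixes R :: "'a::field_char_0 set"
  assumes "number_ring R"
  shows "(\<forall>I. ideal_of R I \<longrightarrow> generated_by_3 R I) \<longleftrightarrow>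
         (\<forall>R'. subring_of R' \<and> R \<subseteq> R' \<and> R' \<subseteq> normalization_of R \<longrightarrow>
               super_multiplicative R')"
proof -
  interpret num_ring R by unfold_locales (rule assms)
  show ?thesis
  proof (intro iffI allI impI; (elim conjE)?)
    fix R' assume gen: "\<forall>I. ideal_of R I \<longrightarrow> generated_by_3 R I"
      and R': "subring_of R'" "R \<subseteq> R'" "R' \<subseteq> normalization_of R"
    have K: "R' \<subseteq> K" using R'(3) by (auto simp: normalization_of_def)
    interpret R': num_ring R' by (rule num_ring_overring[OF R'(1,2) K])
    show "super_multiplicative R'"
      using generated_by_3_overring[OF _ R'(1,2) K] gen by (intro R'.super_multiplicative_if_generated_by_3) blast
  next
    fix I assume "\<forall>R'. subring_of R' \<and> R \<subseteq> R' \<and> R' \<subseteq> normalization_of R \<longrightarrow> super_multiplicative R'"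
      and "ideal_of R I"
    then show "generated_by_3 R I" by (intro generated_by_3_if_super_multiplicative) auto
  qed
qed

end
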